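(* Let $c>0$, and let $\mathbb{S}^r(c)$ and $\mathbb{H}^r(-c)$ denote the $r$-dimensional space forms of constant curvature $c$ and $-c$, respectively. (1) For every $r\ge4$, the Riemannian product $\mathbb{S}^r(c)\times\mathbb{H}^r(-c)$ is $4$-Thorpe but not $4$-anti-Thorpe. (2) For every $r\ge6$, the Riemannian product $\mathbb{S}^r(c)\times\mathbb{H}^r(-c)$ is both $4$-Thorpe and $6$-anti-Thorpe.
   Context: Double forms: for a Euclidean space $(V,g)$ of dimension $n$, a $(p,q)$ double form is an element of $\Lambda^pV^*\otimes\Lambda^qV^*$. The exterior product of double forms is $(\alpha_1\otimes\beta_1)(\alpha_2\otimes\beta_2)=(\alpha_1\wedge\alpha_2)\otimes(\beta_1\wedge\beta_2)$, and powers are taken for this product. The metric $g=\sum e^i\otimes e^i$ is a $(1,1)$ double form. The (double) Hodge star is $\star(\theta_1\otimes\theta_2)=(\star\theta_1)\otimes(\star\theta_2)$. On a Riemannian manifold these notions are applied fibrewise. The Riemann curvature tensor $R$ is viewed as a symmetric $(2,2)$ double form, with sign such that $R(x\wedge y;x\wedge y)$ is the sectional curvature for orthonormal $x,y$; $R^k$ is its $k$-th exterior power, a $(2k,2k)$ double form. A Riemannian manifold of even dimension $n=2r$ is $(2k)$-Thorpe (with $2\le 2k\le r$) if $\star(g^{r-2k}R^k)=g^{r-2k}R^k$, and $(2k)$-anti-Thorpe if $\star(g^{r-2k}R^k)=-g^{r-2k}R^k$. *)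

theory Defs
  imports "HOL-Analysis.Analysis" "HOL-Combinatorics.Permutations"
begin

text \<open>A \<open>p\<close>-form is represented by the multilinear function of the entries
  \<open>x 0, \<dots>, x (p - 1)\<close> of a sequence of vectors \<open>x\<close>; it ignores all further entries. The degrees
  are passed explicitly. An element of $\Lambda^p V^* \otimes \Lambda^q V^*$ is likewise a function
  of two such sequences.\<close>

type_synonym 'v form = "(nat \<Rightarrow> 'v) \<Rightarrow> real"
type_synonym 'v dform = "(nat \<Rightarrow> 'v) \<Rightarrow> (nat \<Rightarrow> 'v) \<Rightarrow> real"

definition tensor :: "'v form \<Rightarrow> 'v form \<Rightarrow> 'v dform" where
  "tensor \<alpha> \<beta> = (\<lambda>x y. \<alpha> x * \<beta> y)"

definition wedge :: "nat \<Rightarrow> nat \<Rightarrow> 'v form \<Rightarrow> 'v form \<Rightarrow> 'v form" where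
  "wedge p p' \<alpha> \<alpha>' = (\<lambda>x.
     (\<Sum>\<sigma> | \<sigma> permutes {..<p + p'}.
        of_int (sign \<sigma>) * \<alpha> (\<lambda>i. x (\<sigma> i)) * \<alpha>' (\<lambda>i. x (\<sigma> (p + i))))
     / (fact p * fact p'))"

text \<open>The exterior product of a \<open>(p, q)\<close> and a \<open>(p', q')\<close> double form is the bilinear extension of
  the rule \<open>dwedge_tensor\<close> below.\<close>

definition dwedge :: "nat \<Rightarrow> nat \<Rightarrow> nat \<Rightarrow> nat \<Rightarrow> 'v dform \<Rightarrow> 'v dform \<Rightarrow> 'v dform" where
  "dwedge p q p' q' \<omega> \<omega>' = (\<lambda>x y.
     (\<Sum>\<sigma> | \<sigma> permutes {..<p + p'}. \<Sum>\<tau> | \<tau> permutes {..<q + q'}.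
        of_int (sign \<sigma>) * of_int (sign \<tau>)
        * \<omega> (\<lambda>i. x (\<sigma> i)) (\<lambda>j. y (\<tau> j)) * \<omega>' (\<lambda>i. x (\<sigma> (p + i))) (\<lambda>j. y (\<tau> (q + j))))
     / (fact p * fact p' * fact q * fact q'))"

lemma dwedge_tensor:
  "dwedge p q p' q' (tensor \<alpha> \<beta>) (tensor \<alpha>' \<beta>') = tensor (wedge p p' \<alpha> \<alpha>') (wedge q q' \<beta> \<beta>')"
  by (simp add: dwedge_def tensor_def wedge_def sum_product mult_ac)

text \<open>The \<open>k\<close>-th exterior power of a \<open>(p, q)\<close> double form, of bidegree \<open>(k * p, k * q)\<close>.\<close>

primrec dpow :: "nat \<Rightarrow> nat \<Rightarrow> 'v dform \<Rightarrow> nat \<Rightarrow> 'v dform" where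
  "dpow p q \<omega> 0 = (\<lambda>x y. 1)"
| "dpow p q \<omega> (Suc k) = dwedge p q (k * p) (k * q) \<omega> (dpow p q \<omega> k)"

definition inner_product :: "('v::euclidean_space \<Rightarrow> 'v \<Rightarrow> real) \<Rightarrow> bool" where
  "inner_product g \<longleftrightarrow> bilinear g \<and> (\<forall>u v. g u v = g v u) \<and> (\<forall>u. u \<noteq> 0 \<longrightarrow> 0 < g u u)"

definition orthonormal_basis :: "('v::euclidean_space \<Rightarrow> 'v \<Rightarrow> real) \<Rightarrow> (nat \<Rightarrow> 'v) \<Rightarrow> bool" where
  "orthonormal_basis g e \<longleftrightarrow>
     (\<forall>i<DIM('v). \<forall>j<DIM('v). g (e i) (e j) = (if i = j then 1 else 0))"

text \<open>The determinant of \<open>g (e i) (y j)\<close>, that is, $e^1 \wedge \dots \wedge e^n$.\<close>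

definition volume :: "('v::euclidean_space \<Rightarrow> 'v \<Rightarrow> real) \<Rightarrow> (nat \<Rightarrow> 'v) \<Rightarrow> 'v form" where
  "volume g e = (\<lambda>y. \<Sum>\<sigma> | \<sigma> permutes {..<DIM('v)}.
     of_int (sign \<sigma>) * (\<Prod>i<DIM('v). g (e i) (y (\<sigma> i))))"

text \<open>The Hodge star of a \<open>p\<close>-form for the orientation given by an orthonormal basis \<open>e\<close>:
  $(\star\alpha)(y) = \sum_{i_1 < \dots < i_p}
     \alpha(e_{i_1}, \dots, e_{i_p})\, \mathrm{vol}(e_{i_1}, \dots, e_{i_p}, y)$,
  with the sum over all index tuples divided by \<open>p!\<close>. Thus
  $\alpha \wedge \star\beta = \langle\alpha, \beta\rangle\, \mathrm{vol}$.\<close>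

definition hodge ::
  "('v::euclidean_space \<Rightarrow> 'v \<Rightarrow> real) \<Rightarrow> (nat \<Rightarrow> 'v) \<Rightarrow> nat \<Rightarrow> 'v form \<Rightarrow> 'v form" where
  "hodge g e p \<alpha> = (\<lambda>y.
     (\<Sum>I \<in> {..<p} \<rightarrow>\<^sub>E {..<DIM('v)}.
        \<alpha> (\<lambda>i. e (I i)) * volume g e (\<lambda>i. if i < p then e (I i) else y (i - p)))
     / fact p)"

text \<open>The double Hodge star applies the Hodge star in both arguments. Reversing the orientation
  changes the sign twice, so the choice of \<open>e\<close> does not matter.\<close>

definition dhodge_at ::
  "('v::euclidean_space \<Rightarrow> 'v \<Rightarrow> real) \<Rightarrow> (nat \<Rightarrow> 'v) \<Rightarrow> nat \<Rightarrow> nat \<Rightarrow> 'v dform \<Rightarrow> 'v dform" where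
  "dhodge_at g e p q \<omega> = (\<lambda>x y. hodge g e p (\<lambda>X. hodge g e q (\<lambda>Y. \<omega> X Y) y) x)"

lemma dhodge_at_tensor:
  "dhodge_at g e p q (tensor \<alpha> \<beta>) = tensor (hodge g e p \<alpha>) (hodge g e q \<beta>)"
proof -
  have *: "hodge g e q (\<lambda>Y. a * \<beta> Y) y = a * hodge g e q \<beta> y" for a y
    by (simp add: hodge_def sum_distrib_left mult.assoc)
  have **: "hodge g e p (\<lambda>X. \<alpha> X * a) x = hodge g e p \<alpha> x * a" for a x
    by (simp add: hodge_def sum_distrib_left sum_distrib_right mult_ac)
  show ?thesis
    by (simp add: dhodge_at_def tensor_def * **)
qed

definition dhodge ::
  "('v::euclidean_space \<Rightarrow> 'v \<Rightarrow> real) \<Rightarrow> nat \<Rightarrow> nat \<Rightarrow> 'v dform \<Rightarrow> 'v dform" where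
  "dhodge g = dhodge_at g (SOME e. orthonormal_basis g e)"

text \<open>Smoothness on an open set; \<open>Ck_on k\<close> says that all iterated directional derivatives up to
  order \<open>k\<close> exist and are continuous.\<close>

primrec Ck_on ::
  "nat \<Rightarrow> 'a::euclidean_space set \<Rightarrow> ('a \<Rightarrow> 'b::real_normed_vector) \<Rightarrow> bool" where
  "Ck_on 0 S f \<longleftrightarrow> continuous_on S f"
| "Ck_on (Suc k) S f \<longleftrightarrow>
     (\<forall>x\<in>S. f differentiable at x) \<and> (\<forall>v. Ck_on k S (\<lambda>x. frechet_derivative f (at x) v))"

definition smooth_on :: "'a::euclidean_space set \<Rightarrow> ('a \<Rightarrow> 'b::real_normed_vector) \<Rightarrow> bool" where
  "smooth_on S f \<longleftrightarrow> (\<forall>k. Ck_on k S f)"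

text \<open>Manifolds are embedded submanifolds of a Euclidean space \<open>'a\<close> (no loss of generality, by
  Whitney's theorem), but the Riemannian metric is arbitrary and need not be the induced one.
  \<open>metric M p X Y\<close> is meaningful only for \<open>X\<close>, \<open>Y\<close> in the tangent space of \<open>M\<close> at \<open>p\<close>, seen as a
  subspace of \<open>'a\<close>. The phantom parameter \<open>'e\<close> is the Euclidean space on which \<open>M\<close> is modelled; the
  dimension of \<open>M\<close> is \<open>DIM('e)\<close>.\<close>

datatype ('a, 'e) riemannian =
  Riemannian (points: "'a set") (metric: "'a \<Rightarrow> 'a \<Rightarrow> 'a \<Rightarrow> real")

definition local_param ::
  "('a::euclidean_space, 'e::euclidean_space) riemannian \<Rightarrow> 'e set \<Rightarrow> ('e \<Rightarrow> 'a) \<Rightarrow> bool" where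
  "local_param M U \<psi> \<longleftrightarrow>
     open U \<and> smooth_on U \<psi> \<and> (\<forall>x\<in>U. inj (frechet_derivative \<psi> (at x))) \<and>
     openin (top_of_set (points M)) (\<psi> ` U) \<and> (\<exists>\<phi>. homeomorphism U (\<psi> ` U) \<psi> \<phi>)"

text \<open>The metric in the coordinates given by \<open>\<psi>\<close>; the tangent space at \<open>\<psi> x\<close> is identified with
  \<open>'e\<close> through the derivative of \<open>\<psi>\<close> at \<open>x\<close>.\<close>

definition coord_metric ::
  "('a::euclidean_space, 'e::euclidean_space) riemannian \<Rightarrow> ('e \<Rightarrow> 'a) \<Rightarrow> 'e \<Rightarrow> 'e \<Rightarrow> 'e \<Rightarrow> real" where
  "coord_metric M \<psi> x u v =
     metric M (\<psi> x) (frechet_derivative \<psi> (at x) u) (frechet_derivative \<psi> (at x) v)"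

definition riemannian_manifold ::
  "('a::euclidean_space, 'e::euclidean_space) riemannian \<Rightarrow> bool" where
  "riemannian_manifold M \<longleftrightarrow>
     (\<forall>p\<in>points M. \<exists>U \<psi>. local_param M U \<psi> \<and> p \<in> \<psi> ` U) \<and>
     (\<forall>U \<psi>. local_param M U \<psi> \<longrightarrow>
        (\<forall>x\<in>U. inner_product (coord_metric M \<psi> x)) \<and>
        (\<forall>u v. smooth_on U (\<lambda>x. coord_metric M \<psi> x u v)))"

text \<open>Here \<open>g x\<close> is the metric at \<open>x\<close> in coordinates. \<open>christoffel g x u v\<close> is the value at \<open>x\<close> of
  the Levi-Civita derivative $\nabla_u v$ of the constant vector field \<open>v\<close>, characterised by the
  Koszul formula, and \<open>riemann g x u v w\<close> is
  $R(u, v) w = \nabla_u \nabla_v w - \nabla_v \nabla_u w$ for constant vector fields.\<close>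

definition christoffel ::
  "('e::euclidean_space \<Rightarrow> 'e \<Rightarrow> 'e \<Rightarrow> real) \<Rightarrow> 'e \<Rightarrow> 'e \<Rightarrow> 'e \<Rightarrow> 'e" where
  "christoffel g x u v = (THE z. \<forall>w. g x z w =
     (frechet_derivative (\<lambda>y. g y v w) (at x) u + frechet_derivative (\<lambda>y. g y u w) (at x) v
      - frechet_derivative (\<lambda>y. g y u v) (at x) w) / 2)"

definition riemann ::
  "('e::euclidean_space \<Rightarrow> 'e \<Rightarrow> 'e \<Rightarrow> real) \<Rightarrow> 'e \<Rightarrow> 'e \<Rightarrow> 'e \<Rightarrow> 'e \<Rightarrow> 'e" where
  "riemann g x u v w =
     frechet_derivative (\<lambda>y. christoffel g y v w) (at x) u
     - frechet_derivative (\<lambda>y. christoffel g y u w) (at x) v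
     + christoffel g x u (christoffel g x v w) - christoffel g x v (christoffel g x u w)"

definition metric_form :: "('e::euclidean_space \<Rightarrow> 'e \<Rightarrow> 'e \<Rightarrow> real) \<Rightarrow> 'e \<Rightarrow> 'e dform" where
  "metric_form g x = (\<lambda>X Y. g x (X 0) (Y 0))"

text \<open>The sign is such that \<open>R (x \<and> y; x \<and> y) = g (R (x, y) y, x)\<close> is the sectional curvature.\<close>

definition curvature_form :: "('e::euclidean_space \<Rightarrow> 'e \<Rightarrow> 'e \<Rightarrow> real) \<Rightarrow> 'e \<Rightarrow> 'e dform" where
  "curvature_form g x = (\<lambda>X Y. g x (riemann g x (X 0) (X 1) (Y 1)) (Y 0))"

definition thorpe_form ::
  "('e::euclidean_space \<Rightarrow> 'e \<Rightarrow> 'e \<Rightarrow> real) \<Rightarrow> 'e \<Rightarrow> nat \<Rightarrow> nat \<Rightarrow> 'e dform" where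
  "thorpe_form g x r k =
     dwedge (r - 2 * k) (r - 2 * k) (2 * k) (2 * k)
       (dpow 1 1 (metric_form g x) (r - 2 * k)) (dpow 2 2 (curvature_form g x) k)"

definition thorpe :: "nat \<Rightarrow> ('a::euclidean_space, 'e::euclidean_space) riemannian \<Rightarrow> bool" where
  "thorpe m M \<longleftrightarrow> riemannian_manifold M \<and>
     (\<exists>r k. DIM('e) = 2 * r \<and> m = 2 * k \<and> 2 \<le> m \<and> m \<le> r \<and>
        (\<forall>U \<psi>. local_param M U \<psi> \<longrightarrow> (\<forall>x\<in>U. let g = coord_metric M \<psi> in
           dhodge (g x) r r (thorpe_form g x r k) = thorpe_form g x r k)))"

definition anti_thorpe :: "nat \<Rightarrow> ('a::euclidean_space, 'e::euclidean_space) riemannian \<Rightarrow> bool" where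
  "anti_thorpe m M \<longleftrightarrow> riemannian_manifold M \<and>
     (\<exists>r k. DIM('e) = 2 * r \<and> m = 2 * k \<and> 2 \<le> m \<and> m \<le> r \<and>
        (\<forall>U \<psi>. local_param M U \<psi> \<longrightarrow> (\<forall>x\<in>U. let g = coord_metric M \<psi> in
           dhodge (g x) r r (thorpe_form g x r k) = (\<lambda>X Y. - thorpe_form g x r k X Y))))"

text \<open>For \<open>K > 0\<close>, the sphere of radius $1/\sqrt{K}$ with the metric induced from Euclidean space;
  for \<open>K < 0\<close>, the upper sheet of the hyperboloid $\langle p, p\rangle = 1/K$ with the metric induced
  from Minkowski space. Both have dimension \<open>DIM('e)\<close> and constant curvature \<open>K\<close>.\<close>

definition round_sphere :: "real \<Rightarrow> ('e::euclidean_space \<times> real, 'e) riemannian" where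
  "round_sphere K = Riemannian
     {(x, t). x \<bullet> x + t * t = 1 / K}
     (\<lambda>p (u, s) (v, t). u \<bullet> v + s * t)"

definition hyperbolic_space :: "real \<Rightarrow> ('e::euclidean_space \<times> real, 'e) riemannian" where
  "hyperbolic_space K = Riemannian
     {(x, t). x \<bullet> x - t * t = 1 / K \<and> 0 < t}
     (\<lambda>p (u, s) (v, t). u \<bullet> v - s * t)"

definition riemannian_product ::
  "('a, 'e) riemannian \<Rightarrow> ('b, 'f) riemannian \<Rightarrow> ('a \<times> 'b, 'e \<times> 'f) riemannian" where
  "riemannian_product M N = Riemannian (points M \<times> points N)
     (\<lambda>(p, q) (u, u') (v, v'). metric M p u v + metric N q u' v')"

end

theory Submission
  imports Defs "Jordan_Normal_Form.Determinant"
begin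

text \<open>Let \<open>g = g1 + g2\<close> be the product metric and \<open>h = g1 - g2\<close>. By the Gauss equation for the
  product inside $(\mathbb{R}^r \times \mathbb{R})^2$ the curvature form is
  $\frac{c}{2}(g_1^2 - g_2^2) = \frac{c}{2} g h$, so $g^{r-2k} R^k$ is a multiple of
  $g^{r-k} h^k$. For $t \neq \pm 1$ the operator of $g + t h$ has eigenvalues $1 + t$ and
  $1 - t$, each with multiplicity $r$; a product of \<open>r\<close> of its eigenvalues at distinct indices equals the
  product of the eigenvalues of $g - t h$ at the complementary indices, hence
  $\star (g + t h)^r = (g - t h)^r$. Comparing coefficients of $t^k$ gives
  $\star (g^{r-k} h^k) = (-1)^k g^{r-k} h^k$.\<close>

subsection \<open>Determinants and exterior products of $(1, 1)$ double forms\<close>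

text \<open>Starring a mixed product of factors \<open>g\<close> and \<open>h\<close> directly means
  tracking which factor sits where. An \<open>r\<close>-th power of a single form is
  \<open>fact r\<close> times a determinant, and for a form diagonal in a
  \<open>g\<close>-orthonormal basis the star only exchanges complementary minors; the parameter t
  packs all mixed products into such powers. The values 1 and -1 of t are left out because some
  eigenvalue is then 0 and cannot be cancelled, and the remaining values still determine a
  polynomial. The analytic obstacle is that the definitions range over every parametrisation, so no
  convenient coordinates may be chosen, and that \<open>christoffel\<close> is a definite
  description whose differentiability is not given. Both are met by working in the ambient space:
  there the normal part of the second derivatives of a chart is explicit, and
  \<open>christoffel\<close> is the solution of a linear system with differentiable data. To refute
  the anti-Thorpe property one also needs a nonzero value of the form. It is found on
  \<open>r\<close> orthonormal vectors tangent to the sphere, where \<open>h\<close> and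
  \<open>g\<close> agree.\<close>

definition sdet :: "nat \<Rightarrow> (nat \<Rightarrow> nat \<Rightarrow> real) \<Rightarrow> real" where
  "sdet n M = (\<Sum>\<sigma> | \<sigma> permutes {..<n}. of_int (sign \<sigma>) * (\<Prod>i<n. M i (\<sigma> i)))"

text \<open>\<open>sdet\<close> has the shape of the sum in \<open>volume\<close>, with plain
  naturals as indices. The determinant laws that follow are imported through this equation.\<close>

lemma sdet_eq_det: "sdet n M = Determinant.det (Matrix.mat n n (\<lambda>(i, j). M i j))"
proof -
  have "Matrix.mat n n (\<lambda>(i, j). M i j) $$ (i, \<sigma> i) = M i (\<sigma> i)"
    if "\<sigma> permutes {0..<n}" "i < n" for \<sigma> i
    using that permutes_in_image[OF that(1), of i] by simp
  then have "(\<Prod>i = 0..<n. Matrix.mat n n (\<lambda>(i, j). M i j) $$ (i, \<sigma> i)) = (\<Prod>i<n. M i (\<sigma> i))"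
    if "\<sigma> permutes {0..<n}" for \<sigma>
    using that by (intro prod.cong) auto
  then show ?thesis
    by (simp add: sdet_def Determinant.det_def atLeast0LessThan)
qed

lemma sdet_cong: "(\<And>i j. i < n \<Longrightarrow> j < n \<Longrightarrow> M i j = N i j) \<Longrightarrow> sdet n M = sdet n N"
  unfolding sdet_def
  by (intro sum.cong prod.cong refl arg_cong2[where f = "(*)"]) (auto dest: permutes_in_image)

lemma sdet_transpose: "sdet n (\<lambda>i j. M j i) = sdet n M"
proof -
  have "transpose_mat (Matrix.mat n n (\<lambda>(i, j). M i j)) = Matrix.mat n n (\<lambda>(i, j). M j i)"
    by (intro eq_matI) auto
  then show ?thesis
    unfolding sdet_eq_det by (metis Determinant.det_transpose mat_carrier)
qed

lemma permutes_nat_less: "\<pi> permutes {..<n} \<Longrightarrow> i < n \<Longrightarrow> \<pi> i < (n::nat)"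
  using permutes_in_image[of \<pi> "{..<n}" i] by simp

lemma sdet_permute_rows:
  assumes "\<pi> permutes {..<n}"
  shows "sdet n (\<lambda>i. M (\<pi> i)) = of_int (sign \<pi>) * sdet n M"
proof -
  have p: "\<pi> permutes {0..<n}" using assms by (simp add: atLeast0LessThan)
  have "Matrix.mat n n (\<lambda>(i, j). Matrix.mat n n (\<lambda>(i, j). M i j) $$ (\<pi> i, j))
      = Matrix.mat n n (\<lambda>(i, j). M (\<pi> i) j)"
    by (intro eq_matI) (simp_all add: permutes_nat_less[OF assms])
  then show ?thesis
    using Determinant.det_permute_rows[OF mat_carrier p, of "\<lambda>(i, j). M i j"]
    by (simp add: sdet_eq_det)
qed

lemma sdet_permute_cols:
  assumes "\<pi> permutes {..<n}"
  shows "sdet n (\<lambda>i j. M i (\<pi> j)) = of_int (sign \<pi>) * sdet n M"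
proof -
  have "sdet n (\<lambda>i j. M i (\<pi> j)) = sdet n (\<lambda>i j. M j (\<pi> i))"
    by (rule sdet_transpose[symmetric])
  also have "\<dots> = of_int (sign \<pi>) * sdet n (\<lambda>i j. M j i)"
    by (rule sdet_permute_rows[OF assms, of "\<lambda>i j. M j i"])
  finally show ?thesis
    using sdet_transpose[of n M] by simp
qed

lemma sdet_identical_rows:
  assumes "i < n" "j < n" "i \<noteq> j" "\<And>k. k < n \<Longrightarrow> M i k = M j k"
  shows "sdet n M = 0"
proof -
  have "Matrix.row (Matrix.mat n n (\<lambda>(i, j). M i j)) i = Matrix.row (Matrix.mat n n (\<lambda>(i, j). M i j)) j"
    by (intro eq_vecI) (simp_all add: assms(1,2,4))
  then show ?thesis
    unfolding sdet_eq_det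
    using assms(1-3) by (intro Determinant.det_identical_rows[of _ n i j]) simp_all
qed

lemma sdet_mult: "sdet n (\<lambda>i j. \<Sum>k<n. M i k * N k j) = sdet n M * sdet n N"
proof -
  have "Matrix.mat n n (\<lambda>(i, j). \<Sum>k<n. M i k * N k j)
      = Matrix.mat n n (\<lambda>(i, j). M i j) * Matrix.mat n n (\<lambda>(i, j). N i j)"
    by (intro eq_matI) (auto simp: scalar_prod_def atLeast0LessThan)
  then show ?thesis
    unfolding sdet_eq_det by (metis Determinant.det_mult mat_carrier)
qed

text \<open>The hypotheses say that the matrix is block upper triangular with an identity block.
  After a reordering of rows this yields complementary minors; with \<open>n = 0\<close> it
  evaluates the determinant of the identity.\<close>

lemma sdet_block:
  assumes "\<And>i j. i < m \<Longrightarrow> j < m \<Longrightarrow> M i j = (if i = j then 1 else 0)"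
    and "\<And>i j. i < n \<Longrightarrow> j < m \<Longrightarrow> M (m + i) j = 0"
  shows "sdet (m + n) M = sdet n (\<lambda>i j. M (m + i) (m + j))"
proof -
  let ?A2 = "Matrix.mat m n (\<lambda>(i, j). M i (m + j))"
  let ?A4 = "Matrix.mat n n (\<lambda>(i, j). M (m + i) (m + j))"
  have eq: "Matrix.mat (m + n) (m + n) (\<lambda>(i, j). M i j)
      = four_block_mat (1\<^sub>m m) ?A2 (0\<^sub>m n m) ?A4"
  proof (intro eq_matI)
    fix i j assume "i < dim_row (four_block_mat (1\<^sub>m m) ?A2 (0\<^sub>m n m) ?A4)"
      "j < dim_col (four_block_mat (1\<^sub>m m) ?A2 (0\<^sub>m n m) ?A4)"
    then have "i < m + n" "j < m + n" by auto
    then show "Matrix.mat (m + n) (m + n) (\<lambda>(i, j). M i j) $$ (i, j)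
      = four_block_mat (1\<^sub>m m) ?A2 (0\<^sub>m n m) ?A4 $$ (i, j)"
      using assms(1)[of i j] assms(2)[of "i - m" j] by auto
  qed auto
  have "Determinant.det (four_block_mat (1\<^sub>m m) ?A2 (0\<^sub>m n m) ?A4)
      = Determinant.det (1\<^sub>m m) * Determinant.det ?A4"
    by (rule Determinant.det_four_block_mat_lower_left_zero) auto
  then show ?thesis
    unfolding sdet_eq_det eq by simp
qed

text \<open>The exterior product of the \<open>(1, 1)\<close> double forms \<open>a 0, \<dots>, a (m - 1)\<close>.\<close>

definition bprod :: "nat \<Rightarrow> (nat \<Rightarrow> 'v \<Rightarrow> 'v \<Rightarrow> real) \<Rightarrow> 'v dform" where
  "bprod m a = (\<lambda>X Y. \<Sum>\<sigma> | \<sigma> permutes {..<m}. \<Sum>\<tau> | \<tau> permutes {..<m}.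
     of_int (sign \<sigma>) * of_int (sign \<tau>) * (\<Prod>i<m. a i (X (\<sigma> i)) (Y (\<tau> i))))"

lemma bprod_cong: "(\<And>i. i < m \<Longrightarrow> a i = b i) \<Longrightarrow> bprod m a = bprod m b"
  unfolding bprod_def by (intro ext sum.cong prod.cong refl arg_cong2[where f = "(*)"]) auto

lemma sign_compose_permutes:
  assumes "finite S" "\<sigma> permutes S" "\<pi> permutes S"
  shows "sign (\<sigma> \<circ> \<pi>) = sign \<sigma> * sign \<pi>"
  using assms by (metis sign_compose permutes_imp_permutation)

text \<open>Right translation of both summation variables. The signs of \<pi> and \<rho> can stand
  on either side because they square to 1.\<close>

lemma bprod_compose:
  assumes "\<pi> permutes {..<m}" "\<rho> permutes {..<m}"
  shows "(\<Sum>\<sigma> | \<sigma> permutes {..<m}. \<Sum>\<tau> | \<tau> permutes {..<m}. of_int (sign \<sigma>) * of_int (sign \<tau>)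
      * (\<Prod>i<m. a i (X (\<sigma> (\<pi> i))) (Y (\<tau> (\<rho> i)))))
    = of_int (sign \<pi>) * of_int (sign \<rho>) * bprod m a X Y"
proof -
  have s: "real_of_int (sign \<pi>) * of_int (sign \<pi>) = 1" for \<pi> :: "nat \<Rightarrow> nat"
    using sign_idempotent[of \<pi>] by (metis of_int_1 of_int_mult)
  have "bprod m a X Y = (\<Sum>\<sigma> | \<sigma> permutes {..<m}. \<Sum>\<tau> | \<tau> permutes {..<m}.
      of_int (sign (\<sigma> \<circ> \<pi>)) * of_int (sign (\<tau> \<circ> \<rho>)) * (\<Prod>i<m. a i (X (\<sigma> (\<pi> i))) (Y (\<tau> (\<rho> i)))))"
    unfolding bprod_def
    by (subst sum_permutations_compose_right[OF assms(1)],
        subst sum_permutations_compose_right[OF assms(2)]) simp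
  also have "\<dots> = of_int (sign \<pi>) * of_int (sign \<rho>) * (\<Sum>\<sigma> | \<sigma> permutes {..<m}.
      \<Sum>\<tau> | \<tau> permutes {..<m}. of_int (sign \<sigma>) * of_int (sign \<tau>)
      * (\<Prod>i<m. a i (X (\<sigma> (\<pi> i))) (Y (\<tau> (\<rho> i)))))"
    unfolding sum_distrib_left
    by (intro sum.cong refl) (simp add: sign_compose_permutes[OF finite_lessThan _ assms(1)]
        sign_compose_permutes[OF finite_lessThan _ assms(2)])
  finally have "of_int (sign \<pi>) * of_int (sign \<rho>) * bprod m a X Y
      = (of_int (sign \<pi>) * of_int (sign \<pi>)) * (of_int (sign \<rho>) * of_int (sign \<rho>)) *
      (\<Sum>\<sigma> | \<sigma> permutes {..<m}. \<Sum>\<tau> | \<tau> permutes {..<m}. of_int (sign \<sigma>) * of_int (sign \<tau>)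
      * (\<Prod>i<m. a i (X (\<sigma> (\<pi> i))) (Y (\<tau> (\<rho> i)))))"
    by (simp only: mult_ac)
  then show ?thesis
    by (simp only: s mult_1_left)
qed

text \<open>Reordering the factors permutes the slots of \<open>X\<close> and of \<open>Y\<close> in
  the same way, so the sign occurs twice and cancels: (1, 1) double forms commute.\<close>

lemma bprod_permute:
  assumes "\<pi> permutes {..<m}"
  shows "bprod m (\<lambda>i. a (\<pi> i)) = bprod m a"
proof (intro ext)
  fix X Y :: "nat \<Rightarrow> 'a"
  have s: "real_of_int (sign \<pi>) * of_int (sign \<pi>) = 1"
    using sign_idempotent[of \<pi>] by (metis of_int_1 of_int_mult)
  have "(\<Prod>i<m. a (\<pi> i) (X (\<sigma> (\<pi> i))) (Y (\<tau> (\<pi> i)))) = (\<Prod>i<m. a i (X (\<sigma> i)) (Y (\<tau> i)))" for \<sigma> \<tau>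
    by (rule prod.permute[OF assms, symmetric, unfolded o_def])
  then have "bprod m a X Y = (\<Sum>\<sigma> | \<sigma> permutes {..<m}. \<Sum>\<tau> | \<tau> permutes {..<m}.
     of_int (sign \<sigma>) * of_int (sign \<tau>) * (\<Prod>i<m. a (\<pi> i) (X (\<sigma> (\<pi> i))) (Y (\<tau> (\<pi> i)))))"
    by (simp add: bprod_def)
  also have "\<dots> = bprod m (\<lambda>i. a (\<pi> i)) X Y"
    using bprod_compose[OF assms assms, of "\<lambda>i. a (\<pi> i)" X Y] s by (simp add: bprod_def)
  finally show "bprod m (\<lambda>i. a (\<pi> i)) X Y = bprod m a X Y" by simp
qed

text \<open>With equal factors the inner sum is the same determinant for every \<sigma>. This is
  what makes powers of one form easier to handle than mixed products.\<close>

lemma bprod_const: "bprod m (\<lambda>_. a) X Y = fact m * sdet m (\<lambda>i j. a (X i) (Y j))"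
proof -
  have "(\<Sum>\<tau> | \<tau> permutes {..<m}. of_int (sign \<sigma>) * of_int (sign \<tau>) * (\<Prod>i<m. a (X (\<sigma> i)) (Y (\<tau> i))))
      = sdet m (\<lambda>i j. a (X i) (Y j))" if "\<sigma> permutes {..<m}" for \<sigma>
  proof -
    have s: "real_of_int (sign \<sigma>) * of_int (sign \<sigma>) = 1"
      using sign_idempotent[of \<sigma>] by (metis of_int_1 of_int_mult)
    have "(\<Sum>\<tau> | \<tau> permutes {..<m}. of_int (sign \<sigma>) * of_int (sign \<tau>) * (\<Prod>i<m. a (X (\<sigma> i)) (Y (\<tau> i))))
      = of_int (sign \<sigma>) * sdet m (\<lambda>i j. a (X (\<sigma> i)) (Y j))"
      by (simp add: sdet_def sum_distrib_left mult.assoc)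
    also have "\<dots> = sdet m (\<lambda>i j. a (X i) (Y j))"
      using sdet_permute_rows[OF that, of "\<lambda>i j. a (X i) (Y j)"] s
      by (simp add: mult.assoc[symmetric])
    finally show ?thesis .
  qed
  then show ?thesis
    by (simp add: bprod_def card_permutations)
qed

definition block_perm :: "nat \<Rightarrow> (nat \<Rightarrow> nat) \<Rightarrow> (nat \<Rightarrow> nat) \<Rightarrow> nat \<Rightarrow> nat" where
  "block_perm p \<sigma> \<tau> = (\<lambda>i. if i < p then \<sigma> i else p + \<tau> (i - p))"

text \<open>\<open>block_perm\<close> is \<sigma> composed with a copy of \<tau> transported by
  adding \<open>p\<close>, so both claims reduce to facts about compositions.\<close>

lemma
  assumes "\<sigma> permutes {..<p}" "\<tau> permutes {..<q}"
  shows block_perm_permutes: "block_perm p \<sigma> \<tau> permutes {..<p + q}"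
    and sign_block_perm: "sign (block_perm p \<sigma> \<tau>) = sign \<sigma> * sign \<tau>"
proof -
  define \<tau>' where "\<tau>' = map_permutation {..<q} ((+) p) \<tau>"
  have img: "(+) p ` {..<q} = {p..<p + q}"
    using image_add_atLeastLessThan[of p 0 q] by (simp add: atLeast0LessThan add.commute)
  have inv: "inv_into {..<q} ((+) p) (p + i) = i" if "i < q" for i
    using that by (intro inv_into_f_f) auto
  have "\<tau>' i = (if p \<le> i then p + \<tau> (i - p) else i)" for i
  proof (cases "i \<in> {p..<p + q}")
    case True
    then show ?thesis
      using inv[of "i - p"] by (auto simp add: \<tau>'_def map_permutation_def restrict_id_def img)
  next
    case False
    then have "p \<le> i \<Longrightarrow> \<tau> (i - p) = i - p"
      using permutes_not_in[OF assms(2), of "i - p"] by auto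
    with False show ?thesis
      by (auto simp: \<tau>'_def map_permutation_def restrict_id_def img)
  qed
  then have eq: "block_perm p \<sigma> \<tau> = \<sigma> \<circ> \<tau>'"
    using permutes_not_in[OF assms(1)] by (auto simp: block_perm_def fun_eq_iff)
  have \<tau>': "\<tau>' permutes {..<p + q}"
    unfolding \<tau>'_def
    by (rule permutes_subset[OF map_permutation_permutes[OF _ assms(2)]])
      (auto simp: img bij_betw_def)
  have \<sigma>: "\<sigma> permutes {..<p + q}"
    by (rule permutes_subset[OF assms(1)]) auto
  show "block_perm p \<sigma> \<tau> permutes {..<p + q}"
    unfolding eq by (rule permutes_compose[OF \<tau>' \<sigma>])
  have "sign \<tau>' = sign \<tau>"
    unfolding \<tau>'_def by (rule sign_map_permutation) (auto simp: assms(2))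
  then show "sign (block_perm p \<sigma> \<tau>) = sign \<sigma> * sign \<tau>"
    unfolding eq using sign_compose_permutes[OF _ \<sigma> \<tau>'] by simp
qed

lemma prod_lessThan_add:
  "prod f {..<p + q} = prod f {..<p} * (\<Prod>i<q. f (p + i))" for p q :: nat
  by (induction q) (simp_all add: mult.assoc)

text \<open>Iterated under \<open>sum.cong\<close>, this carries a pair of outer sums inside any
  number of further sums.\<close>

lemma sum_rotate3:
  "(\<Sum>s\<in>S. \<Sum>t\<in>T. \<Sum>u\<in>U. G s t u) = (\<Sum>u\<in>U. \<Sum>s\<in>S. \<Sum>t\<in>T. G s t u)"
proof -
  have "(\<Sum>s\<in>S. \<Sum>t\<in>T. \<Sum>u\<in>U. G s t u) = (\<Sum>s\<in>S. \<Sum>u\<in>U. \<Sum>t\<in>T. G s t u)"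
    by (intro sum.cong refl) (rule sum.swap)
  also have "\<dots> = (\<Sum>u\<in>U. \<Sum>s\<in>S. \<Sum>t\<in>T. G s t u)"
    by (rule sum.swap)
  finally show ?thesis .
qed

text \<open>The permutations inside the two factors form block permutations, which the outer sums
  absorb by \<open>bprod_compose\<close>. Each of the (p! q!)^2 choices then contributes the same
  term, and this number is exactly the normalisation in \<open>dwedge\<close>. So
  \<open>bprod\<close> multiplies by concatenating factor lists, without factorials.\<close>

lemma dwedge_bprod:
  fixes a b :: "nat \<Rightarrow> 'v \<Rightarrow> 'v \<Rightarrow> real"
  shows "dwedge p p q q (bprod p a) (bprod q b) = bprod (p + q) (\<lambda>i. if i < p then a i else b (i - p))"
proof (intro ext)
  fix X Y :: "nat \<Rightarrow> 'v"
  let ?c = "\<lambda>i. if i < p then a i else b (i - p)"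
  let ?P = "\<lambda>m. {\<sigma>::nat \<Rightarrow> nat. \<sigma> permutes {..<m}}"
  let ?s = "\<lambda>\<sigma>::nat \<Rightarrow> nat. real_of_int (sign \<sigma>)"
  let ?F = "\<lambda>\<sigma> \<tau> \<sigma>1 \<tau>1 \<sigma>2 \<tau>2. (?s \<sigma>1 * ?s \<tau>1 * ?s \<sigma>2 * ?s \<tau>2) * (?s \<sigma> * ?s \<tau> *
    (\<Prod>i<p + q. ?c i (X (\<sigma> (block_perm p \<sigma>1 \<sigma>2 i))) (Y (\<tau> (block_perm p \<tau>1 \<tau>2 i)))))"
  have sq: "?s \<sigma> * ?s \<sigma> = 1" for \<sigma>
    using sign_idempotent[of \<sigma>] by (metis of_int_1 of_int_mult)
  have "?s \<sigma> * ?s \<tau> * bprod p a (\<lambda>i. X (\<sigma> i)) (\<lambda>j. Y (\<tau> j))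
      * bprod q b (\<lambda>i. X (\<sigma> (p + i))) (\<lambda>j. Y (\<tau> (p + j)))
    = (\<Sum>\<sigma>2\<in>?P q. \<Sum>\<tau>2\<in>?P q. \<Sum>\<sigma>1\<in>?P p. \<Sum>\<tau>1\<in>?P p. ?F \<sigma> \<tau> \<sigma>1 \<tau>1 \<sigma>2 \<tau>2)" for \<sigma> \<tau>
    unfolding bprod_def sum_distrib_left sum_distrib_right
    by (intro sum.cong refl) (simp add: prod_lessThan_add block_perm_def mult_ac)
  then have "(\<Sum>\<sigma>\<in>?P (p + q). \<Sum>\<tau>\<in>?P (p + q). ?s \<sigma> * ?s \<tau> * bprod p a (\<lambda>i. X (\<sigma> i)) (\<lambda>j. Y (\<tau> j))
      * bprod q b (\<lambda>i. X (\<sigma> (p + i))) (\<lambda>j. Y (\<tau> (p + j))))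
    = (\<Sum>\<sigma>\<in>?P (p + q). \<Sum>\<tau>\<in>?P (p + q).
        \<Sum>\<sigma>2\<in>?P q. \<Sum>\<tau>2\<in>?P q. \<Sum>\<sigma>1\<in>?P p. \<Sum>\<tau>1\<in>?P p. ?F \<sigma> \<tau> \<sigma>1 \<tau>1 \<sigma>2 \<tau>2)"
    by simp
  also have "\<dots> = (\<Sum>\<sigma>2\<in>?P q. \<Sum>\<tau>2\<in>?P q. \<Sum>\<sigma>1\<in>?P p. \<Sum>\<tau>1\<in>?P p.
      \<Sum>\<sigma>\<in>?P (p + q). \<Sum>\<tau>\<in>?P (p + q). ?F \<sigma> \<tau> \<sigma>1 \<tau>1 \<sigma>2 \<tau>2)"
    by ((rule trans[OF sum_rotate3], rule sum.cong[OF refl])+, rule refl)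
  also have "\<dots> = (\<Sum>\<sigma>2\<in>?P q. \<Sum>\<tau>2\<in>?P q. \<Sum>\<sigma>1\<in>?P p. \<Sum>\<tau>1\<in>?P p. bprod (p + q) ?c X Y)"
  proof (intro sum.cong refl)
    fix \<sigma>1 \<tau>1 \<sigma>2 \<tau>2 :: "nat \<Rightarrow> nat"
    assume "\<sigma>1 \<in> ?P p" "\<tau>1 \<in> ?P p" "\<sigma>2 \<in> ?P q" "\<tau>2 \<in> ?P q"
    then have perm: "\<sigma>1 permutes {..<p}" "\<tau>1 permutes {..<p}" "\<sigma>2 permutes {..<q}" "\<tau>2 permutes {..<q}"
      by auto
    have "(\<Sum>\<sigma>\<in>?P (p + q). \<Sum>\<tau>\<in>?P (p + q). ?F \<sigma> \<tau> \<sigma>1 \<tau>1 \<sigma>2 \<tau>2)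
      = (?s \<sigma>1 * ?s \<tau>1 * ?s \<sigma>2 * ?s \<tau>2) * (?s (block_perm p \<sigma>1 \<sigma>2) * ?s (block_perm p \<tau>1 \<tau>2)
          * bprod (p + q) ?c X Y)"
      unfolding sum_distrib_left[symmetric]
      using bprod_compose[OF block_perm_permutes[OF perm(1,3)] block_perm_permutes[OF perm(2,4)], of ?c X Y]
      by (simp only:)
    also have "\<dots> = (?s \<sigma>1 * ?s \<sigma>1) * (?s \<sigma>2 * ?s \<sigma>2) * (?s \<tau>1 * ?s \<tau>1) * (?s \<tau>2 * ?s \<tau>2)
          * bprod (p + q) ?c X Y"
      by (simp only: sign_block_perm[OF perm(1,3)] sign_block_perm[OF perm(2,4)] of_int_mult mult_ac)
    finally show "(\<Sum>\<sigma>\<in>?P (p + q). \<Sum>\<tau>\<in>?P (p + q). ?F \<sigma> \<tau> \<sigma>1 \<tau>1 \<sigma>2 \<tau>2) = bprod (p + q) ?c X Y"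
      by (simp only: sq mult_1_left)
  qed
  also have "\<dots> = fact p * fact q * fact p * fact q * bprod (p + q) ?c X Y"
    by (simp add: card_permutations)
  finally show "dwedge p p q q (bprod p a) (bprod q b) X Y = bprod (p + q) ?c X Y"
    by (simp add: dwedge_def)
qed

lemma dwedge_scale:
  "dwedge p q p' q' (\<lambda>X Y. s * \<omega> X Y) (\<lambda>X Y. t * \<omega>' X Y) = (\<lambda>X Y. s * t * dwedge p q p' q' \<omega> \<omega>' X Y)"
  unfolding dwedge_def times_divide_eq_right sum_distrib_left by (simp only: mult_ac)

lemma bprod_0: "bprod 0 a = (\<lambda>X Y. 1)"
proof -
  have "{\<sigma>. \<sigma> permutes {..<0::nat}} = {id}"
    by auto
  then show ?thesis
    by (simp only: bprod_def) simp
qed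

lemma dpow_bprod_1: "dpow 1 1 (\<lambda>X Y. a (X 0) (Y 0)) m = bprod m (\<lambda>_. a)"
proof (induction m)
  case 0
  show ?case by (simp add: bprod_0)
next
  case (Suc m)
  have "{\<sigma>. \<sigma> permutes {..<1::nat}} = {id}"
    by (auto simp: lessThan_Suc)
  then have 1: "(\<lambda>X Y. a (X 0) (Y 0)) = bprod 1 (\<lambda>_. a)"
    by (simp only: bprod_def) simp
  have "dpow 1 1 (\<lambda>X Y. a (X 0) (Y 0)) (Suc m) = dwedge 1 1 m m (bprod 1 (\<lambda>_. a)) (bprod m (\<lambda>_. a))"
    by (simp only: dpow.simps Suc mult_1_right) (simp only: 1)
  also have "\<dots> = bprod (1 + m) (\<lambda>_. a)"
    by (simp only: dwedge_bprod if_cancel)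
  finally show ?case
    by (simp only: plus_1_eq_Suc)
qed

text \<open>The period 2 of \<open>c\<close> makes the factor list unchanged when another pair is
  put in front of it.\<close>

lemma dpow_bprod_2:
  assumes "\<omega> = (\<lambda>X Y. s * bprod 2 c X Y)" and "\<And>i. c (i + 2) = c i"
  shows "dpow 2 2 \<omega> k = (\<lambda>X Y. s ^ k * bprod (k * 2) c X Y)"
proof (induction k)
  case 0
  show ?case by (simp add: bprod_0)
next
  case (Suc k)
  have "dpow 2 2 \<omega> (Suc k) = dwedge 2 2 (k * 2) (k * 2) (\<lambda>X Y. s * bprod 2 c X Y)
      (\<lambda>X Y. s ^ k * bprod (k * 2) c X Y)"
    by (simp only: dpow.simps Suc) (simp only: assms(1))
  also have "\<dots> = (\<lambda>X Y. s * s ^ k * bprod (2 + k * 2) (\<lambda>i. if i < 2 then c i else c (i - 2)) X Y)"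
    by (simp only: dwedge_scale dwedge_bprod)
  also have "(\<lambda>i. if i < 2 then c i else c (i - 2)) = c"
  proof
    fix i
    show "(if i < 2 then c i else c (i - 2)) = c i"
      using assms(2)[of "i - 2"] by (cases "i < 2") (simp_all del: add_2_eq_Suc')
  qed
  finally show ?case by simp
qed

subsection \<open>Sums over index tuples\<close>

text \<open>Multilinearity in the first \<open>r\<close> rows. The others are kept because the Hodge
  star sums only over the leading arguments of \<open>volume\<close>; \<open>r = n\<close> gives the
  full expansion.\<close>

lemma sdet_expand_rows:
  assumes "\<And>i j. i < r \<Longrightarrow> j < n \<Longrightarrow> M i j = (\<Sum>k\<in>A. c i k * N k j)" "finite A" "r \<le> n"
  shows "sdet n M = (\<Sum>I\<in>{..<r} \<rightarrow>\<^sub>E A. (\<Prod>i<r. c i (I i)) * sdet n (\<lambda>i j. if i < r then N (I i) j else M i j))"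
proof -
  obtain s where n: "n = r + s"
    using assms(3) le_Suc_ex by blast
  have "(\<Prod>i<n. M i (\<sigma> i)) = (\<Sum>I\<in>{..<r} \<rightarrow>\<^sub>E A.
      (\<Prod>i<r. c i (I i)) * (\<Prod>i<n. if i < r then N (I i) (\<sigma> i) else M i (\<sigma> i)))"
    if "\<sigma> permutes {..<n}" for \<sigma>
  proof -
    have "(\<Prod>i<r. M i (\<sigma> i)) = (\<Prod>i<r. \<Sum>k\<in>A. c i k * N k (\<sigma> i))"
      using assms(3) by (intro prod.cong refl assms(1)) (auto intro: permutes_nat_less[OF that])
    also have "\<dots> = (\<Sum>I\<in>{..<r} \<rightarrow>\<^sub>E A. \<Prod>i<r. c i (I i) * N (I i) (\<sigma> i))"
      by (rule prod_sum_PiE) (auto simp: assms)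
    finally show ?thesis
      by (simp add: n prod_lessThan_add sum_distrib_right prod.distrib mult.assoc)
  qed
  then have "sdet n M = (\<Sum>\<sigma> | \<sigma> permutes {..<n}. \<Sum>I\<in>{..<r} \<rightarrow>\<^sub>E A. (\<Prod>i<r. c i (I i)) *
      (of_int (sign \<sigma>) * (\<Prod>i<n. if i < r then N (I i) (\<sigma> i) else M i (\<sigma> i))))"
    unfolding sdet_def by (intro sum.cong refl) (simp add: sum_distrib_left mult_ac)
  also have "\<dots> = (\<Sum>I\<in>{..<r} \<rightarrow>\<^sub>E A. \<Sum>\<sigma> | \<sigma> permutes {..<n}. (\<Prod>i<r. c i (I i)) *
      (of_int (sign \<sigma>) * (\<Prod>i<n. if i < r then N (I i) (\<sigma> i) else M i (\<sigma> i))))"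
    by (rule sum.swap)
  finally show ?thesis
    by (simp add: sdet_def sum_distrib_left)
qed

lemma sdet_expand_cols:
  assumes "\<And>i j. i < n \<Longrightarrow> j < r \<Longrightarrow> M i j = (\<Sum>k\<in>A. c j k * N k i)" "finite A" "r \<le> n"
  shows "sdet n M = (\<Sum>I\<in>{..<r} \<rightarrow>\<^sub>E A. (\<Prod>j<r. c j (I j)) * sdet n (\<lambda>i j. if j < r then N (I j) i else M i j))"
proof -
  have "sdet n M = sdet n (\<lambda>i j. M j i)"
    by (rule sdet_transpose[symmetric])
  also have "\<dots> = (\<Sum>I\<in>{..<r} \<rightarrow>\<^sub>E A. (\<Prod>i<r. c i (I i)) * sdet n (\<lambda>i j. if i < r then N (I i) j else M j i))"
    by (rule sdet_expand_rows) (use assms in auto)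
  also have "\<dots> = (\<Sum>I\<in>{..<r} \<rightarrow>\<^sub>E A. (\<Prod>j<r. c j (I j)) * sdet n (\<lambda>i j. if j < r then N (I j) i else M i j))"
    using sdet_transpose[of n "\<lambda>i j. if j < r then N (I j) i else M i j" for I] by simp
  finally show ?thesis .
qed

lemma sum_PiE_permute:
  fixes r :: nat
  assumes "\<sigma> permutes {..<r}"
  shows "(\<Sum>I\<in>{..<r} \<rightarrow>\<^sub>E A. f (\<lambda>i. I (\<sigma> i))) = (\<Sum>I\<in>{..<r} \<rightarrow>\<^sub>E A. f I)"
proof (rule sum.reindex_bij_witness[of _ "\<lambda>I i. I (Hilbert_Choice.inv \<sigma> i)" "\<lambda>I i. I (\<sigma> i)"])
  have *: "(\<lambda>i. I (\<pi> i)) \<in> {..<r} \<rightarrow>\<^sub>E A" if "\<pi> permutes {..<r}" "I \<in> {..<r} \<rightarrow>\<^sub>E A" for \<pi> I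
    using that permutes_nat_less[OF that(1)] permutes_not_in[OF that(1)]
    by (auto simp: PiE_iff extensional_def)
  show "(\<lambda>i. I (\<sigma> i)) \<in> {..<r} \<rightarrow>\<^sub>E A" if "I \<in> {..<r} \<rightarrow>\<^sub>E A" for I
    using *[OF assms that] .
  show "(\<lambda>i. I (Hilbert_Choice.inv \<sigma> i)) \<in> {..<r} \<rightarrow>\<^sub>E A" if "I \<in> {..<r} \<rightarrow>\<^sub>E A" for I
    using *[OF permutes_inv[OF assms] that] .
qed (simp_all add: permutes_inverses[OF assms])

text \<open>One permutation \<pi>0 with tail \<open>J\<close> is built; all others arise from it by
  first permuting the leading \<open>r\<close> indices.\<close>

lemma card_permutes_with_tail:
  assumes J: "J \<in> {..<s} \<rightarrow>\<^sub>E {..<r + s}" "inj_on J {..<s}"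
  shows "card {\<pi>. \<pi> permutes {..<r + s} \<and> (\<lambda>j\<in>{..<s}. \<pi> (r + j)) = J} = fact r"
proof -
  define C where "C = {..<r + s} - J ` {..<s}"
  have "card C = r"
    unfolding C_def using J by (subst card_Diff_subset) (auto simp: card_image)
  moreover have "finite C"
    by (simp add: C_def)
  ultimately obtain h where h: "bij_betw h {..<r} C"
    using finite_same_card_bij[of "{..<r}" C] by auto
  \<comment> \<open>The head is an arbitrary enumeration \<open>h\<close> of the indices missed by
    \<open>J\<close>.\<close>
  define \<pi>0 where "\<pi>0 = (\<lambda>i. if i < r then h i else if i < r + s then J (i - r) else i)"
  have b1: "bij_betw \<pi>0 {..<r} C"
    using h by (rule bij_betw_cong[THEN iffD1, rotated]) (simp add: \<pi>0_def)
  have "bij_betw (\<lambda>i. J (i - r)) {r..<r + s} (J ` {..<s})"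
  proof -
    have "bij_betw (\<lambda>i. i - r) {r..<r + s} {..<s}"
      by (rule bij_betw_byWitness[of _ "\<lambda>i. i + r"]) auto
    from bij_betw_trans[OF this, of J] show ?thesis
      using J(2) by (simp add: bij_betw_def o_def)
  qed
  then have b2: "bij_betw \<pi>0 {r..<r + s} (J ` {..<s})"
    by (rule bij_betw_cong[THEN iffD1, rotated]) (simp add: \<pi>0_def)
  have "bij_betw \<pi>0 ({..<r} \<union> {r..<r + s}) (C \<union> J ` {..<s})"
    by (rule bij_betw_combine[OF b1 b2]) (auto simp: C_def)
  moreover have "{..<r} \<union> {r..<r + s} = {..<r + s}"
    by auto
  moreover have "C \<union> J ` {..<s} = {..<r + s}"
  proof -
    have "J ` {..<s} \<subseteq> {..<r + s}"
      using J(1) by (intro image_subsetI) (rule PiE_mem)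
    then show ?thesis
      unfolding C_def by blast
  qed
  ultimately have "bij_betw \<pi>0 {..<r + s} {..<r + s}"
    by simp
  then have \<pi>0: "\<pi>0 permutes {..<r + s}"
    by (rule bij_imp_permutes) (simp add: \<pi>0_def)
  have tail: "\<pi>0 (r + j) = J j" if "j < s" for j
    using that by (simp add: \<pi>0_def)
  have "{\<pi>. \<pi> permutes {..<r + s} \<and> (\<lambda>j\<in>{..<s}. \<pi> (r + j)) = J} = (\<lambda>\<tau>. \<pi>0 \<circ> \<tau>) ` {\<tau>. \<tau> permutes {..<r}}"
  proof (intro equalityI subsetI)
    fix \<pi> assume "\<pi> \<in> {\<pi>. \<pi> permutes {..<r + s} \<and> (\<lambda>j\<in>{..<s}. \<pi> (r + j)) = J}"
    then have \<pi>: "\<pi> permutes {..<r + s}" and eq: "(\<lambda>j\<in>{..<s}. \<pi> (r + j)) = J"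
      by auto
    define \<tau> where "\<tau> = Hilbert_Choice.inv \<pi>0 \<circ> \<pi>"
    have \<tau>: "\<tau> permutes {..<r + s}"
      unfolding \<tau>_def by (rule permutes_compose[OF \<pi> permutes_inv[OF \<pi>0]])
    have "\<tau> i = i" if "i \<notin> {..<r}" for i
    proof (cases "i < r + s")
      case True
      then have i: "i - r < s" "r + (i - r) = i"
        using that by auto
      then have "\<pi> i = J (i - r)"
        using fun_cong[OF eq, of "i - r"] by simp
      also have "\<dots> = \<pi>0 i"
        using tail[OF i(1)] i(2) by simp
      finally show ?thesis
        by (simp add: \<tau>_def permutes_inverses[OF \<pi>0])
    qed (use permutes_not_in[OF \<tau>] in auto)
    then have "\<tau> permutes {..<r}"
      by (intro permutes_superset[OF \<tau>]) auto
    moreover have "\<pi> = \<pi>0 \<circ> \<tau>"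
      by (simp add: \<tau>_def fun_eq_iff permutes_inverses[OF \<pi>0])
    ultimately show "\<pi> \<in> (\<lambda>\<tau>. \<pi>0 \<circ> \<tau>) ` {\<tau>. \<tau> permutes {..<r}}"
      by blast
  next
    fix \<pi> assume "\<pi> \<in> (\<lambda>\<tau>. \<pi>0 \<circ> \<tau>) ` {\<tau>. \<tau> permutes {..<r}}"
    then obtain \<tau> where \<tau>: "\<tau> permutes {..<r}" "\<pi> = \<pi>0 \<circ> \<tau>"
      by auto
    have "\<tau> permutes {..<r + s}"
      by (rule permutes_subset[OF \<tau>(1)]) auto
    then have "\<pi> permutes {..<r + s}"
      unfolding \<tau>(2) by (rule permutes_compose[OF _ \<pi>0])
    moreover have "(\<lambda>j\<in>{..<s}. \<pi> (r + j)) = J"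
    proof
      fix j
      show "(\<lambda>j\<in>{..<s}. \<pi> (r + j)) j = J j"
        using PiE_arb[OF J(1), of j] permutes_not_in[OF \<tau>(1), of "r + j"] tail[of j]
        by (cases "j < s") (auto simp: \<tau>(2))
    qed
    ultimately show "\<pi> \<in> {\<pi>. \<pi> permutes {..<r + s} \<and> (\<lambda>j\<in>{..<s}. \<pi> (r + j)) = J}"
      by simp
  qed
  moreover have "inj_on (\<lambda>\<tau>. \<pi>0 \<circ> \<tau>) {\<tau>. \<tau> permutes {..<r}}"
  proof (intro inj_onI ext)
    fix \<tau> \<tau>' i assume "\<pi>0 \<circ> \<tau> = \<pi>0 \<circ> \<tau>'"
    from fun_cong[OF this, of i] show "\<tau> i = \<tau>' i"
      by - (rule injD[OF permutes_inj[OF \<pi>0]], simp)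
  qed
  ultimately show ?thesis
    by (simp add: card_image card_permutations)
qed

text \<open>Permutations are grouped by their tail. An injective tail occurs \<open>fact r\<close>
  times; a non-injective one never occurs, and on the right the assumption makes its term 0.\<close>

lemma sum_permutes_tail:
  fixes H :: "(nat \<Rightarrow> nat) \<Rightarrow> real"
  assumes "\<And>J. \<not> inj_on J {..<s} \<Longrightarrow> H J = 0"
  shows "(\<Sum>\<pi> | \<pi> permutes {..<r + s}. H (\<lambda>j\<in>{..<s}. \<pi> (r + j)))
    = fact r * (\<Sum>J\<in>{..<s} \<rightarrow>\<^sub>E {..<r + s}. H J)"
proof -
  let ?P = "{\<pi>. \<pi> permutes {..<r + s}}" and ?T = "\<lambda>\<pi>. \<lambda>j\<in>{..<s}. \<pi> (r + j) :: nat"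
  have "(\<Sum>\<pi>\<in>?P. H (?T \<pi>)) = (\<Sum>J\<in>{..<s} \<rightarrow>\<^sub>E {..<r + s}. \<Sum>\<pi> | \<pi> \<in> ?P \<and> ?T \<pi> = J. H (?T \<pi>))"
  proof (rule sum.group[symmetric])
    show "?T ` ?P \<subseteq> {..<s} \<rightarrow>\<^sub>E {..<r + s}"
    proof (rule image_subsetI)
      fix \<pi> assume "\<pi> \<in> ?P"
      then show "?T \<pi> \<in> {..<s} \<rightarrow>\<^sub>E {..<r + s}"
        using permutes_nat_less[of \<pi> "r + s"] by (simp add: restrict_PiE_iff)
    qed
  qed (simp_all add: finite_permutations finite_PiE)
  also have "\<dots> = (\<Sum>J\<in>{..<s} \<rightarrow>\<^sub>E {..<r + s}. fact r * H J)"
  proof (intro sum.cong refl)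
    fix J assume J: "J \<in> {..<s} \<rightarrow>\<^sub>E {..<r + s}"
    have "(\<Sum>\<pi> | \<pi> \<in> ?P \<and> ?T \<pi> = J. H (?T \<pi>)) = (\<Sum>\<pi> | \<pi> \<in> ?P \<and> ?T \<pi> = J. H J)"
      by (intro sum.cong refl) (elim CollectE conjE, simp only:)
    also have "\<dots> = fact r * H J"
      using assms[of J] card_permutes_with_tail[OF J]
      by (cases "inj_on J {..<s}") (simp_all only: sum_constant mem_Collect_eq, simp_all)
    finally show "(\<Sum>\<pi> | \<pi> \<in> ?P \<and> ?T \<pi> = J. H (?T \<pi>)) = fact r * H J" .
  qed
  finally show ?thesis
    by (simp add: sum_distrib_left)
qed

subsection \<open>The Hodge star of exterior products\<close>

lemma inner_productD:
  assumes "inner_product g"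
  shows "linear (g u)" "linear (\<lambda>v. g v u)" "g u v = g v u" "u \<noteq> 0 \<Longrightarrow> 0 < g u u"
  using assms unfolding inner_product_def bilinear_def by auto

lemma orthonormal_basisD:
  assumes "orthonormal_basis g (e :: nat \<Rightarrow> 'v::euclidean_space)" "i < DIM('v)" "j < DIM('v)"
  shows "g (e i) (e j) = (if i = j then 1 else 0)"
  using assms unfolding orthonormal_basis_def by auto

lemma orthonormal_expansion:
  fixes g :: "'v::euclidean_space \<Rightarrow> 'v \<Rightarrow> real"
  assumes g: "inner_product g" and e: "orthonormal_basis g e"
  shows "u = (\<Sum>l<DIM('v). g (e l) u *\<^sub>R e l)"
proof -
  note lin = inner_productD(1,2)[OF g]
  have inj: "inj_on e {..<DIM('v)}"
    using orthonormal_basisD[OF e] by (intro inj_onI) (metis lessThan_iff zero_neq_one)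
  have "independent (e ` {..<DIM('v)})"
  proof (rule independent_if_scalars_zero)
    fix c x assume *: "(\<Sum>x\<in>e ` {..<DIM('v)}. c x *\<^sub>R x) = 0" and "x \<in> e ` {..<DIM('v)}"
    then obtain i where i: "i < DIM('v)" "x = e i"
      by auto
    have "0 = g (e i) (\<Sum>l<DIM('v). c (e l) *\<^sub>R e l)"
      using * by (simp add: sum.reindex[OF inj] linear_0[OF lin(1)])
    also have "\<dots> = (\<Sum>l<DIM('v). c (e l) * g (e i) (e l))"
      by (simp add: linear_sum[OF lin(1)] linear_scale[OF lin(1)])
    also have "\<dots> = (\<Sum>l<DIM('v). if l = i then c (e l) else 0)"
      by (intro sum.cong refl) (use i in \<open>simp add: orthonormal_basisD[OF e]\<close>)
    finally show "c x = 0"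
      using i by simp
  qed simp
  then have "span (e ` {..<DIM('v)}) = UNIV"
    using card_ge_dim_independent[of "e ` {..<DIM('v)}" UNIV] by (auto simp: card_image[OF inj])
  moreover have "w \<in> span (e ` {..<DIM('v)}) \<Longrightarrow> w = (\<Sum>l<DIM('v). g (e l) w *\<^sub>R e l)" for w
  proof (induction rule: span_induct_alt)
    case base
    then show ?case by (simp add: linear_0[OF lin(1)])
  next
    case (step c x y)
    then obtain i where i: "i < DIM('v)" "x = e i"
      by auto
    have "(\<Sum>l<DIM('v). g (e l) (e i) *\<^sub>R e l) = (\<Sum>l<DIM('v). if l = i then e l else 0)"
      by (intro sum.cong refl) (use i in \<open>simp add: orthonormal_basisD[OF e]\<close>)
    also have "\<dots> = x"
      using i by simp
    finally have "(\<Sum>l<DIM('v). g (e l) (c *\<^sub>R x + y) *\<^sub>R e l) = c *\<^sub>R x + (\<Sum>l<DIM('v). g (e l) y *\<^sub>R e l)"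
      using i by (simp add: linear_add[OF lin(1)] linear_scale[OF lin(1)] scaleR_add_left
          sum.distrib scaleR_scaleR[symmetric] scaleR_sum_right[symmetric] del: scaleR_scaleR)
    with step show ?case by simp
  qed
  ultimately show ?thesis
    by blast
qed

lemma bilinear_diagonal_expansion:
  fixes g :: "'v::euclidean_space \<Rightarrow> 'v \<Rightarrow> real"
  assumes g: "inner_product g" and b: "orthonormal_basis g b" and a: "bilinear a"
    and diag: "\<And>i j. i < DIM('v) \<Longrightarrow> j < DIM('v) \<Longrightarrow> a (b i) (b j) = (if i = j then c i else 0)"
  shows "a u v = (\<Sum>l<DIM('v). c l * g (b l) u * g (b l) v)"
proof -
  have lin: "linear (a x)" "linear (\<lambda>x. a x y)" for x y
    using a unfolding bilinear_def by auto
  have "a u v = a (\<Sum>l<DIM('v). g (b l) u *\<^sub>R b l) (\<Sum>m<DIM('v). g (b m) v *\<^sub>R b m)"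
    using orthonormal_expansion[OF g b, of u] orthonormal_expansion[OF g b, of v] by simp
  also have "\<dots> = (\<Sum>l<DIM('v). \<Sum>m<DIM('v). g (b l) u * (g (b m) v * a (b l) (b m)))"
    by (simp add: linear_sum[OF lin(1)] linear_sum[OF lin(2)] linear_scale[OF lin(1)]
        linear_scale[OF lin(2)] sum_distrib_left)
      (rule trans[OF sum.swap], simp add: mult.left_commute)
  also have "\<dots> = (\<Sum>l<DIM('v). \<Sum>m<DIM('v). if m = l then c l * g (b l) u * g (b l) v else 0)"
    by (intro sum.cong refl) (simp add: diag)
  finally show ?thesis
    by simp
qed

lemma volume_eq_sdet:
  "volume g e y = sdet DIM('v) (\<lambda>i j. g (e i) (y j))" for e :: "nat \<Rightarrow> 'v::euclidean_space"
  by (simp add: volume_def sdet_def)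

lemma volume_change_basis:
  fixes g :: "'v::euclidean_space \<Rightarrow> 'v \<Rightarrow> real"
  assumes g: "inner_product g" and b: "orthonormal_basis g b"
  shows "volume g e y = volume g e b * volume g b y"
proof -
  have "g (e i) (y j) = (\<Sum>k<DIM('v). g (e i) (b k) * g (b k) (y j))" for i j
  proof -
    have "g (e i) (y j) = g (e i) (\<Sum>k<DIM('v). g (b k) (y j) *\<^sub>R b k)"
      using orthonormal_expansion[OF g b, of "y j"] by simp
    then show ?thesis
      by (simp add: linear_sum[OF inner_productD(1)[OF g]] linear_scale[OF inner_productD(1)[OF g]] mult.commute)
  qed
  then show ?thesis
    by (simp add: volume_eq_sdet sdet_mult[symmetric])
qed

text \<open>The square of the determinant of an orthogonal matrix. Since \<open>volume\<close>
  enters the double star twice, the star does not depend on the orthonormal basis.\<close>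

lemma volume_basis_squared:
  fixes g :: "'v::euclidean_space \<Rightarrow> 'v \<Rightarrow> real"
  assumes g: "inner_product g" and b: "orthonormal_basis g b" and e: "orthonormal_basis g e"
  shows "volume g e b * volume g e b = 1"
proof -
  have "volume g e e = sdet DIM('v) (\<lambda>i j. if i = j then 1 else 0)"
    unfolding volume_eq_sdet by (rule sdet_cong) (rule orthonormal_basisD[OF e])
  also have "\<dots> = 1"
    using sdet_block[of "DIM('v)" "\<lambda>i j. if i = j then 1 else 0" 0] by (simp add: sdet_def[of 0])
  finally have "volume g e b * volume g b e = 1"
    using volume_change_basis[OF g b, of e e] by simp
  moreover have "volume g b e = volume g e b"
    using sdet_transpose[of "DIM('v)" "\<lambda>i j. g (b i) (e j)"] inner_productD(3)[OF g]
    by (simp add: volume_eq_sdet)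
  ultimately show ?thesis by simp
qed

definition prepend :: "nat \<Rightarrow> (nat \<Rightarrow> 'v) \<Rightarrow> (nat \<Rightarrow> 'v) \<Rightarrow> nat \<Rightarrow> 'v" where
  "prepend r u y = (\<lambda>i. if i < r then u i else y (i - r))"

text \<open>Applied from right to left, it collapses a sum over tuples from \<open>e\<close>, as
  produced by \<open>hodge\<close>, to one volume with chosen vectors in front.\<close>

lemma volume_expand:
  fixes g :: "'v::euclidean_space \<Rightarrow> 'v \<Rightarrow> real"
  assumes g: "inner_product g" and e: "orthonormal_basis g e" and r: "r \<le> DIM('v)"
  shows "volume g f (prepend r u y) = (\<Sum>I\<in>{..<r} \<rightarrow>\<^sub>E {..<DIM('v)}.
      (\<Prod>i<r. g (u i) (e (I i))) * volume g f (prepend r (\<lambda>i. e (I i)) y))"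
proof -
  have "g (f i) (u j) = (\<Sum>k<DIM('v). g (u j) (e k) * g (f i) (e k))" for i j
  proof -
    have "g (f i) (u j) = g (f i) (\<Sum>k<DIM('v). g (e k) (u j) *\<^sub>R e k)"
      using orthonormal_expansion[OF g e, of "u j"] by simp
    then show ?thesis
      by (simp add: linear_sum[OF inner_productD(1)[OF g]] linear_scale[OF inner_productD(1)[OF g]]
          inner_productD(3)[OF g, of "u j"])
  qed
  then have "volume g f (prepend r u y) = (\<Sum>I\<in>{..<r} \<rightarrow>\<^sub>E {..<DIM('v)}. (\<Prod>j<r. g (u j) (e (I j))) *
      sdet DIM('v) (\<lambda>i j. if j < r then g (f i) (e (I j)) else g (f i) (prepend r u y j)))"
    unfolding volume_eq_sdet by (intro sdet_expand_cols[where N = "\<lambda>k i. g (f i) (e k)"]) (auto simp: r prepend_def)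
  then show ?thesis
    unfolding volume_eq_sdet by (simp add: prepend_def if_distrib cong: if_cong)
qed

lemma volume_permute_head:
  fixes e :: "nat \<Rightarrow> 'v::euclidean_space"
  assumes "\<sigma> permutes {..<r}" "r \<le> DIM('v)"
  shows "volume g e (prepend r (\<lambda>i. u (\<sigma> i)) y) = of_int (sign \<sigma>) * volume g e (prepend r u y)"
proof -
  have "\<sigma> permutes {..<DIM('v)}"
    by (rule permutes_subset[OF assms(1)]) (use assms(2) in auto)
  moreover have "prepend r (\<lambda>i. u (\<sigma> i)) y = (\<lambda>j. prepend r u y (\<sigma> j))"
    using permutes_nat_less[OF assms(1)] permutes_not_in[OF assms(1)] by (auto simp: fun_eq_iff prepend_def)
  ultimately show ?thesis
    unfolding volume_eq_sdet
    using sdet_permute_cols[of \<sigma> "DIM('v)" "\<lambda>i j. g (e i) (prepend r u y j)"] by simp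
qed

text \<open>The antisymmetrisation in \<open>bprod\<close> is already contained in the volumes:
  reindexing the tuples \<open>I\<close> and \<open>J\<close> by \<sigma> and \<tau> makes all
  (r!)^2 terms equal, which cancels the factorials of the two stars.\<close>

lemma dhodge_at_bprod:
  fixes e :: "nat \<Rightarrow> 'v::euclidean_space"
  assumes r: "r \<le> DIM('v)"
  shows "dhodge_at g e r r (bprod r a) X Y = (\<Sum>I\<in>{..<r} \<rightarrow>\<^sub>E {..<DIM('v)}. \<Sum>J\<in>{..<r} \<rightarrow>\<^sub>E {..<DIM('v)}.
     (\<Prod>i<r. a i (e (I i)) (e (J i))) *
       (volume g e (prepend r (\<lambda>i. e (I i)) X) * volume g e (prepend r (\<lambda>i. e (J i)) Y)))" (is "_ = ?Q")
proof -
  let ?E = "{..<r} \<rightarrow>\<^sub>E {..<DIM('v)}" and ?P = "{\<sigma>. \<sigma> permutes {..<r}}"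
  let ?s = "\<lambda>\<sigma>::nat \<Rightarrow> nat. real_of_int (sign \<sigma>)"
  let ?V = "\<lambda>I. volume g e (prepend r (\<lambda>i. e (I i)) X)" and ?W = "\<lambda>J. volume g e (prepend r (\<lambda>i. e (J i)) Y)"
  have "(\<Sum>I\<in>?E. \<Sum>J\<in>?E. bprod r a (\<lambda>i. e (I i)) (\<lambda>i. e (J i)) * ?W J * ?V I)
    = (\<Sum>I\<in>?E. \<Sum>J\<in>?E. \<Sum>\<sigma>\<in>?P. \<Sum>\<tau>\<in>?P.
        (\<Prod>i<r. a i (e (I (\<sigma> i))) (e (J (\<tau> i)))) * ((?s \<sigma> * ?V I) * (?s \<tau> * ?W J)))"
    unfolding bprod_def sum_distrib_right by (intro sum.cong refl) (simp only: mult_ac)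
  also have "\<dots> = (\<Sum>\<sigma>\<in>?P. \<Sum>\<tau>\<in>?P. \<Sum>I\<in>?E. \<Sum>J\<in>?E.
        (\<Prod>i<r. a i (e (I (\<sigma> i))) (e (J (\<tau> i)))) * ((?s \<sigma> * ?V I) * (?s \<tau> * ?W J)))"
    by ((rule trans[OF sum_rotate3], rule sum.cong[OF refl])+, rule refl)
  also have "\<dots> = (\<Sum>\<sigma>\<in>?P. \<Sum>\<tau>\<in>?P. ?Q)"
  proof (rule sum.cong[OF refl], rule sum.cong[OF refl])
    fix \<sigma> \<tau> assume "\<sigma> \<in> ?P" "\<tau> \<in> ?P"
    then have \<sigma>: "\<sigma> permutes {..<r}" and \<tau>: "\<tau> permutes {..<r}" by auto
    have "(\<Sum>I\<in>?E. \<Sum>J\<in>?E. (\<Prod>i<r. a i (e (I (\<sigma> i))) (e (J (\<tau> i)))) * ((?s \<sigma> * ?V I) * (?s \<tau> * ?W J)))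
      = (\<Sum>I\<in>?E. \<Sum>J\<in>?E. (\<Prod>i<r. a i (e (I (\<sigma> i))) (e (J (\<tau> i)))) *
          (?V (\<lambda>i. I (\<sigma> i)) * ?W (\<lambda>i. J (\<tau> i))))"
      by (simp only: volume_permute_head[OF \<sigma> r, of g e "\<lambda>i. e (I i)" for I]
          volume_permute_head[OF \<tau> r, of g e "\<lambda>i. e (I i)" for I])
    also have "\<dots> = (\<Sum>I\<in>?E. \<Sum>J\<in>?E. (\<Prod>i<r. a i (e (I (\<sigma> i))) (e (J i))) * (?V (\<lambda>i. I (\<sigma> i)) * ?W J))"
      by (rule sum.cong[OF refl], rule sum_PiE_permute[OF \<tau>, where
          f = "\<lambda>J. (\<Prod>i<r. a i (e (I (\<sigma> i))) (e (J i))) * (?V (\<lambda>i. I (\<sigma> i)) * ?W J)" for I])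
    also have "\<dots> = ?Q"
      by (rule sum_PiE_permute[OF \<sigma>, where
          f = "\<lambda>I. \<Sum>J\<in>?E. (\<Prod>i<r. a i (e (I i)) (e (J i))) * (?V I * ?W J)"])
    finally show "(\<Sum>I\<in>?E. \<Sum>J\<in>?E.
        (\<Prod>i<r. a i (e (I (\<sigma> i))) (e (J (\<tau> i)))) * ((?s \<sigma> * ?V I) * (?s \<tau> * ?W J))) = ?Q" .
  qed
  also have "\<dots> = fact r * fact r * ?Q"
    by (simp add: card_permutations)
  finally have "(\<Sum>I\<in>?E. \<Sum>J\<in>?E. bprod r a (\<lambda>i. e (I i)) (\<lambda>i. e (J i)) * ?W J * ?V I) = fact r * fact r * ?Q" .
  then show ?thesis
    unfolding dhodge_at_def hodge_def prepend_def
    by (simp add: sum_distrib_right sum_divide_distrib[symmetric] times_divide_eq_left)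
qed

text \<open>In the Leibniz sum of the transposed matrix, orthonormality removes every permutation
  whose head differs from \<open>L\<close>. The conditional is kept so that the sum over
  \<open>L\<close> can later be carried out first.\<close>

lemma volume_prepend_basis:
  fixes g :: "'v::euclidean_space \<Rightarrow> 'v \<Rightarrow> real"
  assumes b: "orthonormal_basis g b" and dim: "DIM('v) = r + s" and L: "L \<in> {..<r} \<rightarrow>\<^sub>E {..<r + s}"
  shows "volume g b (prepend r (\<lambda>i. b (L i)) X) = (\<Sum>\<pi> | \<pi> permutes {..<r + s}.
    if (\<lambda>i\<in>{..<r}. \<pi> i) = L then of_int (sign \<pi>) * (\<Prod>j<s. g (b (\<pi> (r + j))) (X j)) else 0)"
proof -
  have "volume g b (prepend r (\<lambda>i. b (L i)) X)
      = sdet (r + s) (\<lambda>i j. g (b j) (prepend r (\<lambda>i. b (L i)) X i))"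
    unfolding volume_eq_sdet dim by (rule sdet_transpose[symmetric])
  also have "\<dots> = (\<Sum>\<pi> | \<pi> permutes {..<r + s}. of_int (sign \<pi>) *
      ((\<Prod>i<r. g (b (\<pi> i)) (b (L i))) * (\<Prod>j<s. g (b (\<pi> (r + j))) (X j))))"
    unfolding sdet_def by (simp add: prod_lessThan_add prepend_def)
  also have "\<dots> = (\<Sum>\<pi> | \<pi> permutes {..<r + s}.
    if (\<lambda>i\<in>{..<r}. \<pi> i) = L then of_int (sign \<pi>) * (\<Prod>j<s. g (b (\<pi> (r + j))) (X j)) else 0)"
  proof (rule sum.cong[OF refl])
    fix \<pi> assume "\<pi> \<in> {\<pi>. \<pi> permutes {..<r + s}}"
    then have \<pi>: "\<pi> permutes {..<r + s}" by simp
    have *: "g (b (\<pi> i)) (b (L i)) = (if \<pi> i = L i then 1 else 0)" if "i < r" for i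
      using that PiE_mem[OF L, of i] permutes_nat_less[OF \<pi>, of i]
      by (intro orthonormal_basisD[OF b]) (auto simp: dim)
    have "(\<Prod>i<r. g (b (\<pi> i)) (b (L i))) = (if (\<lambda>i\<in>{..<r}. \<pi> i) = L then 1 else 0)"
    proof (cases "(\<lambda>i\<in>{..<r}. \<pi> i) = L")
      case True
      then have "\<pi> i = L i" if "i < r" for i
        using that by (simp flip: True)
      with True * show ?thesis by simp
    next
      case False
      then obtain i where i: "restrict \<pi> {..<r} i \<noteq> L i"
        by (auto simp: fun_eq_iff)
      then have "i < r"
        using PiE_arb[OF L, of i] by (cases "i < r") auto
      with i * have "(\<Prod>i<r. g (b (\<pi> i)) (b (L i))) = 0"
        by (intro prod_zero) auto
      with False show ?thesis by simp
    qed
    then show "of_int (sign \<pi>) * ((\<Prod>i<r. g (b (\<pi> i)) (b (L i))) * (\<Prod>j<s. g (b (\<pi> (r + j))) (X j)))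
      = (if (\<lambda>i\<in>{..<r}. \<pi> i) = L then of_int (sign \<pi>) * (\<Prod>j<s. g (b (\<pi> (r + j))) (X j)) else 0)"
      by simp
  qed
  finally show ?thesis .
qed

text \<open>Permuting the rows by \<pi> produces an identity block with zeros below it; what remains
  is the minor on the complementary indices.\<close>

lemma volume_prepend_permutation:
  fixes g :: "'v::euclidean_space \<Rightarrow> 'v \<Rightarrow> real"
  assumes b: "orthonormal_basis g b" and dim: "DIM('v) = r + s" and \<pi>: "\<pi> permutes {..<r + s}"
  shows "of_int (sign \<pi>) * volume g b (prepend r (\<lambda>i. b (\<pi> i)) Y) = sdet s (\<lambda>i j. g (b (\<pi> (r + i))) (Y j))"
proof -
  have lt: "\<pi> i < DIM('v)" if "i < r + s" for i
    using permutes_nat_less[OF \<pi> that] dim by simp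
  have "of_int (sign \<pi>) * volume g b (prepend r (\<lambda>i. b (\<pi> i)) Y)
    = sdet (r + s) (\<lambda>i j. g (b (\<pi> i)) (prepend r (\<lambda>i. b (\<pi> i)) Y j))"
    unfolding volume_eq_sdet dim
    by (rule sdet_permute_rows[OF \<pi>, of "\<lambda>i j. g (b i) (prepend r (\<lambda>i. b (\<pi> i)) Y j)", symmetric])
  also have "\<dots> = sdet s (\<lambda>i j. g (b (\<pi> (r + i))) (prepend r (\<lambda>i. b (\<pi> i)) Y (r + j)))"
  proof (rule sdet_block)
    fix i j assume "i < r" "j < r"
    then show "g (b (\<pi> i)) (prepend r (\<lambda>i. b (\<pi> i)) Y j) = (if i = j then 1 else 0)"
      using orthonormal_basisD[OF b lt lt, of i j] inj_eq[OF permutes_inj[OF \<pi>], of i j]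
      by (simp add: prepend_def)
  next
    fix i j assume "i < s" "j < r"
    then show "g (b (\<pi> (r + i))) (prepend r (\<lambda>i. b (\<pi> i)) Y j) = 0"
      using orthonormal_basisD[OF b lt lt, of "r + i" j] inj_eq[OF permutes_inj[OF \<pi>], of "r + i" j]
      by (simp add: prepend_def)
  qed
  finally show ?thesis
    by (simp add: prepend_def)
qed

text \<open>In the eigenbasis \<open>b\<close> the star replaces each set of \<open>r\<close>
  indices by its complement while keeping the product of eigenvalues. The hypothesis
  \<open>compl\<close> says that this product is the one that \<open>a'\<close> has on the
  complement.\<close>

lemma dhodge_at_diagonal:
  fixes g :: "'v::euclidean_space \<Rightarrow> 'v \<Rightarrow> real"
  assumes g: "inner_product g" and e: "orthonormal_basis g e" and b: "orthonormal_basis g b"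
    and dim: "DIM('v) = r + r"
    and a: "\<And>u v. a u v = (\<Sum>l<r + r. c l * g (b l) u * g (b l) v)"
    and a': "\<And>u v. a' u v = (\<Sum>l<r + r. c' l * g (b l) u * g (b l) v)"
    and compl: "\<And>\<pi>. \<pi> permutes {..<r + r} \<Longrightarrow> (\<Prod>i<r. c (\<pi> i)) = (\<Prod>j<r. c' (\<pi> (r + j)))"
  shows "dhodge_at g e r r (bprod r (\<lambda>_. a)) = bprod r (\<lambda>_. a')"
proof (intro ext)
  fix X Y :: "nat \<Rightarrow> 'v"
  let ?E = "{..<r} \<rightarrow>\<^sub>E {..<r + r}" and ?P = "{\<pi>. \<pi> permutes {..<r + r}}"
  let ?T = "\<lambda>\<pi>. \<lambda>i\<in>{..<r}. \<pi> i :: nat"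
  define V where "V I = volume g e (prepend r (\<lambda>i. e (I i)) X)" for I
  define W where "W I = volume g e (prepend r (\<lambda>i. e (I i)) Y)" for I
  define F where "F L I = (\<Prod>i<r. g (b (L i)) (e (I i)))" for L I
  define C where "C L = (\<Prod>i<r. c (L i))" for L
  define B where "B L = volume g b (prepend r (\<lambda>i. b (L i)) Y)" for L
  \<comment> \<open>The term of \<open>J\<close> in the row expansion of the determinant of
    \<open>a'\<close>.\<close>
  define H where "H J = (\<Prod>j<r. c' (J j) * g (b (J j)) (X j)) * sdet r (\<lambda>i j. g (b (J i)) (Y j))" for J
  have prod_a: "(\<Prod>i<r. a (e (I i)) (e (J i))) = (\<Sum>L\<in>?E. C L * F L I * F L J)" for I J
  proof -
    have "(\<Prod>i<r. a (e (I i)) (e (J i)))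
        = (\<Sum>L\<in>?E. \<Prod>i<r. c (L i) * g (b (L i)) (e (I i)) * g (b (L i)) (e (J i)))"
      unfolding a by (rule prod_sum_PiE) auto
    then show ?thesis
      by (simp add: C_def F_def prod.distrib)
  qed
  have "dhodge_at g e r r (bprod r (\<lambda>_. a)) X Y
      = (\<Sum>I\<in>?E. \<Sum>J\<in>?E. (\<Prod>i<r. a (e (I i)) (e (J i))) * (V I * W J))"
    using dhodge_at_bprod[of r g e "\<lambda>_. a" X Y] dim by (simp add: V_def W_def)
  also have "\<dots> = (\<Sum>I\<in>?E. \<Sum>J\<in>?E. \<Sum>L\<in>?E. C L * ((F L I * V I) * (F L J * W J)))"
    unfolding prod_a sum_distrib_right by (intro sum.cong refl) (simp only: mult_ac)
  also have "\<dots> = (\<Sum>L\<in>?E. \<Sum>I\<in>?E. \<Sum>J\<in>?E. C L * ((F L I * V I) * (F L J * W J)))"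
    by (rule sum_rotate3)
  also have "\<dots> = (\<Sum>L\<in>?E. C L * ((\<Sum>I\<in>?E. F L I * V I) * (\<Sum>J\<in>?E. F L J * W J)))"
    by (simp only: sum_product) (simp only: sum_distrib_left)
  also have "\<dots> = (\<Sum>L\<in>?E. C L * (volume g e (prepend r (\<lambda>i. b (L i)) X) * volume g e (prepend r (\<lambda>i. b (L i)) Y)))"
    using volume_expand[OF g e, of r e "\<lambda>i. b (L i)" for L] dim by (simp add: F_def V_def W_def)
  \<comment> \<open>The two volumes change basis with the same determinant, whose square is
    1.\<close>
  also have "\<dots> = (\<Sum>L\<in>?E. C L * (volume g b (prepend r (\<lambda>i. b (L i)) X) * B L))"
  proof -
    have "volume g e x * volume g e y = volume g b x * volume g b y" for x y
      using volume_change_basis[OF g b, of e x] volume_change_basis[OF g b, of e y]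
        volume_basis_squared[OF g b e] by (simp add: mult_ac)
    then show ?thesis by (simp add: B_def)
  qed
  \<comment> \<open>Only the volume containing \<open>X\<close> is expanded over permutations;
    \<open>B L\<close> stays whole, to become a complementary minor once \<open>L\<close> is the
    head of \<pi>.\<close>
  also have "\<dots> = (\<Sum>L\<in>?E. \<Sum>\<pi>\<in>?P. if ?T \<pi> = L then
      C L * (of_int (sign \<pi>) * (\<Prod>j<r. g (b (\<pi> (r + j))) (X j)) * B L) else 0)"
    by (intro sum.cong refl)
      (simp add: volume_prepend_basis[OF b dim] sum_distrib_left sum_distrib_right if_distrib if_distribR
        cong: if_cong)
  also have "\<dots> = (\<Sum>\<pi>\<in>?P. \<Sum>L\<in>?E. if ?T \<pi> = L then
      C L * (of_int (sign \<pi>) * (\<Prod>j<r. g (b (\<pi> (r + j))) (X j)) * B L) else 0)"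
    by (rule sum.swap)
  also have "\<dots> = (\<Sum>\<pi>\<in>?P. H (\<lambda>j\<in>{..<r}. \<pi> (r + j)))"
  proof (rule sum.cong[OF refl])
    fix \<pi> assume "\<pi> \<in> ?P"
    then have \<pi>: "\<pi> permutes {..<r + r}" by simp
    have "?T \<pi> \<in> ?E"
      using permutes_nat_less[OF \<pi>] by (simp add: restrict_PiE_iff)
    then have "(\<Sum>L\<in>?E. if ?T \<pi> = L then
        C L * (of_int (sign \<pi>) * (\<Prod>j<r. g (b (\<pi> (r + j))) (X j)) * B L) else 0)
      = C (?T \<pi>) * (of_int (sign \<pi>) * (\<Prod>j<r. g (b (\<pi> (r + j))) (X j)) * B (?T \<pi>))"
      by (simp add: finite_PiE)
    also have "B (?T \<pi>) = volume g b (prepend r (\<lambda>i. b (\<pi> i)) Y)"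
      unfolding B_def by (rule arg_cong[where f = "volume g b"]) (auto simp: prepend_def)
    also have "C (?T \<pi>) = (\<Prod>j<r. c' (\<pi> (r + j)))"
      unfolding C_def compl[OF \<pi>, symmetric] by (rule prod.cong) auto
    also have "(\<Prod>j<r. c' (\<pi> (r + j))) * (of_int (sign \<pi>) * (\<Prod>j<r. g (b (\<pi> (r + j))) (X j))
          * volume g b (prepend r (\<lambda>i. b (\<pi> i)) Y))
      = (\<Prod>j<r. c' (\<pi> (r + j)) * g (b (\<pi> (r + j))) (X j)) * sdet r (\<lambda>i j. g (b (\<pi> (r + i))) (Y j))"
      unfolding volume_prepend_permutation[OF b dim \<pi>, symmetric] prod.distrib by (simp only: mult_ac)
    also have "\<dots> = H (\<lambda>j\<in>{..<r}. \<pi> (r + j))"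
      unfolding H_def by (intro arg_cong2[where f = "(*)"] prod.cong sdet_cong) auto
    finally show "(\<Sum>L\<in>?E. if ?T \<pi> = L then
        C L * (of_int (sign \<pi>) * (\<Prod>j<r. g (b (\<pi> (r + j))) (X j)) * B L) else 0)
      = H (\<lambda>j\<in>{..<r}. \<pi> (r + j))" .
  qed
  \<comment> \<open>The summand sees only the tail of \<pi>, and a repeated index in a tail would
    repeat a row of the minor. The factor \<open>fact r\<close> is the one in
    \<open>bprod_const\<close>.\<close>
  also have "\<dots> = fact r * (\<Sum>J\<in>?E. H J)"
  proof (rule sum_permutes_tail)
    fix J :: "nat \<Rightarrow> nat" assume "\<not> inj_on J {..<r}"
    then obtain i j where "i < r" "j < r" "i \<noteq> j" "J i = J j"
      by (auto simp: inj_on_def)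
    then have "sdet r (\<lambda>i j. g (b (J i)) (Y j)) = 0"
      by (intro sdet_identical_rows[of i r j]) auto
    then show "H J = 0" by (simp add: H_def)
  qed
  also have "(\<Sum>J\<in>?E. H J) = sdet r (\<lambda>i j. a' (X i) (Y j))"
  proof -
    have "sdet r (\<lambda>i j. a' (X i) (Y j)) = (\<Sum>J\<in>?E. (\<Prod>i<r. c' (J i) * g (b (J i)) (X i)) *
        sdet r (\<lambda>i j. if i < r then g (b (J i)) (Y j) else a' (X i) (Y j)))"
      by (rule sdet_expand_rows[where c = "\<lambda>i l. c' l * g (b l) (X i)" and N = "\<lambda>l j. g (b l) (Y j)"])
        (simp_all add: a')
    also have "\<dots> = (\<Sum>J\<in>?E. H J)"
      unfolding H_def by (intro sum.cong refl arg_cong2[where f = "(*)"] sdet_cong) simp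
    finally show ?thesis by simp
  qed
  finally show "dhodge_at g e r r (bprod r (\<lambda>_. a)) X Y = bprod r (\<lambda>_. a') X Y"
    by (simp only: bprod_const[of r a' X Y])
qed

subsection \<open>Powers of a pencil of symmetric forms\<close>

text \<open>\<open>S\<close> records the positions at which \<open>h\<close> is chosen; grouping by
  its size exhibits a polynomial in t.\<close>

lemma bprod_pencil:
  "bprod r (\<lambda>_ u v. g u v + t * h u v) X Y
    = (\<Sum>k\<le>r. t ^ k * (\<Sum>S | S \<subseteq> {..<r} \<and> card S = k. bprod r (\<lambda>i. if i \<in> S then h else g) X Y))"
proof -
  let ?s = "\<lambda>\<sigma>::nat \<Rightarrow> nat. real_of_int (sign \<sigma>)" and ?P = "{\<sigma>. \<sigma> permutes {..<r}}"
  let ?a = "\<lambda>S i. if i \<in> S then h else g"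
  have "(\<Prod>i<r. g (X (\<sigma> i)) (Y (\<tau> i)) + t * h (X (\<sigma> i)) (Y (\<tau> i)))
      = (\<Sum>S\<in>Pow {..<r}. t ^ card S * (\<Prod>i<r. ?a S i (X (\<sigma> i)) (Y (\<tau> i))))" for \<sigma> \<tau>
  proof -
    have "(\<Prod>i<r. t * h (X (\<sigma> i)) (Y (\<tau> i)) + g (X (\<sigma> i)) (Y (\<tau> i)))
        = (\<Sum>S\<in>Pow {..<r}. (\<Prod>i\<in>S. t * h (X (\<sigma> i)) (Y (\<tau> i))) * (\<Prod>i\<in>{..<r} - S. g (X (\<sigma> i)) (Y (\<tau> i))))"
      by (rule prod_add) simp
    also have "\<dots> = (\<Sum>S\<in>Pow {..<r}. t ^ card S * (\<Prod>i<r. ?a S i (X (\<sigma> i)) (Y (\<tau> i))))"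
    proof (rule sum.cong[OF refl])
      fix S assume "S \<in> Pow {..<r}"
      then have S: "S \<subseteq> {..<r}" by simp
      have "(\<Prod>i<r. ?a S i (X (\<sigma> i)) (Y (\<tau> i)))
          = (\<Prod>i\<in>{..<r} - S. ?a S i (X (\<sigma> i)) (Y (\<tau> i))) * (\<Prod>i\<in>S. ?a S i (X (\<sigma> i)) (Y (\<tau> i)))"
        by (rule prod.subset_diff[OF S]) simp
      then show "(\<Prod>i\<in>S. t * h (X (\<sigma> i)) (Y (\<tau> i))) * (\<Prod>i\<in>{..<r} - S. g (X (\<sigma> i)) (Y (\<tau> i)))
          = t ^ card S * (\<Prod>i<r. ?a S i (X (\<sigma> i)) (Y (\<tau> i)))"
        by (simp add: prod.distrib)
    qed
    finally show ?thesis by (simp add: add.commute)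
  qed
  then have "bprod r (\<lambda>_ u v. g u v + t * h u v) X Y = (\<Sum>\<sigma>\<in>?P. \<Sum>\<tau>\<in>?P. \<Sum>S\<in>Pow {..<r}.
      t ^ card S * (?s \<sigma> * ?s \<tau> * (\<Prod>i<r. ?a S i (X (\<sigma> i)) (Y (\<tau> i)))))"
    by (simp add: bprod_def sum_distrib_left mult_ac)
  also have "\<dots> = (\<Sum>S\<in>Pow {..<r}. t ^ card S * bprod r (?a S) X Y)"
    by (subst sum_rotate3) (simp add: bprod_def sum_distrib_left)
  also have "\<dots> = (\<Sum>k\<le>r. \<Sum>S | S \<in> Pow {..<r} \<and> card S = k. t ^ card S * bprod r (?a S) X Y)"
  proof (rule sum.group[symmetric])
    show "card ` Pow {..<r} \<subseteq> {..r}"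
      using card_mono[of "{..<r}"] by auto
  qed simp_all
  also have "\<dots> = (\<Sum>k\<le>r. \<Sum>S | S \<subseteq> {..<r} \<and> card S = k. t ^ k * bprod r (?a S) X Y)"
    by (intro sum.cong refl) auto
  finally show ?thesis
    by (simp add: sum_distrib_left)
qed

text \<open>Some permutation of the positions carries one set to the other, so commutativity leaves
  only the number of factors \<open>h\<close>.\<close>

lemma bprod_select_card_eq:
  assumes "S \<subseteq> {..<r}" "S' \<subseteq> {..<r}" "card S = card S'"
  shows "bprod r (\<lambda>i. if i \<in> S then h else g) = bprod r (\<lambda>i. if i \<in> S' then h else g)"
proof -
  have fin: "finite S" "finite S'"
    using assms finite_subset by blast+
  obtain f where f: "bij_betw f S S'"
    using finite_same_card_bij[OF fin assms(3)] by blast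
  have "card ({..<r} - S) = card ({..<r} - S')"
    using assms fin by (simp add: card_Diff_subset)
  then obtain f' where f': "bij_betw f' ({..<r} - S) ({..<r} - S')"
    using finite_same_card_bij[of "{..<r} - S" "{..<r} - S'"] by auto
  define \<pi> where "\<pi> = (\<lambda>i. if i \<in> S then f i else if i < r then f' i else i)"
  have 1: "bij_betw \<pi> S S'"
    using f by (rule bij_betw_cong[THEN iffD1, rotated]) (simp add: \<pi>_def)
  have 2: "bij_betw \<pi> ({..<r} - S) ({..<r} - S')"
    using f' by (rule bij_betw_cong[THEN iffD1, rotated]) (simp add: \<pi>_def)
  have "bij_betw \<pi> (S \<union> ({..<r} - S)) (S' \<union> ({..<r} - S'))"
    by (rule bij_betw_combine[OF 1 2]) auto
  then have "bij_betw \<pi> {..<r} {..<r}"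
    using assms by (simp add: Un_absorb1)
  then have \<pi>: "\<pi> permutes {..<r}"
    by (rule bij_imp_permutes) (use assms in \<open>auto simp: \<pi>_def\<close>)
  have "i \<in> S \<longleftrightarrow> \<pi> i \<in> S'" if "i < r" for i
    using that bij_betwE[OF 1] bij_betwE[OF 2] by auto
  then have "bprod r (\<lambda>i. if i \<in> S then h else g) = bprod r (\<lambda>i. if \<pi> i \<in> S' then h else g)"
    by (intro bprod_cong) simp
  also have "\<dots> = bprod r (\<lambda>i. if i \<in> S' then h else g)"
    by (rule bprod_permute[OF \<pi>])
  finally show ?thesis .
qed

lemma hodge_sum:
  "hodge g e p (\<lambda>X. \<Sum>k\<in>K. s k * \<alpha> k X) y = (\<Sum>k\<in>K. s k * hodge g e p (\<alpha> k) y)"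
proof -
  have "hodge g e p (\<lambda>X. \<Sum>k\<in>K. s k * \<alpha> k X) y = (\<Sum>I\<in>{..<p} \<rightarrow>\<^sub>E {..<DIM('a)}. \<Sum>k\<in>K. s k *
      (\<alpha> k (\<lambda>i. e (I i)) * volume g e (\<lambda>i. if i < p then e (I i) else y (i - p)) / fact p))"
    by (simp add: hodge_def sum_distrib_right sum_divide_distrib mult.assoc)
  also have "\<dots> = (\<Sum>k\<in>K. \<Sum>I\<in>{..<p} \<rightarrow>\<^sub>E {..<DIM('a)}. s k *
      (\<alpha> k (\<lambda>i. e (I i)) * volume g e (\<lambda>i. if i < p then e (I i) else y (i - p)) / fact p))"
    by (rule sum.swap)
  finally show ?thesis
    by (simp add: hodge_def sum_distrib_left sum_divide_distrib)
qed

lemma dhodge_at_sum: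
  "dhodge_at g e p q (\<lambda>X Y. \<Sum>k\<in>K. s k * \<omega> k X Y) X Y = (\<Sum>k\<in>K. s k * dhodge_at g e p q (\<omega> k) X Y)"
  by (simp add: dhodge_at_def hodge_sum)

lemma dhodge_at_scale:
  "dhodge_at g e p q (\<lambda>X Y. s * \<omega> X Y) = (\<lambda>X Y. s * dhodge_at g e p q \<omega> X Y)"
  using dhodge_at_sum[of g e p q "\<lambda>_. s" "\<lambda>_. \<omega>" "{()}"] by (intro ext) simp

lemma dhodge_at_pencil:
  fixes g h :: "'v::euclidean_space \<Rightarrow> 'v \<Rightarrow> real"
  assumes g: "inner_product g" and e: "orthonormal_basis g e" and b: "orthonormal_basis g b"
    and dim: "DIM('v) = r + r" and h: "bilinear h"
    and diag: "\<And>i j. i < r + r \<Longrightarrow> j < r + r \<Longrightarrow> h (b i) (b j) = (if i = j then if i < r then 1 else -1 else 0)"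
    and t: "t \<noteq> 1" "t \<noteq> -1"
  shows "dhodge_at g e r r (bprod r (\<lambda>_ u v. g u v + t * h u v)) = bprod r (\<lambda>_ u v. g u v - t * h u v)"
proof (rule dhodge_at_diagonal[OF g e b dim])
  have g': "g u v = (\<Sum>l<r + r. 1 * g (b l) u * g (b l) v)" for u v
    using bilinear_diagonal_expansion[OF g b, of g "\<lambda>_. 1" u v] orthonormal_basisD[OF b] g dim
    by (simp add: inner_product_def)
  have h': "h u v = (\<Sum>l<r + r. (if l < r then 1 else -1) * g (b l) u * g (b l) v)" for u v
    using bilinear_diagonal_expansion[OF g b h, of "\<lambda>l. if l < r then 1 else -1" u v] diag dim by simp
  show "g u v + t * h u v = (\<Sum>l<r + r. (if l < r then 1 + t else 1 - t) * g (b l) u * g (b l) v)" for u v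
    unfolding g'[of u v] h'[of u v] sum_distrib_left sum.distrib[symmetric]
    by (intro sum.cong refl) (simp add: algebra_simps)
  show "g u v - t * h u v = (\<Sum>l<r + r. (if l < r then 1 - t else 1 + t) * g (b l) u * g (b l) v)" for u v
    unfolding g'[of u v] h'[of u v] sum_distrib_left sum_subtractf[symmetric]
    by (intro sum.cong refl) (simp add: algebra_simps)
next
  fix \<pi> assume \<pi>: "\<pi> permutes {..<r + r}"
  let ?c = "\<lambda>l. if l < r then 1 + t else 1 - t" and ?c' = "\<lambda>l. if l < r then 1 - t else 1 + t"
  have cc: "?c l * ?c' l = (1 + t) * (1 - t)" for l
    by simp
  have nz: "(\<Prod>j<r. ?c (\<pi> (r + j))) \<noteq> 0"
    using t by (auto simp: prod_zero_iff)
  \<comment> \<open>Head times tail is the product of all eigenvalues, ((1 + t) (1 - t))^r. Since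
    \<open>?c l * ?c' l\<close> is (1 + t) (1 - t) at every index, the tail of \<open>?c'\<close>
    times the tail of \<open>?c\<close> has the same value, and the nonzero tail of
    \<open>?c\<close> cancels.\<close>
  have "(\<Prod>i<r. ?c (\<pi> i)) * (\<Prod>j<r. ?c (\<pi> (r + j))) = (\<Prod>l<r + r. ?c (\<pi> l))"
    by (rule prod_lessThan_add[symmetric])
  also have "\<dots> = (\<Prod>l<r + r. ?c l)"
    using prod.permute[OF \<pi>, of ?c] by (simp add: o_def)
  also have "\<dots> = (\<Prod>j<r. (1 + t) * (1 - t))"
    by (simp only: prod_lessThan_add prod.distrib) simp
  also have "\<dots> = (\<Prod>j<r. ?c' (\<pi> (r + j))) * (\<Prod>j<r. ?c (\<pi> (r + j)))"
    unfolding prod.distrib[symmetric] by (intro prod.cong refl) simp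
  finally show "(\<Prod>i<r. ?c (\<pi> i)) = (\<Prod>j<r. ?c' (\<pi> (r + j)))"
    by (rule mult_right_cancel[OF nz, THEN iffD1])
qed

theorem dhodge_at_select:
  fixes g h :: "'v::euclidean_space \<Rightarrow> 'v \<Rightarrow> real"
  assumes g: "inner_product g" and e: "orthonormal_basis g e" and b: "orthonormal_basis g b"
    and dim: "DIM('v) = r + r" and h: "bilinear h"
    and diag: "\<And>i j. i < r + r \<Longrightarrow> j < r + r \<Longrightarrow> h (b i) (b j) = (if i = j then if i < r then 1 else -1 else 0)"
    and S: "S \<subseteq> {..<r}"
  shows "dhodge_at g e r r (bprod r (\<lambda>i. if i \<in> S then h else g))
    = (\<lambda>X Y. (-1) ^ card S * bprod r (\<lambda>i. if i \<in> S then h else g) X Y)"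
proof (intro ext)
  fix X Y :: "nat \<Rightarrow> 'v"
  define d where "d k = (\<lambda>X Y. \<Sum>S | S \<subseteq> {..<r} \<and> card S = k. bprod r (\<lambda>i. if i \<in> S then h else g) X Y)" for k
  let ?p = "\<lambda>k. dhodge_at g e r r (d k) X Y - (-1) ^ k * d k X Y"
  have "(\<Sum>k\<le>r. ?p k * t ^ k) = 0" if "t \<noteq> 1" "t \<noteq> -1" for t
  proof -
    have "(\<Sum>k\<le>r. t ^ k * dhodge_at g e r r (d k) X Y)
        = dhodge_at g e r r (bprod r (\<lambda>_ u v. g u v + t * h u v)) X Y"
      unfolding dhodge_at_sum[symmetric] d_def bprod_pencil[symmetric] ..
    also have "\<dots> = bprod r (\<lambda>_ u v. g u v + (- t) * h u v) X Y"
      using dhodge_at_pencil[OF g e b dim h diag that] by simp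
    also have "\<dots> = (\<Sum>k\<le>r. (- t) ^ k * d k X Y)"
      unfolding d_def by (rule bprod_pencil)
    finally show ?thesis
      by (simp add: algebra_simps sum_subtractf power_minus[of t])
  qed
  \<comment> \<open>The remaining values of t are infinitely many roots, so every coefficient is
    0.\<close>
  then have "UNIV - {1, -1} \<subseteq> {t. (\<Sum>k\<le>r. ?p k * t ^ k) = 0}"
    by auto
  moreover have "infinite (UNIV - {1, -1 :: real})"
    by (simp add: infinite_UNIV_char_0)
  ultimately have "infinite {t. (\<Sum>k\<le>r. ?p k * t ^ k) = 0}"
    using finite_subset by blast
  then have p: "?p k = 0" if "k \<le> r" for k
    using Transcendental.polyfun_rootbound[of ?p k r] that by blast
  \<comment> \<open>All sets of this size give the same product, so the coefficient is
    \<open>N\<close> times the product wanted; \<open>S\<close> itself shows that \<open>N\<close>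
    is not 0.\<close>
  define N where "N = real (card {T. T \<subseteq> {..<r} \<and> card T = card S})"
  define B where "B = bprod r (\<lambda>i. if i \<in> S then h else g)"
  have "N \<noteq> 0"
    using S by (auto simp: N_def card_eq_0_iff)
  have "d (card S) X Y = N * B X Y" for X Y
  proof -
    have "bprod r (\<lambda>i. if i \<in> T then h else g) X Y = B X Y"
      if "T \<in> {T. T \<subseteq> {..<r} \<and> card T = card S}" for T
      unfolding B_def using that bprod_select_card_eq[OF _ S, of T h g] by simp
    then show ?thesis
      by (simp add: d_def N_def)
  qed
  then have "d (card S) = (\<lambda>X Y. N * B X Y)"
    by (intro ext)
  then have "N * dhodge_at g e r r B X Y = N * ((-1) ^ card S * B X Y)"
    using p[of "card S"] card_mono[OF _ S] by (simp add: dhodge_at_scale)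
  with \<open>N \<noteq> 0\<close> show "dhodge_at g e r r (bprod r (\<lambda>i. if i \<in> S then h else g)) X Y
    = (-1) ^ card S * bprod r (\<lambda>i. if i \<in> S then h else g) X Y"
    by (simp add: B_def)
qed

section \<open>Nonvanishing, and the factors of the Thorpe form\<close>

text \<open>On vectors where all factors restrict to the same identity matrix, a mixed product takes
  the value of a power. This applies to the sphere directions, on which \<open>g\<close> and
  \<open>h\<close> agree.\<close>

lemma bprod_basis_nonzero:
  assumes "\<And>i j k. i < r \<Longrightarrow> j < r \<Longrightarrow> k < r \<Longrightarrow> a k (b i) (b j) = (if i = j then 1 else 0)"
  shows "bprod r a b b \<noteq> 0"
proof -
  have "bprod r a b b = bprod r (\<lambda>_ i j. if i = j then 1 else 0) id id"
    unfolding bprod_def using assms permutes_nat_less by (simp add: bprod_def)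
  also have "\<dots> = fact r * sdet r (\<lambda>i j. if i = j then 1 else 0)"
    by (simp add: bprod_const)
  also have "sdet r (\<lambda>i j. if i = j then 1 else 0) = 1"
    using sdet_block[of r "\<lambda>i j. if i = j then 1 else 0" 0] by (simp add: sdet_def[of 0])
  finally show ?thesis by simp
qed

theorem thorpe_form_eq:
  assumes R: "curvature_form g x = (\<lambda>X Y. s * bprod 2 (\<lambda>i. if odd i then h else g x) X Y)" and k: "2 * k \<le> r"
  obtains S where "S \<subseteq> {..<r}" "card S = k"
    "thorpe_form g x r k = (\<lambda>X Y. s ^ k * bprod r (\<lambda>i. if i \<in> S then h else g x) X Y)"
proof
  \<comment> \<open>The factors are \<open>r - 2 * k\<close> metrics followed by \<open>k\<close>
    pairs \<open>g, h\<close>; \<open>S\<close> holds the positions of the second members.\<close>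
  define S where "S = (\<lambda>j. r - 2 * k + (2 * j + 1)) ` {..<k}"
  show "S \<subseteq> {..<r}"
    using k by (auto simp: S_def)
  show "card S = k"
    unfolding S_def by (subst card_image) (auto intro: inj_onI)
  have R': "dpow 2 2 (curvature_form g x) k = (\<lambda>X Y. s ^ k * bprod (2 * k) (\<lambda>i. if odd i then h else g x) X Y)"
    using dpow_bprod_2[OF R] by (simp add: mult.commute)
  have "thorpe_form g x r k = (\<lambda>X Y. s ^ k * dwedge (r - 2 * k) (r - 2 * k) (2 * k) (2 * k)
      (bprod (r - 2 * k) (\<lambda>_. g x)) (bprod (2 * k) (\<lambda>i. if odd i then h else g x)) X Y)"
    unfolding thorpe_form_def metric_form_def dpow_bprod_1[of "g x"] R'
    using dwedge_scale[of "r - 2 * k" "r - 2 * k" "2 * k" "2 * k" 1] by simp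
  also have "dwedge (r - 2 * k) (r - 2 * k) (2 * k) (2 * k)
      (bprod (r - 2 * k) (\<lambda>_. g x)) (bprod (2 * k) (\<lambda>i. if odd i then h else g x))
    = bprod r (\<lambda>i. if i < r - 2 * k then g x else if odd (i - (r - 2 * k)) then h else g x)"
    using k by (simp add: dwedge_bprod)
  also have "\<dots> = bprod r (\<lambda>i. if i \<in> S then h else g x)"
  proof (rule bprod_cong)
    fix i assume i: "i < r"
    have "i \<in> S \<longleftrightarrow> r - 2 * k \<le> i \<and> odd (i - (r - 2 * k))"
    proof
      assume *: "r - 2 * k \<le> i \<and> odd (i - (r - 2 * k))"
      then obtain j where "i - (r - 2 * k) = 2 * j + 1"
        using oddE by blast
      with * i show "i \<in> S"
        unfolding S_def by (intro image_eqI[of _ _ j]) auto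
    qed (auto simp: S_def)
    then show "(if i < r - 2 * k then g x else if odd (i - (r - 2 * k)) then h else g x)
      = (if i \<in> S then h else g x)"
      by auto
  qed
  finally show "thorpe_form g x r k = (\<lambda>X Y. s ^ k * bprod r (\<lambda>i. if i \<in> S then h else g x) X Y)" .
qed

subsection \<open>Smooth maps\<close>

lemma
  assumes "open S" "x \<in> S" "\<And>y. y \<in> S \<Longrightarrow> f y = g y"
  shows frechet_derivative_cong: "frechet_derivative f (at x) = frechet_derivative g (at x)"
    and differentiable_cong: "f differentiable at x \<longleftrightarrow> g differentiable at x"
proof -
  have "(f has_derivative D) (at x) \<longleftrightarrow> (g has_derivative D) (at x)" for D
    using has_derivative_transform_within_open[OF _ assms(1,2), of f D UNIV g]
      has_derivative_transform_within_open[OF _ assms(1,2), of g D UNIV f] assms(3) by auto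
  then show "frechet_derivative f (at x) = frechet_derivative g (at x)"
    "f differentiable at x \<longleftrightarrow> g differentiable at x"
    by (simp_all add: frechet_derivative_def differentiable_def)
qed

lemma frechet_derivative_eq: "(f has_derivative D) (at x) \<Longrightarrow> frechet_derivative f (at x) = D"
  by (rule frechet_derivative_at[symmetric])

lemma Ck_on_cong:
  assumes "open S" "\<And>x. x \<in> S \<Longrightarrow> f x = g x"
  shows "Ck_on k S f \<longleftrightarrow> Ck_on k S g"
  using assms(2)
proof (induction k arbitrary: f g)
  case 0
  then show ?case by (simp cong: continuous_on_cong)
next
  case (Suc k)
  have "Ck_on k S (\<lambda>x. frechet_derivative f (at x) v) \<longleftrightarrow> Ck_on k S (\<lambda>x. frechet_derivative g (at x) v)" for v
    by (rule Suc.IH) (simp add: frechet_derivative_cong[OF assms(1) _ Suc.prems])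
  then show ?case
    using differentiable_cong[OF assms(1) _ Suc.prems] by auto
qed

lemma Ck_on_SucD: "Ck_on (Suc k) S f \<Longrightarrow> Ck_on k S f"
proof (induction k arbitrary: f)
  case 0
  then show ?case
    by (auto intro!: continuous_at_imp_continuous_on differentiable_imp_continuous_within)
next
  case (Suc k)
  then show ?case by auto
qed

text \<open>Lets the derivative be supplied in closed form; openness permits replacing
  \<open>frechet_derivative\<close> under \<open>Ck_on\<close>.\<close>

lemma Ck_on_SucI:
  assumes "open S" "\<And>x. x \<in> S \<Longrightarrow> (f has_derivative D x) (at x)" "\<And>v. Ck_on k S (\<lambda>x. D x v)"
  shows "Ck_on (Suc k) S f"
proof -
  have "Ck_on k S (\<lambda>x. frechet_derivative f (at x) v)" for v
    using assms(3)[of v] frechet_derivative_eq[OF assms(2)]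
    by (subst Ck_on_cong[OF assms(1), of _ "\<lambda>x. D x v"]) auto
  then show ?thesis
    using assms(2) by (auto simp: differentiable_def)
qed

lemma Ck_on_has_derivative:
  assumes "Ck_on (Suc k) S f" "x \<in> S"
  shows "(f has_derivative frechet_derivative f (at x)) (at x)"
  using assms by (simp add: frechet_derivative_works)

lemma Ck_on_const: "Ck_on k S (\<lambda>x. c)"
  by (induction k arbitrary: c) (auto simp: frechet_derivative_const)

lemma Ck_on_add:
  assumes "open S" "Ck_on k S f" "Ck_on k S g"
  shows "Ck_on k S (\<lambda>x. f x + g x)"
  using assms(2,3)
proof (induction k arbitrary: f g)
  case 0
  then show ?case by (auto intro: continuous_intros)
next
  case (Suc k)
  show ?case
    by (rule Ck_on_SucI[OF assms(1) has_derivative_add[OF Ck_on_has_derivative[OF Suc.prems(1)]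
            Ck_on_has_derivative[OF Suc.prems(2)]]]) (use Suc in auto)
qed

lemma Ck_on_bounded_linear:
  assumes "open S" "bounded_linear L" "Ck_on k S f"
  shows "Ck_on k S (\<lambda>x. L (f x))"
  using assms(3)
proof (induction k arbitrary: f)
  case 0
  then show ?case
    using bounded_linear.continuous_on[OF assms(2)] by auto
next
  case (Suc k)
  show ?case
    by (rule Ck_on_SucI[OF assms(1) bounded_linear.has_derivative[OF assms(2)
            Ck_on_has_derivative[OF Suc.prems]]]) (use Suc in auto)
qed

text \<open>Each term of the Leibniz rule pairs a derivative with an undifferentiated factor, which
  \<open>Ck_on_SucD\<close> lowers by one order; hence the induction over arbitrary \<open>f\<close>
  and \<open>g\<close>.\<close>

lemma Ck_on_bounded_bilinear:
  assumes "open S" "bounded_bilinear P" "Ck_on k S f" "Ck_on k S g"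
  shows "Ck_on k S (\<lambda>x. P (f x) (g x))"
  using assms(3,4)
proof (induction k arbitrary: f g)
  case 0
  then show ?case
    using bounded_bilinear.continuous_on[OF assms(2)] by auto
next
  case (Suc k)
  show ?case
  proof (rule Ck_on_SucI[OF assms(1) bounded_bilinear.FDERIV[OF assms(2)
            Ck_on_has_derivative[OF Suc.prems(1)] Ck_on_has_derivative[OF Suc.prems(2)]]])
    fix v
    show "Ck_on k S (\<lambda>x. P (f x) (frechet_derivative g (at x) v) + P (frechet_derivative f (at x) v) (g x))"
      using Suc.prems by (intro Ck_on_add[OF assms(1)] Suc.IH Ck_on_SucD[of k S f] Ck_on_SucD[of k S g]) simp_all
  qed
qed

lemma Ck_on_linear_comp:
  assumes "open T" "bounded_linear L" "L ` T \<subseteq> S" "Ck_on k S f"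
  shows "Ck_on k T (\<lambda>x. f (L x))"
  using assms(4)
proof (induction k arbitrary: f)
  case 0
  have "continuous_on T L"
    using assms(2) by (simp add: linear_continuous_on)
  with 0 assms(3) show ?case
    using continuous_on_compose2[of S f T L] by auto
next
  case (Suc k)
  have "((\<lambda>x. f (L x)) has_derivative (\<lambda>v. frechet_derivative f (at (L x)) (L v))) (at x)" if "x \<in> T" for x
    using diff_chain_at[OF bounded_linear.has_derivative[OF assms(2) has_derivative_ident]
        Ck_on_has_derivative[OF Suc.prems], of x] that assms(3) by (auto simp: o_def)
  then show ?case
    by (rule Ck_on_SucI[OF assms(1)]) (use Suc in auto)
qed

text \<open>The derivative consists of that of \<open>f\<close> and the inverse itself, so the
  induction can keep \<open>f\<close> fixed.\<close>

lemma Ck_on_inverse: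
  fixes f :: "'a::euclidean_space \<Rightarrow> real"
  assumes "open S" "Ck_on k S f" "\<And>x. x \<in> S \<Longrightarrow> f x \<noteq> 0"
  shows "Ck_on k S (\<lambda>x. inverse (f x))"
  using assms(2)
proof (induction k)
  case 0
  then show ?case using assms(3) by (auto intro!: continuous_intros)
next
  case (Suc k)
  show ?case
  proof (rule Ck_on_SucI[OF assms(1) Deriv.has_derivative_inverse[OF assms(3) Ck_on_has_derivative[OF Suc.prems]]])
    fix v
    have "Ck_on k S (\<lambda>x. inverse (f x))"
      by (rule Suc.IH[OF Ck_on_SucD[OF Suc.prems]])
    moreover have "Ck_on k S (\<lambda>x. frechet_derivative f (at x) v)"
      using Suc.prems by simp
    ultimately have "Ck_on k S (\<lambda>x. inverse (f x) * frechet_derivative f (at x) v * inverse (f x))"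
      by (intro Ck_on_bounded_bilinear[OF assms(1) bounded_bilinear_mult])
    then show "Ck_on k S (\<lambda>x. - (inverse (f x) * frechet_derivative f (at x) v * inverse (f x)))"
      by (intro Ck_on_bounded_linear[OF assms(1) bounded_linear_minus[OF bounded_linear_ident]])
  qed auto
qed

lemma smooth_on_const: "smooth_on S (\<lambda>x. c)"
  by (simp add: smooth_on_def Ck_on_const)

lemma smooth_on_add: "open S \<Longrightarrow> smooth_on S f \<Longrightarrow> smooth_on S g \<Longrightarrow> smooth_on S (\<lambda>x. f x + g x)"
  by (simp add: smooth_on_def Ck_on_add)

lemma smooth_on_bounded_linear:
  "open S \<Longrightarrow> bounded_linear L \<Longrightarrow> smooth_on S f \<Longrightarrow> smooth_on S (\<lambda>x. L (f x))"
  by (simp add: smooth_on_def Ck_on_bounded_linear)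

lemma smooth_on_bounded_bilinear:
  "open S \<Longrightarrow> bounded_bilinear P \<Longrightarrow> smooth_on S f \<Longrightarrow> smooth_on S g \<Longrightarrow> smooth_on S (\<lambda>x. P (f x) (g x))"
  by (simp add: smooth_on_def Ck_on_bounded_bilinear)

lemma smooth_on_linear_comp:
  "open T \<Longrightarrow> bounded_linear L \<Longrightarrow> L ` T \<subseteq> S \<Longrightarrow> smooth_on S f \<Longrightarrow> smooth_on T (\<lambda>x. f (L x))"
  by (auto simp: smooth_on_def intro: Ck_on_linear_comp)

lemma smooth_on_ident: "open S \<Longrightarrow> smooth_on S (\<lambda>x. x)"
proof -
  assume "open S"
  have "Ck_on k S (\<lambda>x. x)" for k
  proof (cases k)
    case (Suc l)
    show ?thesis
      unfolding Suc by (rule Ck_on_SucI[OF \<open>open S\<close> has_derivative_ident Ck_on_const])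
  qed (simp add: continuous_on_id)
  then show ?thesis by (simp add: smooth_on_def)
qed

lemma smooth_on_inverse:
  fixes f :: "'a::euclidean_space \<Rightarrow> real"
  shows "open S \<Longrightarrow> smooth_on S f \<Longrightarrow> (\<And>x. x \<in> S \<Longrightarrow> f x \<noteq> 0) \<Longrightarrow> smooth_on S (\<lambda>x. inverse (f x))"
  by (simp add: smooth_on_def Ck_on_inverse)

lemma smooth_on_deriv: "smooth_on S f \<Longrightarrow> smooth_on S (\<lambda>x. frechet_derivative f (at x) v)"
  unfolding smooth_on_def using Ck_on.simps(2) by blast

lemma smooth_on_has_derivative:
  "smooth_on S f \<Longrightarrow> x \<in> S \<Longrightarrow> (f has_derivative frechet_derivative f (at x)) (at x)"
  unfolding smooth_on_def using Ck_on_has_derivative by blast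

lemma smooth_on_imp_continuous_on: "smooth_on S f \<Longrightarrow> continuous_on S f"
  unfolding smooth_on_def using Ck_on.simps(1) by blast

section \<open>Symmetry of second derivatives\<close>

text \<open>The mean value theorem twice, first along \<open>u\<close> and then along
  \<open>v\<close>. The left-hand side is symmetric in \<open>u\<close> and \<open>v\<close>,
  whereas the right-hand side fixes the order of differentiation.\<close>

lemma second_difference:
  fixes f :: "'a::euclidean_space \<Rightarrow> real"
  assumes f: "smooth_on S f" and s: "0 < s"
    and sub: "\<And>a b. 0 \<le> a \<Longrightarrow> a \<le> s \<Longrightarrow> 0 \<le> b \<Longrightarrow> b \<le> s \<Longrightarrow> x + a *\<^sub>R u + b *\<^sub>R v \<in> S"
  shows "\<exists>a b. 0 \<le> a \<and> a \<le> s \<and> 0 \<le> b \<and> b \<le> s \<and>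
    f (x + s *\<^sub>R u + s *\<^sub>R v) - f (x + s *\<^sub>R u) - f (x + s *\<^sub>R v) + f x
      = s * s * frechet_derivative (\<lambda>y. frechet_derivative f (at y) u) (at (x + a *\<^sub>R u + b *\<^sub>R v)) v"
proof -
  have along: "((\<lambda>t. h (y + t *\<^sub>R w)) has_derivative
      (\<lambda>\<tau>. \<tau> * frechet_derivative h (at (y + t *\<^sub>R w)) w)) (at t)"
    if "smooth_on S h" "y + t *\<^sub>R w \<in> S" for h :: "'a \<Rightarrow> real" and y w t
  proof -
    have D: "(h has_derivative frechet_derivative h (at (y + t *\<^sub>R w))) (at (y + t *\<^sub>R w))"
      using that by (rule smooth_on_has_derivative)
    have "((\<lambda>t. y + t *\<^sub>R w) has_derivative (\<lambda>\<tau>. \<tau> *\<^sub>R w)) (at t)"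
      by (auto intro!: derivative_eq_intros)
    from diff_chain_at[OF this D] show ?thesis
      by (simp add: o_def linear_scale[OF has_derivative_linear[OF D]])
  qed
  let ?\<phi> = "\<lambda>t. f (x + s *\<^sub>R v + t *\<^sub>R u) - f (x + t *\<^sub>R u)"
  let ?\<phi>' = "\<lambda>t \<tau>. \<tau> * frechet_derivative f (at (x + s *\<^sub>R v + t *\<^sub>R u)) u - \<tau> * frechet_derivative f (at (x + t *\<^sub>R u)) u"
  have \<phi>: "(?\<phi> has_derivative ?\<phi>' t) (at t)" if "0 \<le> t" "t \<le> s" for t
    using sub[of t s] sub[of t 0] s that
    by (intro has_derivative_diff along f) (auto simp: algebra_simps)
  have "continuous_on {0..s} ?\<phi>"
    using has_derivative_continuous[OF \<phi>] by (intro continuous_at_imp_continuous_on) simp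
  then obtain a where a: "0 < a" "a < s" "?\<phi> s - ?\<phi> 0 = ?\<phi>' a (s - 0)"
  proof (rule mvt[OF s, of ?\<phi> ?\<phi>'])
    show "(?\<phi> has_derivative ?\<phi>' t) (at t)" if "0 < t" "t < s" for t
      using \<phi>[of t] that by simp
  qed (rule that)
  have \<phi>_diff: "f (x + s *\<^sub>R u + s *\<^sub>R v) - f (x + s *\<^sub>R u) - f (x + s *\<^sub>R v) + f x
      = s * (frechet_derivative f (at (x + a *\<^sub>R u + s *\<^sub>R v)) u - frechet_derivative f (at (x + a *\<^sub>R u)) u)"
  proof -
    have "x + s *\<^sub>R v + t *\<^sub>R u = x + t *\<^sub>R u + s *\<^sub>R v" for t
      by simp
    with a(3) show ?thesis
      by (simp add: right_diff_distrib)
  qed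
  let ?g = "\<lambda>y. frechet_derivative f (at y) u"
  have g: "smooth_on S ?g"
    using f by (rule smooth_on_deriv)
  let ?\<gamma> = "\<lambda>t. ?g (x + a *\<^sub>R u + t *\<^sub>R v)"
  let ?\<gamma>' = "\<lambda>t \<tau>. \<tau> * frechet_derivative ?g (at (x + a *\<^sub>R u + t *\<^sub>R v)) v"
  have \<gamma>: "(?\<gamma> has_derivative ?\<gamma>' t) (at t)" if "0 \<le> t" "t \<le> s" for t
    using sub[of a t] a that by (intro along g) auto
  have "continuous_on {0..s} ?\<gamma>"
    using has_derivative_continuous[OF \<gamma>] by (intro continuous_at_imp_continuous_on) simp
  then obtain b where b: "0 < b" "b < s" "?\<gamma> s - ?\<gamma> 0 = ?\<gamma>' b (s - 0)"
  proof (rule mvt[OF s, of ?\<gamma> ?\<gamma>'])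
    show "(?\<gamma> has_derivative ?\<gamma>' t) (at t)" if "0 < t" "t < s" for t
      using \<gamma>[of t] that by simp
  qed (rule that)
  have "f (x + s *\<^sub>R u + s *\<^sub>R v) - f (x + s *\<^sub>R u) - f (x + s *\<^sub>R v) + f x
      = s * s * frechet_derivative ?g (at (x + a *\<^sub>R u + b *\<^sub>R v)) v"
    unfolding \<phi>_diff using b(3) by simp
  with a(1,2) b(1,2) show ?thesis
    by (intro exI[of _ a] exI[of _ b]) simp
qed

text \<open>By \<open>second_difference\<close> for both orders, the two mixed derivatives agree at
  some pair of points close to \<open>x\<close>; by continuity they cannot differ at
  \<open>x\<close>.\<close>

lemma second_derivative_symmetric_real:
  fixes f :: "'a::euclidean_space \<Rightarrow> real"
  assumes S: "open S" and f: "smooth_on S f" and x: "x \<in> S"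
  shows "frechet_derivative (\<lambda>y. frechet_derivative f (at y) u) (at x) v
    = frechet_derivative (\<lambda>y. frechet_derivative f (at y) v) (at x) u" (is "?A x = ?B x")
proof (rule ccontr)
  assume "?A x \<noteq> ?B x"
  define \<epsilon> where "\<epsilon> = \<bar>?A x - ?B x\<bar> / 2"
  have "\<epsilon> > 0" using \<open>?A x \<noteq> ?B x\<close> by (simp add: \<epsilon>_def)
  have cont: "continuous (at x) ?A" "continuous (at x) ?B"
    using smooth_on_imp_continuous_on[OF smooth_on_deriv[OF smooth_on_deriv[OF f]]] S x
    by (auto simp: continuous_on_eq_continuous_at)
  obtain d1 where d1: "d1 > 0" "\<And>y. dist y x < d1 \<Longrightarrow> \<bar>?A y - ?A x\<bar> < \<epsilon>"
    using cont(1) \<open>\<epsilon> > 0\<close> unfolding continuous_at_eps_delta dist_real_def by blast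
  obtain d2 where d2: "d2 > 0" "\<And>y. dist y x < d2 \<Longrightarrow> \<bar>?B y - ?B x\<bar> < \<epsilon>"
    using cont(2) \<open>\<epsilon> > 0\<close> unfolding continuous_at_eps_delta dist_real_def by blast
  obtain d3 where d3: "d3 > 0" "\<And>y. dist y x < d3 \<Longrightarrow> y \<in> S"
    using S x unfolding open_dist by blast
  define d where "d = min d1 (min d2 d3)"
  have "d > 0" using d1(1) d2(1) d3(1) by (simp add: d_def)
  \<comment> \<open>The summand 1 keeps the denominator positive and makes the bound by
    \<open>d\<close> strict.\<close>
  define s where "s = d / (norm u + norm v + 1)"
  have "s > 0" using \<open>d > 0\<close> by (simp add: s_def add_nonneg_pos)
  have near: "dist (x + a *\<^sub>R p + b *\<^sub>R q) x < d"
    if "0 \<le> a" "a \<le> s" "0 \<le> b" "b \<le> s" "p = u \<and> q = v \<or> p = v \<and> q = u" for a b p q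
  proof -
    have "dist (x + a *\<^sub>R p + b *\<^sub>R q) x = norm (a *\<^sub>R p + b *\<^sub>R q)"
      by (simp add: dist_norm algebra_simps)
    also have "\<dots> \<le> a * norm p + b * norm q"
      using norm_triangle_ineq[of "a *\<^sub>R p" "b *\<^sub>R q"] that by simp
    also have "\<dots> \<le> s * norm p + s * norm q"
      using that by (intro add_mono mult_right_mono) auto
    also have "\<dots> = s * (norm u + norm v)"
      using that by (auto simp: algebra_simps)
    also have "\<dots> < s * (norm u + norm v + 1)"
      using \<open>s > 0\<close> by simp
    also have "\<dots> = d"
      using add_nonneg_pos[of "norm u + norm v" 1] by (simp add: s_def)
    finally show ?thesis .
  qed
  have sub: "x + a *\<^sub>R p + b *\<^sub>R q \<in> S"
    if "0 \<le> a" "a \<le> s" "0 \<le> b" "b \<le> s" "p = u \<and> q = v \<or> p = v \<and> q = u" for a b p q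
    using near[OF that] d3(2) by (simp add: d_def)
  obtain a b where ab: "0 \<le> a" "a \<le> s" "0 \<le> b" "b \<le> s"
    "f (x + s *\<^sub>R u + s *\<^sub>R v) - f (x + s *\<^sub>R u) - f (x + s *\<^sub>R v) + f x = s * s * ?A (x + a *\<^sub>R u + b *\<^sub>R v)"
    using second_difference[OF f \<open>s > 0\<close>, of x u v] sub by blast
  obtain a' b' where ab': "0 \<le> a'" "a' \<le> s" "0 \<le> b'" "b' \<le> s"
    "f (x + s *\<^sub>R v + s *\<^sub>R u) - f (x + s *\<^sub>R v) - f (x + s *\<^sub>R u) + f x = s * s * ?B (x + a' *\<^sub>R v + b' *\<^sub>R u)"
    using second_difference[OF f \<open>s > 0\<close>, of x v u] sub by blast
  have "s * s * ?A (x + a *\<^sub>R u + b *\<^sub>R v) = s * s * ?B (x + a' *\<^sub>R v + b' *\<^sub>R u)"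
    unfolding ab(5)[symmetric] ab'(5)[symmetric] by (simp add: algebra_simps)
  then have "?A (x + a *\<^sub>R u + b *\<^sub>R v) = ?B (x + a' *\<^sub>R v + b' *\<^sub>R u)"
    using \<open>s > 0\<close> by simp
  moreover have "\<bar>?A (x + a *\<^sub>R u + b *\<^sub>R v) - ?A x\<bar> < \<epsilon>"
    using near[OF ab(1-4)] by (intro d1(2)) (simp add: d_def)
  moreover have "\<bar>?B (x + a' *\<^sub>R v + b' *\<^sub>R u) - ?B x\<bar> < \<epsilon>"
    using near[OF ab'(1-4)] by (intro d2(2)) (simp add: d_def)
  ultimately have "\<bar>?A x - ?B x\<bar> < 2 * \<epsilon>"
    by linarith
  then show False
    by (simp add: \<epsilon>_def)
qed

lemma second_derivative_symmetric:
  fixes f :: "'a::euclidean_space \<Rightarrow> 'b::euclidean_space"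
  assumes S: "open S" and f: "smooth_on S f" and x: "x \<in> S"
  shows "frechet_derivative (\<lambda>y. frechet_derivative f (at y) u) (at x) v
    = frechet_derivative (\<lambda>y. frechet_derivative f (at y) v) (at x) u"
proof (rule euclidean_eqI)
  fix i :: 'b
  let ?F = "\<lambda>y. f y \<bullet> i"
  have F: "smooth_on S ?F"
    using S bounded_linear_inner_left f by (rule smooth_on_bounded_linear)
  have inner: "frechet_derivative (\<lambda>y. h y \<bullet> i) (at y) = (\<lambda>w. frechet_derivative h (at y) w \<bullet> i)"
    if "smooth_on S h" "y \<in> S" for h :: "'a \<Rightarrow> 'b" and y
    using smooth_on_has_derivative[OF that]
    by (intro frechet_derivative_eq has_derivative_inner_left)
  have "frechet_derivative (\<lambda>y. frechet_derivative ?F (at y) u) (at x) v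
      = frechet_derivative (\<lambda>y. frechet_derivative f (at y) u) (at x) v \<bullet> i" for u v
  proof -
    have "frechet_derivative (\<lambda>y. frechet_derivative ?F (at y) u) (at x)
        = frechet_derivative (\<lambda>y. frechet_derivative f (at y) u \<bullet> i) (at x)"
      by (rule frechet_derivative_cong[OF S x]) (simp add: inner[OF f])
    then show ?thesis
      by (simp add: inner[OF smooth_on_deriv[OF f] x])
  qed
  then show "frechet_derivative (\<lambda>y. frechet_derivative f (at y) u) (at x) v \<bullet> i
      = frechet_derivative (\<lambda>y. frechet_derivative f (at y) v) (at x) u \<bullet> i"
    using second_derivative_symmetric_real[OF S F x] by metis
qed

section \<open>Differentiability of solutions of linear systems\<close>

text \<open>Where \<open>k\<close> vanishes, the product rule has no term with a derivative of
  \<open>f\<close>, so continuity of \<open>f\<close> suffices. It serves for coordinates of a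
  solution whose differentiability is still to be proved.\<close>

lemma has_derivative_scaleR_vanishing:
  fixes f :: "'a::real_normed_vector \<Rightarrow> real" and k :: "'a \<Rightarrow> 'b::real_normed_vector"
  assumes f: "isCont f x" and k: "(k has_derivative k') (at x)" and k0: "k x = 0"
  shows "((\<lambda>y. f y *\<^sub>R k y) has_derivative (\<lambda>v. f x *\<^sub>R k' v)) (at x)"
proof -
  have lin: "bounded_linear k'" using k by (rule has_derivative_bounded_linear)
  then obtain C where C: "\<And>v. norm (k' v) \<le> norm v * C"
    using bounded_linear.bounded by blast
  have fc: "((\<lambda>h. f (x + h)) \<longlongrightarrow> f x) (at 0)"
    using f by (simp add: isCont_iff)
  have kl: "((\<lambda>h. norm (k (x + h) - k' h) / norm h) \<longlongrightarrow> 0) (at 0)"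
    using k k0 by (simp add: has_derivative_at)
  have "((\<lambda>h. \<bar>f (x + h)\<bar> * (norm (k (x + h) - k' h) / norm h) + \<bar>f (x + h) - f x\<bar> * C)
      \<longlongrightarrow> \<bar>f x\<bar> * 0 + \<bar>f x - f x\<bar> * C) (at 0)"
    by (intro tendsto_intros fc kl)
  then have lim: "((\<lambda>h. \<bar>f (x + h)\<bar> * (norm (k (x + h) - k' h) / norm h) + \<bar>f (x + h) - f x\<bar> * C)
      \<longlongrightarrow> 0) (at 0)"
    by simp
  have "norm (f (x + h) *\<^sub>R k (x + h) - f x *\<^sub>R k x - f x *\<^sub>R k' h) / norm h
      \<le> \<bar>f (x + h)\<bar> * (norm (k (x + h) - k' h) / norm h) + \<bar>f (x + h) - f x\<bar> * C" if "h \<noteq> 0" for h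
  proof -
    have "f (x + h) *\<^sub>R k (x + h) - f x *\<^sub>R k x - f x *\<^sub>R k' h
        = f (x + h) *\<^sub>R (k (x + h) - k' h) + (f (x + h) - f x) *\<^sub>R k' h"
      by (simp add: k0 algebra_simps)
    then have "norm (f (x + h) *\<^sub>R k (x + h) - f x *\<^sub>R k x - f x *\<^sub>R k' h)
        \<le> \<bar>f (x + h)\<bar> * norm (k (x + h) - k' h) + \<bar>f (x + h) - f x\<bar> * (norm h * C)"
      using norm_triangle_ineq[of "f (x + h) *\<^sub>R (k (x + h) - k' h)" "(f (x + h) - f x) *\<^sub>R k' h"]
        mult_left_mono[OF C[of h], of "\<bar>f (x + h) - f x\<bar>"] by simp
    then have "norm (f (x + h) *\<^sub>R k (x + h) - f x *\<^sub>R k x - f x *\<^sub>R k' h) / norm h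
        \<le> (\<bar>f (x + h)\<bar> * norm (k (x + h) - k' h) + \<bar>f (x + h) - f x\<bar> * (norm h * C)) / norm h"
      by (rule divide_right_mono) simp
    also have "\<dots> = \<bar>f (x + h)\<bar> * (norm (k (x + h) - k' h) / norm h) + \<bar>f (x + h) - f x\<bar> * C"
      using that by (simp add: add_divide_distrib)
    finally show ?thesis .
  qed
  then have "((\<lambda>h. norm (f (x + h) *\<^sub>R k (x + h) - f x *\<^sub>R k x - f x *\<^sub>R k' h) / norm h) \<longlongrightarrow> 0) (at 0)"
    by (intro tendsto_sandwich[OF _ _ tendsto_const lim])
      (auto simp: eventually_at_filter)
  then show ?thesis
    unfolding has_derivative_at by (simp add: bounded_linear_scaleR_right[THEN bounded_linear_compose, OF lin])
qed

text \<open>With a left inverse \<open>P\<close> of \<open>L x\<close>, the solution is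
  \<open>P (W y)\<close> minus a sum of its coordinates times functions \<open>k b\<close> that
  vanish at \<open>x\<close>. This equation first bounds \<gamma> near \<open>x\<close>, then gives
  its continuity, and finally its differentiability by
  \<open>has_derivative_scaleR_vanishing\<close>.\<close>

lemma differentiable_linear_solve:
  fixes L :: "'a::euclidean_space \<Rightarrow> 'b::euclidean_space \<Rightarrow> 'c::euclidean_space"
  assumes U: "open U" "x \<in> U" and lin: "\<And>y. y \<in> U \<Longrightarrow> linear (L y)"
    and L: "\<And>v. (\<lambda>y. L y v) differentiable at x" and inj: "inj (L x)"
    and W: "W differentiable at x" and eq: "\<And>y. y \<in> U \<Longrightarrow> L y (\<gamma> y) = W y"
  shows "\<gamma> differentiable at x"
proof -
  obtain P where P: "linear P" "P \<circ> L x = id"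
    using linear_injective_left_inverse[OF lin[OF U(2)] inj] by blast
  have bP: "bounded_linear P"
    using P(1) by (simp add: linear_conv_bounded_linear)
  have PL: "P (L x v) = v" for v
    using fun_cong[OF P(2), of v] by simp
  define k where "k b y = P (L y b - L x b)" for b y
  have k0: "k b x = 0" for b
    by (simp add: k_def linear_0[OF P(1)])
  have kd: "k b differentiable at x" for b
  proof -
    obtain D where "((\<lambda>y. L y b) has_derivative D) (at x)"
      using L[of b] unfolding differentiable_def by blast
    from bounded_linear.has_derivative[OF bP has_derivative_diff[OF this has_derivative_const]]
    show ?thesis
      unfolding k_def by (rule differentiableI)
  qed
  then have kc: "isCont (k b) x" for b
    by (rule differentiable_imp_continuous_within)
  have expand: "\<gamma> y = P (W y) - (\<Sum>b\<in>Basis. (\<gamma> y \<bullet> b) *\<^sub>R k b y)" if "y \<in> U" for y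
  proof -
    have "(\<Sum>b\<in>Basis. (\<gamma> y \<bullet> b) *\<^sub>R k b y)
        = P (L y (\<Sum>b\<in>Basis. (\<gamma> y \<bullet> b) *\<^sub>R b)) - P (L x (\<Sum>b\<in>Basis. (\<gamma> y \<bullet> b) *\<^sub>R b))"
      by (simp only: k_def linear_sum[OF lin[OF that]] linear_sum[OF lin[OF U(2)]] linear_scale[OF lin[OF that]]
          linear_scale[OF lin[OF U(2)]] linear_diff[OF P(1)] linear_sum[OF P(1)] linear_scale[OF P(1)]
          scaleR_diff_right sum_subtractf)
    then show ?thesis
      by (simp add: euclidean_representation PL eq[OF that])
  qed
  define m where "m y = (\<Sum>b\<in>Basis. norm (k b y))" for y
  have "isCont m x"
    unfolding m_def using kc by (intro continuous_intros)
  then have m0: "(m \<longlongrightarrow> 0) (at x)"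
    by (simp add: isCont_def m_def k0)
  have diff: "norm (\<gamma> y - P (W y)) \<le> m y * norm (\<gamma> y)" if "y \<in> U" for y
  proof -
    have "\<gamma> y - P (W y) = - (\<Sum>b\<in>Basis. (\<gamma> y \<bullet> b) *\<^sub>R k b y)"
      by (subst (1) expand[OF that]) simp
    then have "norm (\<gamma> y - P (W y)) = norm (\<Sum>b\<in>Basis. (\<gamma> y \<bullet> b) *\<^sub>R k b y)"
      by simp
    also have "\<dots> \<le> (\<Sum>b\<in>Basis. norm (\<gamma> y) * norm (k b y))"
      by (rule order_trans[OF norm_sum sum_mono]) (simp add: Basis_le_norm mult_right_mono)
    finally show ?thesis
      by (simp add: m_def sum_distrib_left mult.commute)
  qed
  have PWc: "((\<lambda>y. P (W y)) \<longlongrightarrow> P (W x)) (at x)"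
    using bounded_linear.tendsto[OF bP] differentiable_imp_continuous_within[OF W]
    by (simp add: continuous_within)
  have evU: "eventually (\<lambda>y. y \<in> U) (at x)"
    using U by (rule eventually_at_in_open')
  \<comment> \<open>Below 1/2 the error is at most half the norm of \<gamma>, which bounds \<gamma>
    by twice \<open>P (W y)\<close>.\<close>
  have "eventually (\<lambda>y. m y < 1 / 2) (at x)"
    using m0 by (rule order_tendstoD) simp
  then have "eventually (\<lambda>y. norm (\<gamma> y - P (W y)) \<le> m y * (2 * norm (P (W y)))) (at x)"
    using evU
  proof eventually_elim
    case (elim y)
    have m: "0 \<le> m y"
      by (simp add: m_def sum_nonneg)
    have "norm (\<gamma> y) \<le> norm (P (W y)) + norm (\<gamma> y - P (W y))"
      using norm_triangle_ineq[of "P (W y)" "\<gamma> y - P (W y)"] by simp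
    also have "norm (\<gamma> y - P (W y)) \<le> 1 / 2 * norm (\<gamma> y)"
      using diff[OF elim(2)] mult_right_mono[of "m y" "1 / 2" "norm (\<gamma> y)"] elim(1) by simp
    finally have "norm (\<gamma> y) \<le> 2 * norm (P (W y))"
      by simp
    then show ?case
      by (intro order_trans[OF diff[OF elim(2)]] mult_left_mono m)
  qed
  moreover have "((\<lambda>y. m y * (2 * norm (P (W y)))) \<longlongrightarrow> 0 * (2 * norm (P (W x)))) (at x)"
    by (intro tendsto_intros m0 PWc)
  then have "((\<lambda>y. m y * (2 * norm (P (W y)))) \<longlongrightarrow> 0) (at x)"
    by simp
  ultimately have "((\<lambda>y. \<gamma> y - P (W y)) \<longlongrightarrow> 0) (at x)"
    by (rule Lim_null_comparison)
  from tendsto_add[OF this PWc] have "(\<gamma> \<longlongrightarrow> P (W x)) (at x)"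
    by simp
  moreover have "P (W x) = \<gamma> x"
    using PL[of "\<gamma> x"] unfolding eq[OF U(2)] .
  ultimately have "(\<gamma> \<longlongrightarrow> \<gamma> x) (at x)"
    by simp
  then have \<gamma>c: "isCont \<gamma> x"
    by (simp add: isCont_def)
  have "(\<lambda>y. (\<gamma> y \<bullet> b) *\<^sub>R k b y) differentiable at x" for b
  proof -
    have "isCont (\<lambda>y. \<gamma> y \<bullet> b) x"
      using \<gamma>c by (intro continuous_intros)
    moreover obtain D where "(k b has_derivative D) (at x)"
      using kd[of b] unfolding differentiable_def by blast
    ultimately have "((\<lambda>y. (\<gamma> y \<bullet> b) *\<^sub>R k b y) has_derivative (\<lambda>v. (\<gamma> x \<bullet> b) *\<^sub>R D v)) (at x)"
      by (rule has_derivative_scaleR_vanishing) (rule k0)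
    then show ?thesis
      by (rule differentiableI)
  qed
  then have "(\<lambda>y. \<Sum>b\<in>Basis. (\<gamma> y \<bullet> b) *\<^sub>R k b y) differentiable at x"
    by (intro differentiable_sum) auto
  moreover have "(\<lambda>y. P (W y)) differentiable at x"
    using W bounded_linear.has_derivative[OF bP] unfolding differentiable_def by blast
  ultimately have "(\<lambda>y. P (W y) - (\<Sum>b\<in>Basis. (\<gamma> y \<bullet> b) *\<^sub>R k b y)) differentiable at x"
    by (intro differentiable_diff)
  then show ?thesis
    using differentiable_cong[OF U expand] by simp
qed

subsection \<open>Charts of the product\<close>

text \<open>One definition for both ambient spaces: Euclidean for \<epsilon> = 1, Minkowski for
  \<epsilon> = -1.\<close>

definition mform :: "real \<Rightarrow> 'a::euclidean_space \<times> real \<Rightarrow> 'a \<times> real \<Rightarrow> real" where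
  "mform \<epsilon> p q = fst p \<bullet> fst q + \<epsilon> * (snd p * snd q)"

lemma mform_commute: "mform \<epsilon> p q = mform \<epsilon> q p"
  by (simp add: mform_def inner_commute mult.commute)

lemma bilinear_mform: "bilinear (mform \<epsilon>)"
  unfolding bilinear_def by (auto intro!: linearI simp: mform_def algebra_simps)

text \<open>For \<epsilon> = -1 the position vector is timelike, and Cauchy-Schwarz shows that
  everything orthogonal to it is spacelike.\<close>

lemma mform_pos:
  fixes p \<xi> :: "'a::euclidean_space \<times> real"
  assumes c: "0 < c" and \<epsilon>: "\<epsilon> = 1 \<or> \<epsilon> = -1" and p: "mform \<epsilon> p p = \<epsilon> / c"
    and \<xi>: "mform \<epsilon> \<xi> p = 0" "\<xi> \<noteq> 0"
  shows "0 < mform \<epsilon> \<xi> \<xi>"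
  using \<epsilon>
proof
  assume "\<epsilon> = 1"
  then have "mform \<epsilon> \<xi> \<xi> = \<xi> \<bullet> \<xi>"
    by (simp add: mform_def inner_prod_def)
  with \<xi>(2) show ?thesis by simp
next
  assume "\<epsilon> = -1"
  define x t u s where "x = fst p" "t = snd p" "u = fst \<xi>" "s = snd \<xi>"
  note [simp] = \<open>\<epsilon> = -1\<close> x_t_u_s_def
  have xt: "x \<bullet> x = t * t - 1 / c" and us: "u \<bullet> x = s * t"
    using p \<xi>(1) by (simp_all add: mform_def)
  have "t \<noteq> 0"
    using xt c inner_ge_zero[of x] by auto
  have "u \<noteq> 0"
    using us \<open>t \<noteq> 0\<close> \<xi>(2) by (auto simp: prod_eq_iff)
  \<comment> \<open>Both the orthogonality and the equation of the quadric are already substituted;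
    the term 1 / c supplies the strictness.\<close>
  have "(s * t)\<^sup>2 \<le> (u \<bullet> u) * (t * t - 1 / c)"
    using Cauchy_Schwarz_ineq[of u x] by (simp only: us xt)
  then have "(u \<bullet> u) / c \<le> (u \<bullet> u - s * s) * (t * t)"
    by (simp add: algebra_simps power2_eq_square del: x_t_u_s_def)
  moreover have "0 < (u \<bullet> u) / c"
    using c \<open>u \<noteq> 0\<close> by (simp del: x_t_u_s_def)
  ultimately have "0 < (u \<bullet> u - s * s) * (t * t)"
    by linarith
  then have "0 < u \<bullet> u - s * s"
    by (simp add: zero_less_mult_iff del: x_t_u_s_def)
  then show ?thesis
    by (simp add: mform_def)
qed

lemma dim_mform_orthogonal:
  fixes p :: "'a::euclidean_space \<times> real"
  assumes "mform \<epsilon> p p \<noteq> 0"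
  shows "dim {\<xi>. mform \<epsilon> \<xi> p = 0} = DIM('a)"
proof -
  \<comment> \<open>The Euclidean normal of the hyperplane orthogonal to \<open>p\<close> for
    \<open>mform\<close>.\<close>
  define a where "a = (fst p, \<epsilon> * snd p)"
  have a: "mform \<epsilon> \<xi> p = a \<bullet> \<xi>" for \<xi>
    by (simp add: mform_def a_def inner_prod_def inner_commute mult_ac)
  then have "a \<noteq> 0"
    using assms by auto
  then show ?thesis
    using dim_hyperplane[of a] by (simp add: a)
qed

lemma subspace_mform_orthogonal: "subspace {\<xi>. mform \<epsilon> \<xi> p = 0}"
proof -
  have lin: "linear (\<lambda>\<xi>. mform \<epsilon> \<xi> p)"
    using bilinear_mform unfolding bilinear_def by blast
  show ?thesis
    by (simp add: subspace_def linear_0[OF lin] linear_add[OF lin] linear_scale[OF lin])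
qed

text \<open>Positivity is assumed only on \<open>V\<close>, because the Minkowski form is indefinite
  on the ambient space.\<close>

lemma gram_schmidt:
  fixes \<beta> :: "'a::euclidean_space \<Rightarrow> 'a \<Rightarrow> real"
  assumes V: "subspace V" and \<beta>: "bilinear \<beta>" "\<And>u v. \<beta> u v = \<beta> v u"
    and pos: "\<And>v. v \<in> V \<Longrightarrow> v \<noteq> 0 \<Longrightarrow> 0 < \<beta> v v"
  shows "\<exists>f :: nat \<Rightarrow> 'a. (\<forall>i<dim V. f i \<in> V) \<and> (\<forall>i<dim V. \<forall>j<dim V. \<beta> (f i) (f j) = (if i = j then 1 else 0))"
proof -
  have lin: "linear (\<beta> u)" for u
    using \<beta>(1) unfolding bilinear_def by blast
  have "m \<le> dim V \<Longrightarrow> \<exists>f :: nat \<Rightarrow> 'a. (\<forall>i<m. f i \<in> V) \<and> (\<forall>i<m. \<forall>j<m. \<beta> (f i) (f j) = (if i = j then 1 else 0))" for m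
  proof (induction m)
    case (Suc m)
    then obtain f :: "nat \<Rightarrow> 'a" where f: "\<And>i. i < m \<Longrightarrow> f i \<in> V"
      "\<And>i j. i < m \<Longrightarrow> j < m \<Longrightarrow> \<beta> (f i) (f j) = (if i = j then 1 else 0)"
      by auto
    have "dim (f ` {..<m}) \<le> m"
      using dim_le_card[of "f ` {..<m}" "f ` {..<m}"] card_image_le[of "{..<m}" f] span_superset by fastforce
    then have "\<not> V \<subseteq> span (f ` {..<m})"
      using Suc.prems dim_subset[of V "span (f ` {..<m})"] by (auto simp: dim_span)
    then obtain v where v: "v \<in> V" "v \<notin> span (f ` {..<m})"
      by blast
    define w where "w = v - (\<Sum>l<m. \<beta> (f l) v *\<^sub>R f l)"
    have wV: "w \<in> V"
      unfolding w_def by (intro subspace_diff[OF V] subspace_sum[OF V] subspace_scale[OF V] v f) simp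
    have "(\<Sum>l<m. \<beta> (f l) v *\<^sub>R f l) \<in> span (f ` {..<m})"
      by (intro span_sum span_scale span_base) auto
    with v(2) have "w \<noteq> 0"
      unfolding w_def by auto
    then have ww: "0 < \<beta> w w"
      using pos wV by blast
    have fw: "\<beta> (f i) w = 0" if "i < m" for i
    proof -
      have "\<beta> (f i) w = \<beta> (f i) v - (\<Sum>l<m. \<beta> (f l) v * \<beta> (f i) (f l))"
        by (simp add: w_def linear_diff[OF lin] linear_sum[OF lin] linear_scale[OF lin])
      also have "(\<Sum>l<m. \<beta> (f l) v * \<beta> (f i) (f l)) = (\<Sum>l<m. if l = i then \<beta> (f l) v else 0)"
        using that by (intro sum.cong refl) (auto simp: f(2))
      finally show ?thesis using that by simp
    qed
    define w' where "w' = (1 / sqrt (\<beta> w w)) *\<^sub>R w"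
    have lin': "linear (\<lambda>u. \<beta> u v)" for v
      using \<beta>(1) unfolding bilinear_def by blast
    have w': "w' \<in> V" "\<And>i. i < m \<Longrightarrow> \<beta> (f i) w' = 0" "\<beta> w' w' = 1"
      using ww by (simp_all add: w'_def subspace_scale[OF V wV] linear_scale[OF lin] linear_scale[OF lin'] fw)
    have w'_left: "\<beta> w' (f i) = 0" if "i < m" for i
      using w'(2)[OF that] \<beta>(2)[of w' "f i"] by simp
    show ?case
    proof (intro exI[of _ "f(m := w')"] conjI allI impI)
      fix i j assume "i < Suc m" "j < Suc m"
      then show "\<beta> ((f(m := w')) i) ((f(m := w')) j) = (if i = j then 1 else 0)"
        using w' w'_left f(2) by (auto simp: less_Suc_eq)
    qed (use w' f in \<open>auto simp: less_Suc_eq\<close>)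
  qed auto
  from this[of "dim V"] show ?thesis by simp
qed

type_synonym 'e ambient = "('e \<times> real) \<times> ('e \<times> real)"

definition form1 :: "'e::euclidean_space ambient \<Rightarrow> 'e ambient \<Rightarrow> real" where
  "form1 a b = mform 1 (fst a) (fst b)"

definition form2 :: "'e::euclidean_space ambient \<Rightarrow> 'e ambient \<Rightarrow> real" where
  "form2 a b = mform (-1) (snd a) (snd b)"

lemma forms_commute: "form1 a b = form1 b a" "form2 a b = form2 b a"
  by (simp_all add: form1_def form2_def mform_commute)

lemma bounded_bilinear_form1: "bounded_bilinear form1"
  unfolding bilinear_conv_bounded_bilinear[symmetric] bilinear_def form1_def
  by (auto intro!: linearI simp: mform_def algebra_simps)

lemma bounded_bilinear_form2: "bounded_bilinear form2"
  unfolding bilinear_conv_bounded_bilinear[symmetric] bilinear_def form2_def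
  by (auto intro!: linearI simp: mform_def algebra_simps)

lemma bilinear_pullback:
  assumes "bounded_bilinear P" "linear f"
  shows "bilinear (\<lambda>u v. P (f u) (f v))"
  unfolding bilinear_def
  by (auto intro!: linearI simp: linear_add[OF assms(2)] linear_scale[OF assms(2)]
      bounded_bilinear.add_left[OF assms(1)] bounded_bilinear.add_right[OF assms(1)]
      bounded_bilinear.scaleR_left[OF assms(1)] bounded_bilinear.scaleR_right[OF assms(1)])

text \<open>An immersion into the product of the two quadrics. Every \<open>local_param\<close> of
  the product manifold is an instance, so the curvature is computed in all charts at once.\<close>

locale product_chart =
  fixes c :: real and U :: "('e::euclidean_space \<times> 'e) set" and \<psi> :: "'e \<times> 'e \<Rightarrow> 'e ambient"
  assumes c_pos: "0 < c" and open_U: "open U" and smooth: "smooth_on U \<psi>"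
    and inj_deriv: "x \<in> U \<Longrightarrow> inj (frechet_derivative \<psi> (at x))"
    and form1_\<psi>: "x \<in> U \<Longrightarrow> form1 (\<psi> x) (\<psi> x) = 1 / c"
    and form2_\<psi>: "x \<in> U \<Longrightarrow> form2 (\<psi> x) (\<psi> x) = - 1 / c"
begin

text \<open>The direction comes before the point so that \<open>D v\<close> is a map that can be
  differentiated again.\<close>

abbreviation D :: "'e \<times> 'e \<Rightarrow> 'e \<times> 'e \<Rightarrow> 'e ambient" where
  "D v y \<equiv> frechet_derivative \<psi> (at y) v"

abbreviation DD :: "'e \<times> 'e \<Rightarrow> 'e \<times> 'e \<Rightarrow> 'e \<times> 'e \<Rightarrow> 'e ambient" where
  "DD u v y \<equiv> frechet_derivative (\<lambda>z. D v z) (at y) u"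

definition "g1 y u v = form1 (D u y) (D v y)"
definition "g2 y u v = form2 (D u y) (D v y)"
definition "G y u v = g1 y u v + g2 y u v"
definition "h y u v = g1 y u v - g2 y u v"

definition tangent :: "'e \<times> 'e \<Rightarrow> 'e ambient set" where
  "tangent y = {w. form1 w (\<psi> y) = 0 \<and> form2 w (\<psi> y) = 0}"

lemma linear_D: "y \<in> U \<Longrightarrow> linear (\<lambda>v. D v y)"
  using has_derivative_linear[OF smooth_on_has_derivative[OF smooth]] by simp

lemma deriv_form:
  assumes "bounded_bilinear P" "smooth_on U f" "smooth_on U k" "y \<in> U"
  shows "frechet_derivative (\<lambda>z. P (f z) (k z)) (at y) u
    = P (f y) (frechet_derivative k (at y) u) + P (frechet_derivative f (at y) u) (k y)"
  using frechet_derivative_eq[OF bounded_bilinear.FDERIV[OF assms(1)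
        smooth_on_has_derivative[OF assms(2,4)] smooth_on_has_derivative[OF assms(3,4)]]] by simp

lemma deriv_eq_zero:
  assumes "\<And>z. z \<in> U \<Longrightarrow> f z = a" "y \<in> U"
  shows "frechet_derivative f (at y) u = 0"
  using frechet_derivative_cong[OF open_U assms(2), of f "\<lambda>_. a"] assms(1)
  by (simp add: frechet_derivative_const)

lemma tangent_D:
  assumes "y \<in> U"
  shows "form1 (D u y) (\<psi> y) = 0" "form2 (D u y) (\<psi> y) = 0"
  using deriv_form[OF bounded_bilinear_form1 smooth smooth assms, of u]
    deriv_form[OF bounded_bilinear_form2 smooth smooth assms, of u]
    deriv_eq_zero[OF form1_\<psi> assms] deriv_eq_zero[OF form2_\<psi> assms]
    forms_commute[of "\<psi> y" "D u y"]
  by auto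

text \<open>The identities of \<open>tangent_D\<close> differentiated once more: they fix the normal
  part of the second derivatives.\<close>

lemma form_DD:
  assumes "y \<in> U"
  shows "form1 (DD u v y) (\<psi> y) = - g1 y u v" "form2 (DD u v y) (\<psi> y) = - g2 y u v"
  using deriv_form[OF bounded_bilinear_form1 smooth_on_deriv[OF smooth] smooth assms, of v u]
    deriv_form[OF bounded_bilinear_form2 smooth_on_deriv[OF smooth] smooth assms, of v u]
    deriv_eq_zero[OF tangent_D(1) assms] deriv_eq_zero[OF tangent_D(2) assms]
    forms_commute[of "D u y" "D v y"]
  by (auto simp: g1_def g2_def)

lemma DD_commute: "y \<in> U \<Longrightarrow> DD u v y = DD v u y"
  using second_derivative_symmetric[OF open_U smooth] by simp

text \<open>One inclusion is \<open>tangent_D\<close>; injectivity of the derivative and a dimension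
  count give equality.\<close>

lemma range_D:
  assumes "y \<in> U"
  shows "range (\<lambda>v. D v y) = tangent y"
proof -
  have "mform 1 (fst (\<psi> y)) (fst (\<psi> y)) \<noteq> 0" "mform (-1) (snd (\<psi> y)) (snd (\<psi> y)) \<noteq> 0"
    using form1_\<psi>[OF assms] form2_\<psi>[OF assms] c_pos by (auto simp: form1_def form2_def)
  note dims = dim_mform_orthogonal[OF this(1)] dim_mform_orthogonal[OF this(2)]
  note sub = subspace_mform_orthogonal
  have "tangent y = {\<xi>. mform 1 \<xi> (fst (\<psi> y)) = 0} \<times> {\<xi>. mform (-1) \<xi> (snd (\<psi> y)) = 0}"
    by (auto simp: tangent_def form1_def form2_def)
  then have t: "subspace (tangent y)" "dim (tangent y) = DIM('e) + DIM('e)"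
    using dims by (simp_all add: dim_Times[OF sub sub] subspace_Times[OF sub sub])
  have "dim (range (\<lambda>v. D v y)) = DIM('e \<times> 'e)"
    using dim_image_eq[OF linear_D[OF assms], of UNIV] inj_deriv[OF assms] by (simp add: inj_on_subset)
  then show ?thesis
    using t tangent_D[OF assms]
    by (intro subspace_dim_equal linear_subspace_image[OF linear_D[OF assms]]) (auto simp: tangent_def)
qed

lemma tangent_pos:
  assumes "y \<in> U" "w \<in> tangent y" "w \<noteq> 0"
  shows "0 < form1 w w + form2 w w"
proof -
  have 1: "fst w \<noteq> 0 \<Longrightarrow> 0 < form1 w w"
    using mform_pos[OF c_pos, of 1 "fst (\<psi> y)" "fst w"] form1_\<psi>[OF assms(1)] assms(2)
    by (simp add: form1_def tangent_def)
  have 2: "snd w \<noteq> 0 \<Longrightarrow> 0 < form2 w w"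
    using mform_pos[OF c_pos, of "-1" "snd (\<psi> y)" "snd w"] form2_\<psi>[OF assms(1)] assms(2)
    by (simp add: form2_def tangent_def)
  have "fst w = 0 \<Longrightarrow> form1 w w = 0" "snd w = 0 \<Longrightarrow> form2 w w = 0"
    by (simp_all add: form1_def form2_def mform_def)
  with 1 2 assms(3) show ?thesis
    by (cases "fst w = 0"; cases "snd w = 0") (auto simp: prod_eq_iff)
qed

lemma bilinear_g:
  assumes "y \<in> U"
  shows "bilinear (g1 y)" "bilinear (g2 y)"
  using bilinear_pullback[OF bounded_bilinear_form1 linear_D[OF assms]]
    bilinear_pullback[OF bounded_bilinear_form2 linear_D[OF assms]]
  by (simp_all add: g1_def[abs_def] g2_def[abs_def])

lemma
  assumes "y \<in> U"
  shows inner_product_G: "inner_product (G y)" and bilinear_h: "bilinear (h y)"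
proof -
  have "bilinear (G y)" "bilinear (h y)"
    using bilinear_g[OF assms] unfolding bilinear_def G_def[abs_def] h_def[abs_def]
    by (auto intro: linear_compose_add linear_compose_sub)
  moreover have "0 < G y u u" if "u \<noteq> 0" for u
  proof -
    have "D u y \<noteq> D 0 y"
      using inj_deriv[OF assms] that by (auto dest: injD)
    then have "D u y \<noteq> 0"
      by (simp add: linear_0[OF linear_D[OF assms]])
    then show ?thesis
      using tangent_pos[OF assms, of "D u y"] tangent_D[OF assms]
      by (simp add: G_def g1_def g2_def tangent_def)
  qed
  ultimately show "inner_product (G y)" "bilinear (h y)"
    by (simp_all add: inner_product_def G_def g1_def g2_def forms_commute)
qed

text \<open>Orthonormal bases of the two tangent factors, sphere first, are joined and pulled back
  through the derivative of \<psi>.\<close>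

lemma adapted_basis:
  assumes "y \<in> U"
  obtains b where "orthonormal_basis (G y) b"
    "\<And>i j. i < DIM('e) + DIM('e) \<Longrightarrow> j < DIM('e) + DIM('e) \<Longrightarrow>
      h y (b i) (b j) = (if i = j then if i < DIM('e) then 1 else -1 else 0)"
proof -
  let ?T1 = "{\<xi>. mform 1 \<xi> (fst (\<psi> y)) = 0}" and ?T2 = "{\<xi>. mform (-1) \<xi> (snd (\<psi> y)) = 0}"
  have p: "mform 1 (fst (\<psi> y)) (fst (\<psi> y)) = 1 / c" "mform (-1) (snd (\<psi> y)) (snd (\<psi> y)) = - 1 / c"
    using form1_\<psi>[OF assms] form2_\<psi>[OF assms] by (auto simp: form1_def form2_def)
  have dims: "dim ?T1 = DIM('e)" "dim ?T2 = DIM('e)"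
    using p c_pos by (auto intro!: dim_mform_orthogonal)
  have "\<exists>f :: nat \<Rightarrow> 'e \<times> real. (\<forall>i<dim ?T1. f i \<in> ?T1) \<and>
      (\<forall>i<dim ?T1. \<forall>j<dim ?T1. mform 1 (f i) (f j) = (if i = j then 1 else 0))"
    by (rule gram_schmidt[OF subspace_mform_orthogonal bilinear_mform mform_commute])
      (rule mform_pos[OF c_pos _ p(1)], simp_all)
  then obtain f1 :: "nat \<Rightarrow> 'e \<times> real" where f1: "\<And>i. i < DIM('e) \<Longrightarrow> f1 i \<in> ?T1"
    "\<And>i j. i < DIM('e) \<Longrightarrow> j < DIM('e) \<Longrightarrow> mform 1 (f1 i) (f1 j) = (if i = j then 1 else 0)"
    unfolding dims by blast
  have "\<exists>f :: nat \<Rightarrow> 'e \<times> real. (\<forall>i<dim ?T2. f i \<in> ?T2) \<and>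
      (\<forall>i<dim ?T2. \<forall>j<dim ?T2. mform (-1) (f i) (f j) = (if i = j then 1 else 0))"
    by (rule gram_schmidt[OF subspace_mform_orthogonal bilinear_mform mform_commute])
      (rule mform_pos[OF c_pos _ p(2)], simp_all)
  then obtain f2 :: "nat \<Rightarrow> 'e \<times> real" where f2: "\<And>i. i < DIM('e) \<Longrightarrow> f2 i \<in> ?T2"
    "\<And>i j. i < DIM('e) \<Longrightarrow> j < DIM('e) \<Longrightarrow> mform (-1) (f2 i) (f2 j) = (if i = j then 1 else 0)"
    unfolding dims by blast
  define w where "w i = (if i < DIM('e) then (f1 i, 0) else (0, f2 (i - DIM('e))))" for i
  have "w i \<in> range (\<lambda>v. D v y)" if "i < DIM('e) + DIM('e)" for i
    unfolding range_D[OF assms] tangent_def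
    using that f1(1)[of i] f2(1)[of "i - DIM('e)"] by (auto simp: w_def form1_def form2_def mform_def)
  then have "\<exists>v. D v y = w i" if "i < DIM('e) + DIM('e)" for i
    using that by (metis rangeE)
  then obtain b where b: "\<And>i. i < DIM('e) + DIM('e) \<Longrightarrow> D (b i) y = w i"
    by metis
  have z: "mform \<epsilon> 0 q = 0" "mform \<epsilon> q 0 = 0" for \<epsilon> and q :: "'e \<times> real"
    by (simp_all add: mform_def)
  have val: "g1 y (b i) (b j) = (if i = j \<and> i < DIM('e) then 1 else 0)"
    "g2 y (b i) (b j) = (if i = j \<and> \<not> i < DIM('e) then 1 else 0)"
    if "i < DIM('e) + DIM('e)" "j < DIM('e) + DIM('e)" for i j
  proof -
    have "i - DIM('e) < DIM('e)" "j - DIM('e) < DIM('e)"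
      using that DIM_positive[where 'a = 'e] by linarith+
    then show "g1 y (b i) (b j) = (if i = j \<and> i < DIM('e) then 1 else 0)"
      "g2 y (b i) (b j) = (if i = j \<and> \<not> i < DIM('e) then 1 else 0)"
      using b[OF that(1)] b[OF that(2)] f1(2)[of i j] f2(2)[of "i - DIM('e)" "j - DIM('e)"]
      by (auto simp: g1_def g2_def form1_def form2_def w_def z)
  qed
  show ?thesis
  proof (rule that[of b])
    show "orthonormal_basis (G y) b"
      using val by (simp add: orthonormal_basis_def G_def)
    show "h y (b i) (b j) = (if i = j then if i < DIM('e) then 1 else -1 else 0)"
      if "i < DIM('e) + DIM('e)" "j < DIM('e) + DIM('e)" for i j
      using val[OF that] by (simp add: h_def)
  qed
qed

end

subsection \<open>The Gauss equation\<close>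

context product_chart begin

lemma has_derivative_form:
  assumes "bounded_bilinear P" "y \<in> U"
  shows "((\<lambda>y. P (D v y) (D w y)) has_derivative (\<lambda>u. P (D v y) (DD u w y) + P (DD u v y) (D w y))) (at y)"
  using bounded_bilinear.FDERIV[OF assms(1) smooth_on_has_derivative[OF smooth_on_deriv[OF smooth] assms(2)]
      smooth_on_has_derivative[OF smooth_on_deriv[OF smooth] assms(2)]] .

lemma has_derivative_g1:
  "y \<in> U \<Longrightarrow> ((\<lambda>y. g1 y v w) has_derivative (\<lambda>u. form1 (D v y) (DD u w y) + form1 (DD u v y) (D w y))) (at y)"
  unfolding g1_def by (rule has_derivative_form[OF bounded_bilinear_form1])

lemma has_derivative_g2:
  "y \<in> U \<Longrightarrow> ((\<lambda>y. g2 y v w) has_derivative (\<lambda>u. form2 (D v y) (DD u w y) + form2 (DD u v y) (D w y))) (at y)"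
  unfolding g2_def by (rule has_derivative_form[OF bounded_bilinear_form2])

definition form :: "'e ambient \<Rightarrow> 'e ambient \<Rightarrow> real" where
  "form a b = form1 a b + form2 a b"

lemma form_add: "form (a + b) d = form a d + form b d"
  and form_diff: "form (a - b) d = form a d - form b d"
  and form_scale: "form (s *\<^sub>R a) d = s * form a d"
  and form_commute: "form a d = form d a"
  by (simp_all add: form_def forms_commute[of a] algebra_simps
      bounded_bilinear.add_left[OF bounded_bilinear_form1] bounded_bilinear.add_left[OF bounded_bilinear_form2]
      bounded_bilinear.diff_left[OF bounded_bilinear_form1] bounded_bilinear.diff_left[OF bounded_bilinear_form2]
      bounded_bilinear.scaleR_left[OF bounded_bilinear_form1] bounded_bilinear.scaleR_left[OF bounded_bilinear_form2])

lemma G_eq_form: "G y u v = form (D u y) (D v y)"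
  by (simp add: G_def g1_def g2_def form_def)

text \<open>For a metric induced by a constant ambient form, symmetry of \<open>DD\<close> cancels
  all terms of the Koszul formula except two equal ones.\<close>

lemma koszul:
  assumes "y \<in> U"
  shows "(frechet_derivative (\<lambda>y. G y v w) (at y) u + frechet_derivative (\<lambda>y. G y u w) (at y) v
      - frechet_derivative (\<lambda>y. G y u v) (at y) w) / 2 = form (DD u v y) (D w y)"
proof -
  have "frechet_derivative (\<lambda>y. G y v w) (at y) u = form (D v y) (DD u w y) + form (DD u v y) (D w y)" for u v w
    unfolding G_def
    using frechet_derivative_eq[OF has_derivative_add[OF has_derivative_g1[OF assms] has_derivative_g2[OF assms]]]
    by (simp add: form_def)
  then show ?thesis
    using DD_commute[OF assms, of u v] DD_commute[OF assms, of u w] DD_commute[OF assms, of v w]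
      form_commute[of "D v y" "DD u w y"] form_commute[of "D u y" "DD v w y"]
    by simp
qed

text \<open>The second derivatives of \<open>\<psi>\<close> with the normal components removed: the second fundamental
  form of the product is \<open>- c * g1\<close> times the position vector of the sphere plus \<open>c * g2\<close> times
  that of the hyperboloid.\<close>

definition tangential :: "'e \<times> 'e \<Rightarrow> 'e \<times> 'e \<Rightarrow> 'e \<times> 'e \<Rightarrow> 'e ambient" where
  "tangential u v y = DD u v y + (c * g1 y u v) *\<^sub>R (fst (\<psi> y), 0) - (c * g2 y u v) *\<^sub>R (0, snd (\<psi> y))"

lemma form_normal:
  "form1 (fst a, 0) b = form1 a b" "form2 (fst a, 0) b = 0" "form1 (0, snd a) b = 0" "form2 (0, snd a) b = form2 a b"
  by (simp_all add: form1_def form2_def mform_def)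

lemma tangential_in_tangent:
  assumes "y \<in> U"
  shows "tangential u v y \<in> tangent y"
proof -
  have "form1 (tangential u v y) (\<psi> y) = - g1 y u v + c * g1 y u v * form1 (\<psi> y) (\<psi> y)"
    by (simp add: form_DD(1)[OF assms] tangential_def bounded_bilinear.add_left[OF bounded_bilinear_form1]
        bounded_bilinear.diff_left[OF bounded_bilinear_form1]
        bounded_bilinear.scaleR_left[OF bounded_bilinear_form1] form_normal del: scaleR_Pair)
  moreover have "form2 (tangential u v y) (\<psi> y) = - g2 y u v - c * g2 y u v * form2 (\<psi> y) (\<psi> y)"
    by (simp add: form_DD(2)[OF assms] tangential_def bounded_bilinear.add_left[OF bounded_bilinear_form2]
        bounded_bilinear.diff_left[OF bounded_bilinear_form2]
        bounded_bilinear.scaleR_left[OF bounded_bilinear_form2] form_normal del: scaleR_Pair)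
  ultimately show ?thesis
    using form1_\<psi>[OF assms] form2_\<psi>[OF assms] c_pos by (simp add: tangent_def)
qed

lemma form_normal_D:
  assumes "y \<in> U"
  shows "form (fst (\<psi> y), 0) (D w y) = 0" "form (0, snd (\<psi> y)) (D w y) = 0"
  using tangent_D[OF assms, of w]
  by (simp_all add: form_def form_normal forms_commute[of "\<psi> y"])

lemma form_tangential: "y \<in> U \<Longrightarrow> form (tangential u v y) (D w y) = form (DD u v y) (D w y)"
  by (simp add: tangential_def form_add form_diff form_scale form_normal_D del: scaleR_Pair)

text \<open>The Levi-Civita derivative is the tangential part of the ambient one.
  \<open>range_D\<close> provides a solution of the defining equation; positive definiteness, tested
  on the difference, makes it unique.\<close>

lemma D_christoffel:
  assumes "y \<in> U"
  shows "D (christoffel G y u v) y = tangential u v y"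
proof -
  have "tangential u v y \<in> range (\<lambda>v. D v y)"
    unfolding range_D[OF assms] by (rule tangential_in_tangent[OF assms])
  then obtain z where z: "D z y = tangential u v y"
    by (elim rangeE) simp
  have "christoffel G y u v = z"
    unfolding christoffel_def koszul[OF assms]
  proof (rule the_equality)
    show zw: "\<forall>w. G y z w = form (DD u v y) (D w y)"
      by (simp add: G_eq_form z form_tangential[OF assms])
    fix z' assume z'w: "\<forall>w. G y z' w = form (DD u v y) (D w y)"
    have "G y (z' - z) (z' - z) = 0"
      using spec[OF zw, of "z' - z"] spec[OF z'w, of "z' - z"] by (simp add: linear_diff[OF inner_productD(2)[OF inner_product_G[OF assms]]])
    then show "z' = z"
      using inner_productD(4)[OF inner_product_G[OF assms], of "z' - z"] by auto
  qed
  with z show ?thesis by simp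
qed

lemma D_expand: "y \<in> U \<Longrightarrow> D v y = (\<Sum>b\<in>Basis. (v \<bullet> b) *\<^sub>R D b y)"
  using linear_sum[OF linear_D, of y "\<lambda>b. (v \<bullet> b) *\<^sub>R b" Basis] linear_scale[OF linear_D, of y]
  by (simp add: euclidean_representation)

lemma has_derivative_D: "y \<in> U \<Longrightarrow> ((\<lambda>y. D v y) has_derivative (\<lambda>u. DD u v y)) (at y)"
  by (rule smooth_on_has_derivative[OF smooth_on_deriv[OF smooth]])

lemma DD_expand:
  assumes "y \<in> U"
  shows "DD u v y = (\<Sum>b\<in>Basis. (v \<bullet> b) *\<^sub>R DD u b y)"
proof -
  have "((\<lambda>y. \<Sum>b\<in>Basis. (v \<bullet> b) *\<^sub>R D b y) has_derivative (\<lambda>u. \<Sum>b\<in>Basis. (v \<bullet> b) *\<^sub>R DD u b y)) (at y)"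
    by (intro has_derivative_sum has_derivative_scaleR_right has_derivative_D assms)
  from frechet_derivative_eq[OF this] show ?thesis
    using frechet_derivative_cong[OF open_U assms D_expand] by simp
qed

text \<open>The coefficients \<mu> and \<nu> may stay unspecified: they multiply normal vectors,
  which are orthogonal to all \<open>D z y\<close>.\<close>

lemma has_derivative_tangential:
  assumes "y \<in> U"
  obtains \<mu> \<nu> where "((\<lambda>y. tangential v w y) has_derivative
    (\<lambda>u. frechet_derivative (\<lambda>y. DD v w y) (at y) u
      + (\<mu> u *\<^sub>R (fst (\<psi> y), 0) + (c * g1 y v w) *\<^sub>R (fst (D u y), 0))
      - (\<nu> u *\<^sub>R (0, snd (\<psi> y)) + (c * g2 y v w) *\<^sub>R (0, snd (D u y))))) (at y)"
proof -
  have \<psi>: "(\<psi> has_derivative (\<lambda>u. D u y)) (at y)"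
    by (rule smooth_on_has_derivative[OF smooth assms])
  have n1: "((\<lambda>y. (fst (\<psi> y), 0)) has_derivative (\<lambda>u. (fst (D u y), 0))) (at y)"
    by (intro has_derivative_Pair has_derivative_fst \<psi> has_derivative_const)
  have n2: "((\<lambda>y. (0, snd (\<psi> y))) has_derivative (\<lambda>u. (0, snd (D u y)))) (at y)"
    by (intro has_derivative_Pair has_derivative_snd \<psi> has_derivative_const)
  let ?g1' = "\<lambda>u. c * (form1 (D v y) (DD u w y) + form1 (DD u v y) (D w y))"
  let ?g2' = "\<lambda>u. c * (form2 (D v y) (DD u w y) + form2 (DD u v y) (D w y))"
  have "((\<lambda>y. tangential v w y) has_derivative
    (\<lambda>u. frechet_derivative (\<lambda>y. DD v w y) (at y) u
      + ((c * g1 y v w) *\<^sub>R (fst (D u y), 0) + ?g1' u *\<^sub>R (fst (\<psi> y), 0))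
      - ((c * g2 y v w) *\<^sub>R (0, snd (D u y)) + ?g2' u *\<^sub>R (0, snd (\<psi> y))))) (at y)"
    unfolding tangential_def
    by (intro has_derivative_add has_derivative_diff has_derivative_scaleR has_derivative_mult_right
        has_derivative_g1 has_derivative_g2 n1 n2 assms
        smooth_on_has_derivative[OF smooth_on_deriv[OF smooth_on_deriv[OF smooth]]])
  then show ?thesis
    by (intro that[of ?g1' ?g2']) (simp only: add.commute)
qed

text \<open>\<open>D_christoffel\<close> is the linear system to which
  \<open>differentiable_linear_solve\<close> applies.\<close>

lemma differentiable_christoffel:
  assumes "x \<in> U"
  shows "(\<lambda>y. christoffel G y v w) differentiable at x"
proof (rule differentiable_linear_solve[OF open_U assms, of "\<lambda>y v. D v y"])
  show "(\<lambda>y. tangential v w y) differentiable at x"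
    by (rule has_derivative_tangential[OF assms, of v w]) (rule differentiableI)
  show "(\<lambda>y. D v y) differentiable at x" for v
    using has_derivative_D[OF assms] by (rule differentiableI)
qed (use linear_D D_christoffel inj_deriv[OF assms] in auto)

text \<open>The equation of \<open>D_christoffel\<close> is differentiated and paired with a tangent
  vector. One side yields the two Christoffel terms of the curvature, the other a third derivative
  of \<psi> and the derivatives of the position vectors.\<close>

lemma christoffel_derivative:
  assumes "x \<in> U"
  shows "G x (frechet_derivative (\<lambda>y. christoffel G y v w) (at x) u) z
      + G x (christoffel G x u (christoffel G x v w)) z
    = form (frechet_derivative (\<lambda>y. DD v w y) (at x) u) (D z x)
      + c * (g1 x v w * g1 x u z) - c * (g2 x v w * g2 x u z)"
proof -
  let ?\<gamma> = "\<lambda>y. christoffel G y v w"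
  let ?\<gamma>' = "frechet_derivative ?\<gamma> (at x)"
  have \<gamma>': "(?\<gamma> has_derivative ?\<gamma>') (at x)"
    using differentiable_christoffel[OF assms] by (simp add: frechet_derivative_works)
  have eq: "tangential v w y = (\<Sum>b\<in>Basis. (?\<gamma> y \<bullet> b) *\<^sub>R D b y)" if "y \<in> U" for y
    using D_christoffel[OF that, of v w] D_expand[OF that, of "?\<gamma> y"] by simp
  have "((\<lambda>y. \<Sum>b\<in>Basis. (?\<gamma> y \<bullet> b) *\<^sub>R D b y) has_derivative
      (\<lambda>u. \<Sum>b\<in>Basis. (?\<gamma> x \<bullet> b) *\<^sub>R DD u b x + (?\<gamma>' u \<bullet> b) *\<^sub>R D b x)) (at x)"
    by (intro has_derivative_sum has_derivative_scaleR has_derivative_inner_left \<gamma>' has_derivative_D assms)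
  then have "frechet_derivative (\<lambda>y. tangential v w y) (at x)
      = (\<lambda>u. \<Sum>b\<in>Basis. (?\<gamma> x \<bullet> b) *\<^sub>R DD u b x + (?\<gamma>' u \<bullet> b) *\<^sub>R D b x)"
    by - (rule trans[OF frechet_derivative_cong[OF open_U assms eq]], assumption | rule frechet_derivative_eq)+
  then have "frechet_derivative (\<lambda>y. tangential v w y) (at x) u = DD u (?\<gamma> x) x + D (?\<gamma>' u) x"
    using DD_expand[OF assms, of "?\<gamma> x" u] D_expand[OF assms, of "?\<gamma>' u"] by (simp add: sum.distrib)
  moreover obtain \<mu> \<nu> where "((\<lambda>y. tangential v w y) has_derivative
    (\<lambda>u. frechet_derivative (\<lambda>y. DD v w y) (at x) u
      + (\<mu> u *\<^sub>R (fst (\<psi> x), 0) + (c * g1 x v w) *\<^sub>R (fst (D u x), 0))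
      - (\<nu> u *\<^sub>R (0, snd (\<psi> x)) + (c * g2 x v w) *\<^sub>R (0, snd (D u x))))) (at x)"
    by (rule has_derivative_tangential[OF assms, of v w])
  note fun_cong[OF frechet_derivative_eq[OF this], of u]
  ultimately have "form (DD u (?\<gamma> x) x + D (?\<gamma>' u) x) (D z x)
    = form (frechet_derivative (\<lambda>y. DD v w y) (at x) u
      + (\<mu> u *\<^sub>R (fst (\<psi> x), 0) + (c * g1 x v w) *\<^sub>R (fst (D u x), 0))
      - (\<nu> u *\<^sub>R (0, snd (\<psi> x)) + (c * g2 x v w) *\<^sub>R (0, snd (D u x)))) (D z x)"
    by simp
  moreover have "form (fst (D u x), 0) (D z x) = g1 x u z" "form (0, snd (D u x)) (D z x) = g2 x u z"
    by (simp_all add: form_def form_normal g1_def g2_def)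
  moreover have "form (DD u (?\<gamma> x) x) (D z x) = G x (christoffel G x u (?\<gamma> x)) z"
    by (simp add: G_eq_form D_christoffel[OF assms] form_tangential[OF assms])
  ultimately show ?thesis
    by (simp add: form_add form_diff form_scale form_normal_D[OF assms] G_eq_form del: scaleR_Pair add_Pair)
qed

text \<open>Antisymmetrising \<open>christoffel_derivative\<close> in \<open>u\<close> and
  \<open>v\<close> removes the third derivatives and leaves the products of the second fundamental
  form.\<close>

theorem riemann_G:
  assumes "x \<in> U"
  shows "G x (riemann G x u v w) z
    = c * (g1 x v w * g1 x u z - g1 x u w * g1 x v z) - c * (g2 x v w * g2 x u z - g2 x u w * g2 x v z)"
proof -
  note lin = inner_productD(2)[OF inner_product_G[OF assms]]
  have "frechet_derivative (\<lambda>y. DD v w y) (at x) u = frechet_derivative (\<lambda>y. DD u w y) (at x) v"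
    by (rule second_derivative_symmetric[OF open_U smooth_on_deriv[OF smooth] assms])
  then show ?thesis
    using christoffel_derivative[OF assms, of v w u z] christoffel_derivative[OF assms, of u w v z]
    by (simp add: riemann_def linear_add[OF lin] linear_diff[OF lin] algebra_simps)
qed

text \<open>In the product of \<open>g1 + g2\<close> and \<open>g1 - g2\<close> the mixed terms
  cancel, while those in \<open>g1\<close> alone and in \<open>g2\<close> alone occur twice; hence
  the constant c / 2.\<close>

theorem curvature_form_G:
  assumes "x \<in> U"
  shows "curvature_form G x = (\<lambda>X Y. c / 2 * bprod 2 (\<lambda>i. if odd i then h x else G x) X Y)"
proof (intro ext)
  fix X Y :: "nat \<Rightarrow> 'e \<times> 'e"
  have "{..<2::nat} = {0, 1}"
    by auto
  then have P: "{\<sigma>. \<sigma> permutes {..<2::nat}} = {id, Transposition.transpose 0 1}"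
    by (auto simp: permutes_doubleton_iff)
  have "id \<noteq> Transposition.transpose 0 (1::nat)"
    by (metis id_apply transpose_apply_first zero_neq_one)
  then have bprod: "bprod 2 (\<lambda>i. if odd i then h x else G x) X Y
    = G x (X 0) (Y 0) * h x (X 1) (Y 1) - G x (X 0) (Y 1) * h x (X 1) (Y 0)
      - G x (X 1) (Y 0) * h x (X 0) (Y 1) + G x (X 1) (Y 1) * h x (X 0) (Y 0)"
    unfolding bprod_def P by (simp add: sign_swap_id numeral_2_eq_2)
  show "curvature_form G x X Y = c / 2 * bprod 2 (\<lambda>i. if odd i then h x else G x) X Y"
    unfolding curvature_form_def riemann_G[OF assms] bprod by (simp add: G_def h_def algebra_simps)
qed

end

section \<open>The Thorpe forms in a chart\<close>

context product_chart begin

lemma dhodge_thorpe_form: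
  assumes "x \<in> U" and k: "2 * k \<le> DIM('e)"
  shows "dhodge (G x) DIM('e) DIM('e) (thorpe_form G x DIM('e) k)
    = (\<lambda>X Y. (-1) ^ k * thorpe_form G x DIM('e) k X Y)"
proof -
  obtain b where b: "orthonormal_basis (G x) b"
    "\<And>i j. i < DIM('e) + DIM('e) \<Longrightarrow> j < DIM('e) + DIM('e) \<Longrightarrow>
      h x (b i) (b j) = (if i = j then if i < DIM('e) then 1 else -1 else 0)"
    using adapted_basis[OF assms(1)] by blast
  obtain S where S: "S \<subseteq> {..<DIM('e)}" "card S = k" "thorpe_form G x DIM('e) k
      = (\<lambda>X Y. (c / 2) ^ k * bprod DIM('e) (\<lambda>i. if i \<in> S then h x else G x) X Y)"
    using thorpe_form_eq[OF curvature_form_G[OF assms(1)] k] by blast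
  \<comment> \<open>The adapted basis proves that the choice in \<open>dhodge\<close> succeeds;
    \<open>dhodge_at_select\<close> then handles the chosen basis, whatever it is.\<close>
  have "orthonormal_basis (G x) (SOME e. orthonormal_basis (G x) e)"
    by (rule someI[of "orthonormal_basis (G x)" b, OF b(1)])
  from dhodge_at_select[OF inner_product_G[OF assms(1)] this b(1) _ bilinear_h[OF assms(1)] b(2) S(1)]
  show ?thesis
    by (simp add: dhodge_def S(2,3) dhodge_at_scale mult.left_commute)
qed

text \<open>Evaluated on the first half of the adapted basis, which is tangent to the sphere, so
  that every factor restricts to the identity.\<close>

lemma thorpe_form_nonzero:
  assumes "x \<in> U" and k: "2 * k \<le> DIM('e)"
  shows "\<exists>X Y. thorpe_form G x DIM('e) k X Y \<noteq> 0"
proof -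
  obtain b where b: "orthonormal_basis (G x) b"
    "\<And>i j. i < DIM('e) + DIM('e) \<Longrightarrow> j < DIM('e) + DIM('e) \<Longrightarrow>
      h x (b i) (b j) = (if i = j then if i < DIM('e) then 1 else -1 else 0)"
    using adapted_basis[OF assms(1)] by blast
  obtain S where S: "thorpe_form G x DIM('e) k
      = (\<lambda>X Y. (c / 2) ^ k * bprod DIM('e) (\<lambda>i. if i \<in> S then h x else G x) X Y)"
    using thorpe_form_eq[OF curvature_form_G[OF assms(1)] k] by blast
  have "bprod DIM('e) (\<lambda>i. if i \<in> S then h x else G x) b b \<noteq> 0"
  proof (rule bprod_basis_nonzero)
    fix i j m assume "i < DIM('e)" "j < DIM('e)"
    then show "(if m \<in> S then h x else G x) (b i) (b j) = (if i = j then 1 else 0)"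
      using orthonormal_basisD[OF b(1), of i j] b(2)[of i j] by auto
  qed
  then show ?thesis
    using c_pos by (intro exI[of _ b]) (simp add: S)
qed

lemma smooth_on_G: "smooth_on U (\<lambda>x. G x u v)"
  unfolding G_def g1_def g2_def
  by (rule smooth_on_add[OF open_U smooth_on_bounded_bilinear[OF open_U bounded_bilinear_form1
          smooth_on_deriv[OF smooth] smooth_on_deriv[OF smooth]]
        smooth_on_bounded_bilinear[OF open_U bounded_bilinear_form2
          smooth_on_deriv[OF smooth] smooth_on_deriv[OF smooth]]])

end

section \<open>The product manifold and its stereographic charts\<close>

abbreviation sphere_times_hyperbolic ::
  "real \<Rightarrow> (('e::euclidean_space \<times> real) \<times> ('e \<times> real), 'e \<times> 'e) riemannian" where
  "sphere_times_hyperbolic c \<equiv> riemannian_product (round_sphere c) (hyperbolic_space (- c))"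

lemma points_product:
  "points (sphere_times_hyperbolic c :: (_, 'e::euclidean_space \<times> 'e) riemannian)
    = {w. form1 w w = 1 / c \<and> form2 w w = - 1 / c \<and> 0 < snd (snd w)}"
  by (auto simp: riemannian_product_def round_sphere_def hyperbolic_space_def form1_def form2_def mform_def)

lemma product_chart_of_local_param:
  assumes "0 < c" "local_param (sphere_times_hyperbolic c) U \<psi>"
  shows "product_chart c U \<psi>"
proof -
  have "\<psi> ` U \<subseteq> points (sphere_times_hyperbolic c)"
    using assms(2) openin_imp_subset unfolding local_param_def by blast
  then have "form1 (\<psi> x) (\<psi> x) = 1 / c" "form2 (\<psi> x) (\<psi> x) = - 1 / c" if "x \<in> U" for x
    using that unfolding points_product by blast+
  with assms show ?thesis
    by (simp add: product_chart_def local_param_def)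
qed

lemma coord_metric_product:
  assumes "product_chart c U \<psi>"
  shows "coord_metric (sphere_times_hyperbolic c) \<psi> = product_chart.G \<psi>"
  by (intro ext)
    (simp add: coord_metric_def product_chart.G_def[OF assms] product_chart.g1_def[OF assms]
      product_chart.g2_def[OF assms] riemannian_product_def round_sphere_def hyperbolic_space_def
      form1_def form2_def mform_def split: prod.splits)

text \<open>For \<open>\<epsilon> = 1\<close> the inverse stereographic projection of the sphere from the pole with last coordinate
  \<open>- s / sqrt c\<close>; for \<open>\<epsilon> = -1\<close> and \<open>s = 1\<close> the Poincare ball parametrisation of the hyperboloid.\<close>

definition stereographic :: "real \<Rightarrow> real \<Rightarrow> real \<Rightarrow> 'a::euclidean_space \<Rightarrow> 'a \<times> real" where
  "stereographic \<epsilon> c s y = ((2 * inverse (1 + \<epsilon> * c * (y \<bullet> y))) *\<^sub>R y,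
    s / sqrt c * (1 - \<epsilon> * c * (y \<bullet> y)) * inverse (1 + \<epsilon> * c * (y \<bullet> y)))"

text \<open>Projection from the pole onto the hyperplane of last coordinate 0; the denominator
  vanishes at the pole.\<close>

definition stereographic_inv :: "real \<Rightarrow> real \<Rightarrow> 'a::euclidean_space \<times> real \<Rightarrow> 'a" where
  "stereographic_inv c s p = inverse (1 + s * sqrt c * snd p) *\<^sub>R fst p"

text \<open>For positive \<open>c\<close> this is the whole space if \<epsilon> = 1, and the open
  ball of radius 1 / sqrt c if \<epsilon> = -1.\<close>

definition stereographic_dom :: "real \<Rightarrow> real \<Rightarrow> 'a::euclidean_space set" where
  "stereographic_dom \<epsilon> c = {y. 0 < 1 + \<epsilon> * c * (y \<bullet> y)}"

lemma open_stereographic_dom: "open (stereographic_dom \<epsilon> c)"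
  unfolding stereographic_dom_def by (intro open_Collect_less continuous_intros)

text \<open>The denominators of the two maps are reciprocal up to the factor 2, so positivity of one
  is positivity of the other.\<close>

lemma stereographic_denominator:
  assumes "0 < c" "s = 1 \<or> s = -1" "y \<in> stereographic_dom \<epsilon> c"
  shows "1 + s * sqrt c * snd (stereographic \<epsilon> c s y) = 2 * inverse (1 + \<epsilon> * c * (y \<bullet> y))"
proof -
  define d where "d = 1 + \<epsilon> * c * (y \<bullet> y)"
  have "d \<noteq> 0"
    using assms(3) by (simp add: d_def stereographic_dom_def)
  have q: "s * sqrt c * (s / sqrt c) = 1"
    using assms(1,2) by auto
  have "1 + s * sqrt c * snd (stereographic \<epsilon> c s y)
      = 1 + (s * sqrt c * (s / sqrt c)) * ((1 - \<epsilon> * c * (y \<bullet> y)) * inverse d)"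
    by (simp only: stereographic_def snd_conv d_def mult.assoc)
  also have "\<dots> = 1 + (2 - d) * inverse d"
    unfolding q by (simp add: d_def)
  also have "\<dots> = 2 * inverse d"
    using \<open>d \<noteq> 0\<close> by (simp add: field_simps)
  finally show ?thesis
    by (simp add: d_def)
qed

lemma stereographic_inv_stereographic:
  assumes "0 < c" "s = 1 \<or> s = -1" "y \<in> stereographic_dom \<epsilon> c"
  shows "stereographic_inv c s (stereographic \<epsilon> c s y) = y"
  using assms(3) unfolding stereographic_inv_def stereographic_denominator[OF assms]
  by (simp add: stereographic_def stereographic_dom_def)

lemma mform_stereographic:
  assumes "0 < c" "s = 1 \<or> s = -1" "\<epsilon> = 1 \<or> \<epsilon> = -1" "y \<in> stereographic_dom \<epsilon> c"
  shows "mform \<epsilon> (stereographic \<epsilon> c s y) (stereographic \<epsilon> c s y) = \<epsilon> / c"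
proof -
  define e d k where "e = \<epsilon> * c * (y \<bullet> y)" "d = 1 + e" "k = s / sqrt c"
  note defs = this
  have "d \<noteq> 0"
    using assms(4) by (simp add: defs stereographic_dom_def)
  have k: "k * k = 1 / c"
    using assms(1,2) by (auto simp: defs)
  have "stereographic \<epsilon> c s y = ((2 * inverse d) *\<^sub>R y, k * (1 - e) * inverse d)"
    by (simp add: stereographic_def defs)
  then have "mform \<epsilon> (stereographic \<epsilon> c s y) (stereographic \<epsilon> c s y)
    = (4 * (y \<bullet> y) + \<epsilon> * (k * k) * (1 - e)\<^sup>2) * (inverse d)\<^sup>2"
    by (simp add: mform_def power2_eq_square algebra_simps)
  \<comment> \<open>Up to the factor \<epsilon> / c this is 4 e + (1 - e)^2 = (1 + e)^2.\<close>
  also have "4 * (y \<bullet> y) + \<epsilon> * (k * k) * (1 - e)\<^sup>2 = \<epsilon> / c * d\<^sup>2"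
    unfolding k using assms(1,3) by (auto simp: defs(1,2) power2_eq_square field_simps)
  also have "\<epsilon> / c * d\<^sup>2 * (inverse d)\<^sup>2 = \<epsilon> / c"
    using \<open>d \<noteq> 0\<close> by (simp add: mult.assoc power_mult_distrib[symmetric])
  finally show ?thesis .
qed

lemma stereographic_stereographic_inv:
  assumes c: "0 < c" and s: "s = 1 \<or> s = -1" and \<epsilon>: "\<epsilon> = 1 \<or> \<epsilon> = -1"
    and p: "mform \<epsilon> p p = \<epsilon> / c" "0 < 1 + s * sqrt c * snd p"
  shows "stereographic_inv c s p \<in> stereographic_dom \<epsilon> c"
    "stereographic \<epsilon> c s (stereographic_inv c s p) = p"
proof -
  define \<tau> where "\<tau> = s * sqrt c * snd p"
  define y where "y = stereographic_inv c s p"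
  have \<tau>: "0 < 1 + \<tau>" using p(2) by (simp add: \<tau>_def)
  have "\<tau> * \<tau> = c * (snd p * snd p)"
    using s c by (auto simp: \<tau>_def)
  moreover have "fst p \<bullet> fst p + \<epsilon> * (snd p * snd p) = \<epsilon> / c"
    using p(1) by (simp add: mform_def)
  \<comment> \<open>The equation of the quadric, with the last coordinate rescaled to \<tau> so that
    the pole lies at \<tau> = -1.\<close>
  ultimately have x: "\<epsilon> * c * (fst p \<bullet> fst p) = (1 - \<tau>) * (1 + \<tau>)"
    using \<epsilon> c by (auto simp: field_simps)
  have yy: "\<epsilon> * c * (y \<bullet> y) = (1 - \<tau>) / (1 + \<tau>)"
  proof -
    have "\<epsilon> * c * (y \<bullet> y) = \<epsilon> * c * (fst p \<bullet> fst p) * (inverse (1 + \<tau>) * inverse (1 + \<tau>))"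
      by (simp add: y_def stereographic_inv_def \<tau>_def[symmetric])
    also have "\<dots> = (1 - \<tau>) * inverse (1 + \<tau>) * ((1 + \<tau>) * inverse (1 + \<tau>))"
      unfolding x by (simp only: mult_ac)
    also have "\<dots> = (1 - \<tau>) / (1 + \<tau>)"
      using \<tau> by (simp add: divide_inverse)
    finally show ?thesis .
  qed
  have d: "1 + \<epsilon> * c * (y \<bullet> y) = 2 / (1 + \<tau>)"
    unfolding yy using \<tau> by (simp add: field_simps)
  then show "stereographic_inv c s p \<in> stereographic_dom \<epsilon> c"
    using \<tau> by (simp add: y_def[symmetric] stereographic_dom_def)
  have "(1 - \<epsilon> * c * (y \<bullet> y)) * inverse (1 + \<epsilon> * c * (y \<bullet> y)) = \<tau>"
    unfolding yy d using \<tau> by (simp add: field_simps)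
  then have "s / sqrt c * (1 - \<epsilon> * c * (y \<bullet> y)) * inverse (1 + \<epsilon> * c * (y \<bullet> y)) = s / sqrt c * \<tau>"
    by (simp only: mult.assoc)
  also have "s / sqrt c * \<tau> = snd p"
    using s c by (auto simp: \<tau>_def)
  finally have snd: "s / sqrt c * (1 - \<epsilon> * c * (y \<bullet> y)) * inverse (1 + \<epsilon> * c * (y \<bullet> y)) = snd p" .
  have fst: "(2 * inverse (1 + \<epsilon> * c * (y \<bullet> y))) *\<^sub>R y = fst p"
  proof -
    have "2 * inverse (2 / u) * inverse u = 1" if "u \<noteq> 0" for u :: real
      using that by (simp add: field_simps)
    from this[of "1 + \<tau>"] \<tau> have "2 * inverse (2 / (1 + \<tau>)) * inverse (1 + \<tau>) = 1"
      by simp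
    then show ?thesis
      unfolding d by (simp only: y_def stereographic_inv_def \<tau>_def[symmetric] scaleR_scaleR scaleR_one)
  qed
  show "stereographic \<epsilon> c s (stereographic_inv c s p) = p"
    by (simp only: y_def[symmetric] stereographic_def fst snd prod.collapse)
qed

lemma smooth_on_Pair:
  assumes "open S" "smooth_on S f" "smooth_on S g"
  shows "smooth_on S (\<lambda>x. (f x, g x))"
proof -
  have "smooth_on S (\<lambda>x. (f x, 0) + (0, g x))"
    by (intro smooth_on_add assms smooth_on_bounded_linear[of S "\<lambda>x. (x, 0)"]
        smooth_on_bounded_linear[of S "\<lambda>x. (0, x)"] bounded_linear_Pair bounded_linear_ident bounded_linear_zero)
  then show ?thesis by simp
qed

lemma smooth_on_stereographic: "smooth_on (stereographic_dom \<epsilon> c) (stereographic \<epsilon> c s)"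
proof -
  let ?S = "stereographic_dom \<epsilon> c :: 'a set"
  note S = open_stereographic_dom
  have q: "smooth_on ?S (\<lambda>y. a + b * (y \<bullet> y))" for a b :: real
    by (intro smooth_on_add smooth_on_const smooth_on_bounded_linear[of _ "\<lambda>z. b * z"] bounded_linear_mult_right
        smooth_on_bounded_bilinear[OF _ bounded_bilinear_inner] smooth_on_ident S)
  have i: "smooth_on ?S (\<lambda>y. inverse (1 + \<epsilon> * c * (y \<bullet> y)))"
    by (intro smooth_on_inverse S q) (simp add: stereographic_dom_def)
  have "smooth_on ?S (\<lambda>y. (2 * inverse (1 + \<epsilon> * c * (y \<bullet> y))) *\<^sub>R y)"
    by (intro smooth_on_bounded_bilinear[OF _ bounded_bilinear_scaleR] smooth_on_bounded_linear[of _ "\<lambda>z. 2 * z"]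
        bounded_linear_mult_right i smooth_on_ident S)
  moreover have "smooth_on ?S (\<lambda>y. s / sqrt c * (1 + (- (\<epsilon> * c)) * (y \<bullet> y)) * inverse (1 + \<epsilon> * c * (y \<bullet> y)))"
    by (intro smooth_on_bounded_bilinear[OF _ bounded_bilinear_mult] smooth_on_const q i S)
  ultimately have "smooth_on ?S (\<lambda>y. ((2 * inverse (1 + \<epsilon> * c * (y \<bullet> y))) *\<^sub>R y,
      s / sqrt c * (1 + (- (\<epsilon> * c)) * (y \<bullet> y)) * inverse (1 + \<epsilon> * c * (y \<bullet> y))))"
    by (intro smooth_on_Pair S)
  then show ?thesis
    by (simp add: stereographic_def[abs_def])
qed

lemma differentiable_stereographic_inv:
  assumes "1 + s * sqrt c * snd p \<noteq> 0"
  shows "stereographic_inv c s differentiable at p"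
proof -
  have "((\<lambda>p. 1 + s * sqrt c * snd p) has_derivative (\<lambda>h. 0 + s * sqrt c * snd h)) (at p)"
    by (intro has_derivative_add has_derivative_const has_derivative_mult_right has_derivative_snd has_derivative_ident)
  from has_derivative_scaleR[OF Deriv.has_derivative_inverse[OF assms this] has_derivative_fst[OF has_derivative_ident]]
  show ?thesis
    unfolding stereographic_inv_def[abs_def] by (rule differentiableI)
qed

text \<open>The chain rule for a differentiable left inverse; no derivative of the chart has to be
  computed.\<close>

lemma inj_frechet_derivative_left_inverse:
  assumes U: "open U" "x \<in> U" and \<psi>: "\<psi> differentiable at x" and \<phi>: "\<phi> differentiable at (\<psi> x)"
    and inv: "\<And>y. y \<in> U \<Longrightarrow> \<phi> (\<psi> y) = y"
  shows "inj (frechet_derivative \<psi> (at x))"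
proof -
  have "((\<phi> \<circ> \<psi>) has_derivative frechet_derivative \<phi> (at (\<psi> x)) \<circ> frechet_derivative \<psi> (at x)) (at x)"
    using \<psi> \<phi> by (intro diff_chain_at) (simp_all add: frechet_derivative_works)
  then have "frechet_derivative (\<phi> \<circ> \<psi>) (at x) = frechet_derivative \<phi> (at (\<psi> x)) \<circ> frechet_derivative \<psi> (at x)"
    by (rule frechet_derivative_eq)
  moreover have "frechet_derivative (\<phi> \<circ> \<psi>) (at x) = frechet_derivative (\<lambda>y. y) (at x)"
    by (rule frechet_derivative_cong[OF U]) (simp add: inv)
  ultimately have "frechet_derivative \<phi> (at (\<psi> x)) \<circ> frechet_derivative \<psi> (at x) = id"
    using frechet_derivative_eq[OF has_derivative_ident, of x] by (simp add: id_def)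
  then have "frechet_derivative \<phi> (at (\<psi> x)) (frechet_derivative \<psi> (at x) v) = v" for v
    by (simp add: fun_eq_iff)
  then show ?thesis
    by (rule inj_on_inverseI)
qed

definition product_dom :: "real \<Rightarrow> ('e::euclidean_space \<times> 'e) set" where
  "product_dom c = stereographic_dom 1 c \<times> stereographic_dom (-1) c"

text \<open>Only the sphere factor carries a choice of pole: two stereographic charts cover the
  sphere, while one ball covers the upper sheet.\<close>

definition product_param :: "real \<Rightarrow> real \<Rightarrow> 'e \<times> 'e \<Rightarrow> 'e::euclidean_space ambient" where
  "product_param c s y = (stereographic 1 c s (fst y), stereographic (-1) c 1 (snd y))"

definition product_param_inv :: "real \<Rightarrow> real \<Rightarrow> 'e::euclidean_space ambient \<Rightarrow> 'e \<times> 'e" where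
  "product_param_inv c s w = (stereographic_inv c s (fst w), stereographic_inv c 1 (snd w))"

lemma product_param_inv_product_param:
  assumes "0 < c" "s = 1 \<or> s = -1" "y \<in> product_dom c"
  shows "product_param_inv c s (product_param c s y) = y"
  using assms by (auto simp: product_param_inv_def product_param_def product_dom_def
      stereographic_inv_stereographic)

text \<open>Cutting out the image by strict inequalities between continuous functions is what shows
  that it is relatively open.\<close>

lemma product_param_image:
  fixes c s :: real
  assumes c: "0 < c" and s: "s = 1 \<or> s = -1"
  shows "product_param c s ` (product_dom c :: ('e::euclidean_space \<times> 'e) set)
    = points (sphere_times_hyperbolic c :: (_, 'e \<times> 'e) riemannian)
      \<inter> {w. 0 < 1 + s * sqrt c * snd (fst w) \<and> 0 < 1 + 1 * sqrt c * snd (snd w)}" (is "?L = ?R")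
proof (intro equalityI subsetI)
  fix w assume "w \<in> ?L"
  then obtain y1 y2 :: 'e where y: "y1 \<in> stereographic_dom 1 c" "y2 \<in> stereographic_dom (-1) c"
    "w = (stereographic 1 c s y1, stereographic (-1) c 1 y2)"
    by (auto simp: product_dom_def product_param_def)
  \<comment> \<open>The last coordinate is positive on the ball, so the image lies on the upper
    sheet.\<close>
  have "0 < 1 + c * (y2 \<bullet> y2)"
    using c by (intro add_pos_nonneg) simp_all
  moreover have "0 < inverse (1 + (-1) * c * (y2 \<bullet> y2))"
    using y(2) by (simp add: stereographic_dom_def)
  ultimately have "0 < 1 / sqrt c * (1 + c * (y2 \<bullet> y2)) * inverse (1 + (-1) * c * (y2 \<bullet> y2))"
    using c by (intro mult_pos_pos) simp_all
  then have "0 < snd (stereographic (-1) c 1 y2)"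
    by (simp add: stereographic_def)
  moreover have "0 < inverse (1 + 1 * c * (y1 \<bullet> y1))" "0 < inverse (1 + (-1) * c * (y2 \<bullet> y2))"
    using y(1,2) by (simp_all add: stereographic_dom_def)
  ultimately show "w \<in> ?R"
    using stereographic_denominator[OF c s y(1)] stereographic_denominator[OF c _ y(2), of 1]
      mform_stereographic[OF c s _ y(1)] mform_stereographic[OF c _ _ y(2), of 1]
    unfolding y(3) points_product by (simp add: form1_def form2_def)
next
  fix w assume "w \<in> ?R"
  then have w: "mform 1 (fst w) (fst w) = 1 / c" "mform (-1) (snd w) (snd w) = (-1) / c"
    "0 < 1 + s * sqrt c * snd (fst w)" "0 < 1 + 1 * sqrt c * snd (snd w)"
    unfolding points_product by (simp_all add: form1_def form2_def)
  have 1: "stereographic_inv c s (fst w) \<in> stereographic_dom 1 c"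
    "stereographic 1 c s (stereographic_inv c s (fst w)) = fst w"
    using stereographic_stereographic_inv[OF c s _ w(1,3)] by simp_all
  have 2: "stereographic_inv c 1 (snd w) \<in> stereographic_dom (-1) c"
    "stereographic (-1) c 1 (stereographic_inv c 1 (snd w)) = snd w"
    using stereographic_stereographic_inv[OF c _ _ w(2,4)] by simp_all
  show "w \<in> ?L"
    by (rule image_eqI[of _ _ "product_param_inv c s w"])
      (simp_all add: product_param_def product_param_inv_def product_dom_def 1 2)
qed

lemma local_param_product_param:
  fixes c s :: real
  assumes c: "0 < c" and s: "s = 1 \<or> s = -1"
  shows "local_param (sphere_times_hyperbolic c :: (_, 'e::euclidean_space \<times> 'e) riemannian)
    (product_dom c) (product_param c s)"
proof -
  let ?U = "product_dom c :: ('e \<times> 'e) set" and ?\<psi> = "product_param c s :: 'e \<times> 'e \<Rightarrow> _"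
  have U: "open ?U"
    unfolding product_dom_def by (intro open_Times open_stereographic_dom)
  have "smooth_on ?U (\<lambda>y. stereographic 1 c s (fst y))"
    by (rule smooth_on_linear_comp[OF U bounded_linear_fst _ smooth_on_stereographic]) (auto simp: product_dom_def)
  moreover have "smooth_on ?U (\<lambda>y. stereographic (-1) c 1 (snd y))"
    by (rule smooth_on_linear_comp[OF U bounded_linear_snd _ smooth_on_stereographic]) (auto simp: product_dom_def)
  ultimately have smooth: "smooth_on ?U ?\<psi>"
    unfolding product_param_def[abs_def] by (rule smooth_on_Pair[OF U])
  have \<phi>: "product_param_inv c s differentiable at w" if "w \<in> ?\<psi> ` ?U" for w
  proof -
    have "1 + s * sqrt c * snd (fst w) \<noteq> 0" "1 + 1 * sqrt c * snd (snd w) \<noteq> 0"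
      using that unfolding product_param_image[OF assms] by auto
    note d = this[THEN differentiable_stereographic_inv, unfolded frechet_derivative_works]
    show ?thesis
      unfolding product_param_inv_def[abs_def]
      by (rule differentiableI[OF has_derivative_Pair[OF
            has_derivative_compose[OF has_derivative_fst[OF has_derivative_ident] d(1)]
            has_derivative_compose[OF has_derivative_snd[OF has_derivative_ident] d(2)]]])
  qed
  have "inj (frechet_derivative ?\<psi> (at x))" if "x \<in> ?U" for x
    using smooth_on_has_derivative[OF smooth that] that
    by (intro inj_frechet_derivative_left_inverse[OF U that _ \<phi>] product_param_inv_product_param[OF assms])
      (auto intro: differentiableI)
  moreover have "openin (top_of_set (points (sphere_times_hyperbolic c))) (?\<psi> ` ?U)"
    unfolding product_param_image[OF assms]
    by (intro openin_open_Int open_Collect_conj open_Collect_less continuous_intros)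
  moreover have "homeomorphism ?U (?\<psi> ` ?U) ?\<psi> (product_param_inv c s)"
  proof
    show "continuous_on (?\<psi> ` ?U) (product_param_inv c s)"
      by (intro continuous_at_imp_continuous_on ballI differentiable_imp_continuous_within \<phi>)
    show "continuous_on ?U ?\<psi>"
      by (rule smooth_on_imp_continuous_on[OF smooth])
  qed (auto simp: product_param_inv_product_param[OF assms])
  ultimately show ?thesis
    using U smooth unfolding local_param_def by blast
qed

lemma local_param_covers:
  assumes c: "0 < c" and p: "p \<in> points (sphere_times_hyperbolic c :: (_, 'e::euclidean_space \<times> 'e) riemannian)"
  shows "\<exists>U \<psi>. local_param (sphere_times_hyperbolic c :: (_, 'e \<times> 'e) riemannian) U \<psi> \<and> p \<in> \<psi> ` U"
proof -
  \<comment> \<open>The pole is taken in the opposite hemisphere, so that both denominators are at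
    least 1 at \<open>p\<close>.\<close>
  define s :: real where "s = (if 0 \<le> snd (fst p) then 1 else -1)"
  have s: "s = 1 \<or> s = -1"
    by (simp add: s_def)
  have "0 \<le> sqrt c * (s * snd (fst p))" "0 \<le> sqrt c * snd (snd p)"
    using c p by (auto simp: s_def points_product)
  then have "p \<in> product_param c s ` product_dom c"
    using p unfolding product_param_image[OF c s] by (auto simp: mult_ac)
  with local_param_product_param[OF c s] show ?thesis
    by blast
qed

lemma riemannian_manifold_product:
  assumes "0 < c"
  shows "riemannian_manifold (sphere_times_hyperbolic c :: (_, 'e::euclidean_space \<times> 'e) riemannian)"
  unfolding riemannian_manifold_def
proof (intro conjI ballI allI impI)
  fix U :: "('e \<times> 'e) set" and \<psi> assume "local_param (sphere_times_hyperbolic c) U \<psi>"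
  then have chart: "product_chart c U \<psi>"
    by (rule product_chart_of_local_param[OF assms])
  show "inner_product (coord_metric (sphere_times_hyperbolic c) \<psi> x)" if "x \<in> U" for x
    unfolding coord_metric_product[OF chart] by (rule product_chart.inner_product_G[OF chart that])
  show "smooth_on U (\<lambda>x. coord_metric (sphere_times_hyperbolic c) \<psi> x u v)" for u v
    unfolding coord_metric_product[OF chart] by (rule product_chart.smooth_on_G[OF chart])
qed (rule local_param_covers[OF assms])

text \<open>The anti-Thorpe condition quantifies universally over charts and points; refuting it
  takes an actual chart with a point.\<close>

lemma local_param_nonempty:
  assumes "0 < c"
  obtains U \<psi> x where
    "local_param (sphere_times_hyperbolic c :: (_, 'e::euclidean_space \<times> 'e) riemannian) U \<psi>" "x \<in> U"
proof
  show "local_param (sphere_times_hyperbolic c :: (_, 'e \<times> 'e) riemannian) (product_dom c) (product_param c 1)"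
    by (rule local_param_product_param[OF assms]) simp
  show "0 \<in> (product_dom c :: ('e \<times> 'e) set)"
    by (simp add: product_dom_def stereographic_dom_def zero_prod_def)
qed

lemma dhodge_thorpe_form_product:
  fixes U :: "('e::euclidean_space \<times> 'e) set"
  assumes "0 < c" "local_param (sphere_times_hyperbolic c) U \<psi>" "x \<in> U" "2 * k \<le> DIM('e)"
  shows "dhodge (coord_metric (sphere_times_hyperbolic c) \<psi> x) DIM('e) DIM('e)
      (thorpe_form (coord_metric (sphere_times_hyperbolic c) \<psi>) x DIM('e) k)
    = (\<lambda>X Y. (-1) ^ k * thorpe_form (coord_metric (sphere_times_hyperbolic c) \<psi>) x DIM('e) k X Y)"
proof -
  have chart: "product_chart c U \<psi>"
    by (rule product_chart_of_local_param[OF assms(1,2)])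
  show ?thesis
    unfolding coord_metric_product[OF chart] by (rule product_chart.dhodge_thorpe_form[OF chart assms(3,4)])
qed

section \<open>The Thorpe and anti-Thorpe properties of the product\<close>

lemma thorpe_product:
  assumes "0 < c" "even k" "0 < k" "2 * k \<le> DIM('e)"
  shows "thorpe (2 * k) (sphere_times_hyperbolic c :: (_, 'e::euclidean_space \<times> 'e) riemannian)"
  unfolding thorpe_def
proof (rule conjI[OF riemannian_manifold_product[OF assms(1)]], rule exI[of _ "DIM('e)"], rule exI[of _ k],
    intro conjI allI impI ballI)
  fix U :: "('e \<times> 'e) set" and \<psi> x assume "local_param (sphere_times_hyperbolic c) U \<psi>" "x \<in> U"
  from dhodge_thorpe_form_product[OF assms(1) this assms(4)] assms(2)
  show "let g = coord_metric (sphere_times_hyperbolic c) \<psi> in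
      dhodge (g x) DIM('e) DIM('e) (thorpe_form g x DIM('e) k) = thorpe_form g x DIM('e) k"
    by (simp add: Let_def)
qed (use assms in auto)

lemma anti_thorpe_product:
  assumes "0 < c" "odd k" "2 * k \<le> DIM('e)"
  shows "anti_thorpe (2 * k) (sphere_times_hyperbolic c :: (_, 'e::euclidean_space \<times> 'e) riemannian)"
  unfolding anti_thorpe_def
proof (rule conjI[OF riemannian_manifold_product[OF assms(1)]], rule exI[of _ "DIM('e)"], rule exI[of _ k],
    intro conjI allI impI ballI)
  fix U :: "('e \<times> 'e) set" and \<psi> x assume "local_param (sphere_times_hyperbolic c) U \<psi>" "x \<in> U"
  from dhodge_thorpe_form_product[OF assms(1) this assms(3)] assms(2)
  show "let g = coord_metric (sphere_times_hyperbolic c) \<psi> in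
      dhodge (g x) DIM('e) DIM('e) (thorpe_form g x DIM('e) k) = (\<lambda>X Y. - thorpe_form g x DIM('e) k X Y)"
    by (simp add: Let_def)
qed (use assms in \<open>auto elim: oddE\<close>)

text \<open>For even \<open>k\<close> the star fixes the form; if it also negated it, the form would
  vanish at every point of every chart, against \<open>thorpe_form_nonzero\<close>.\<close>

lemma not_anti_thorpe_product:
  assumes "0 < c" "even k"
  shows "\<not> anti_thorpe (2 * k) (sphere_times_hyperbolic c :: (_, 'e::euclidean_space \<times> 'e) riemannian)"
proof
  let ?M = "sphere_times_hyperbolic c :: (_, 'e \<times> 'e) riemannian"
  assume "anti_thorpe (2 * k) ?M"
  then have k: "2 * k \<le> DIM('e)" and anti: "\<And>U \<psi> x. local_param ?M U \<psi> \<Longrightarrow> x \<in> U \<Longrightarrow>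
      dhodge (coord_metric ?M \<psi> x) DIM('e) DIM('e) (thorpe_form (coord_metric ?M \<psi>) x DIM('e) k)
        = (\<lambda>X Y. - thorpe_form (coord_metric ?M \<psi>) x DIM('e) k X Y)"
  proof -
    \<comment> \<open>The existentially quantified \<open>r\<close> and \<open>k'\<close> are forced
      by the dimension and the degree.\<close>
    obtain r k' where rk: "DIM('e \<times> 'e) = 2 * r" "2 * k = 2 * k'" "2 * k \<le> r"
      and eq: "\<forall>U \<psi>. local_param ?M U \<psi> \<longrightarrow> (\<forall>x\<in>U. let g = coord_metric ?M \<psi> in
        dhodge (g x) r r (thorpe_form g x r k') = (\<lambda>X Y. - thorpe_form g x r k' X Y))"
      using \<open>anti_thorpe (2 * k) ?M\<close> unfolding anti_thorpe_def by blast
    have r: "r = DIM('e)" and k': "k' = k"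
      using rk by simp_all
    show "2 * k \<le> DIM('e)"
      using rk(3) r by simp
    show "dhodge (coord_metric ?M \<psi> x) DIM('e) DIM('e) (thorpe_form (coord_metric ?M \<psi>) x DIM('e) k)
        = (\<lambda>X Y. - thorpe_form (coord_metric ?M \<psi>) x DIM('e) k X Y)"
      if "local_param ?M U \<psi>" "x \<in> U" for U \<psi> x
      using eq that unfolding r k' Let_def by blast
  qed
  obtain U \<psi> x where U: "local_param ?M U \<psi>" "x \<in> U"
    by (rule local_param_nonempty[OF assms(1)])
  have chart: "product_chart c U \<psi>"
    by (rule product_chart_of_local_param[OF assms(1) U(1)])
  obtain X Y where "thorpe_form (coord_metric ?M \<psi>) x DIM('e) k X Y \<noteq> 0"
    using product_chart.thorpe_form_nonzero[OF chart U(2) k] unfolding coord_metric_product[OF chart] by blast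
  moreover have "thorpe_form (coord_metric ?M \<psi>) x DIM('e) k X Y = - thorpe_form (coord_metric ?M \<psi>) x DIM('e) k X Y"
    using dhodge_thorpe_form_product[OF assms(1) U k] anti[OF U] assms(2) by (simp add: fun_eq_iff)
  ultimately show False
    by simp
qed

theorem corollary5p16:
  fixes c :: real and r :: nat
  assumes "0 < c" and "DIM('e::euclidean_space) = r"
  shows
    "(4 \<le> r \<longrightarrow>
        thorpe 4 (riemannian_product
          (round_sphere c :: ('e \<times> real, 'e) riemannian)
          (hyperbolic_space (- c) :: ('e \<times> real, 'e) riemannian)) \<and>
        \<not> anti_thorpe 4 (riemannian_product
          (round_sphere c :: ('e \<times> real, 'e) riemannian)
          (hyperbolic_space (- c) :: ('e \<times> real, 'e) riemannian))) \<and>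
     (6 \<le> r \<longrightarrow>
        thorpe 4 (riemannian_product
          (round_sphere c :: ('e \<times> real, 'e) riemannian)
          (hyperbolic_space (- c) :: ('e \<times> real, 'e) riemannian)) \<and>
        anti_thorpe 6 (riemannian_product
          (round_sphere c :: ('e \<times> real, 'e) riemannian)
          (hyperbolic_space (- c) :: ('e \<times> real, 'e) riemannian)))"
  \<comment> \<open>Degree 4 is the even case \<open>k = 2\<close>, degree 6 the odd case
    \<open>k = 3\<close>.\<close>
  using thorpe_product[where 'e = 'e, OF assms(1), of 2] not_anti_thorpe_product[where 'e = 'e, OF assms(1), of 2]
    anti_thorpe_product[where 'e = 'e, OF assms(1), of 3] assms(2)
  by simp

end
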